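(* Let $(M,g)$ be an $n$-dimensional compact Riemannian manifold, $f\in C^2(M)$, $d\mu=e^{-f}d\nu$ with $\nu$ the Riemannian volume measure, $m\ge n$ a constant, and $c\in(0,\infty)$. Let $u:(0,T)\to(0,\infty)$ be a smooth solution of the ODE $c^2u''+u'=\frac{1}{2u}$ and put $\alpha(t)=\frac{u'(t)}{u(t)}$. Let $(\rho,\phi)$ be a smooth solution on $M\times(0,T)$, with $\rho(\cdot,t)>0$ a probability density with respect to $\mu$, of $$\partial_t\rho-\nabla_\mu^*(\rho\nabla\phi)=0,\qquad c^2\left(\partial_t\phi+\tfrac12|\nabla\phi|^2\right)=-\phi-\log\rho-1 .$$ Then $$\frac{d^2}{dt^2}\mathrm{Ent}(\rho(t))+\left(2\alpha(t)+\frac1{c^2}\right)\frac{d}{dt}\mathrm{Ent}(\rho(t))+\frac1{c^2}\int_M\frac{|\nabla\rho(t)|^2}{\rho(t)}\,d\mu+m\alpha^2(t)$$ $$=\int_M\left[\left|\mathrm{Hess}\,\phi-\alpha(t)g\right|^2+\mathrm{Ric}_{m,n}(L)(\nabla\phi,\nabla\phi)\right]\rho\,d\mu+(m-n)\int_M\left|\alpha(t)+\frac{\nabla\phi\cdot\nabla f}{m-n}\right|^2\rho\,d\mu .$$ In particular, if $\mathrm{Ric}_{m,n}(L)\ge0$, then $$\frac{d^2}{dt^2}\mathrm{Ent}(\rho(t))+\left(2\alpha(t)+\frac1{c^2}\right)\frac{d}{dt}\mathrm{Ent}(\rho(t))+\frac1{c^2}\int_M\frac{|\nabla\rho(t)|^2}{\rho(t)}\,d\mu+m\alpha^2(t)\ge0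 .$$
   Context: $\mathrm{Ent}(\rho)=\int_M\rho\log\rho\,d\mu$. $\nabla_\mu^*X=-\nabla\cdot X+\langle\nabla f,X\rangle$ is the $L^2(\mu)$-adjoint of the gradient, $L=\Delta-\nabla f\cdot\nabla$. For $m>n$, $\mathrm{Ric}_{m,n}(L)=\mathrm{Ric}+\nabla^2f-\frac{\nabla f\otimes\nabla f}{m-n}$; when $m=n$, $f$ is required to be constant, $\mathrm{Ric}_{n,n}(L)=\mathrm{Ric}$, and the last integral term (with factor $m-n$) is taken to be $0$. *)

theory Defs
  imports "HOL-Analysis.Analysis"
begin

section \<open>Functions of class $C^k$ on open subsets of normed spaces\<close>

text \<open>To be used for open \<open>S\<close> and finite-dimensional domains, where continuity of all iterated
  directional derivatives up to order \<open>k\<close> is the usual notion of class $C^k$.\<close>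

primrec Ck_on :: "nat \<Rightarrow> 'v::real_normed_vector set \<Rightarrow> ('v \<Rightarrow> 'w::real_normed_vector) \<Rightarrow> bool" where
  "Ck_on 0 S h \<longleftrightarrow> continuous_on S h"
| "Ck_on (Suc k) S h \<longleftrightarrow> (\<forall>x\<in>S. h differentiable (at x)) \<and>
     (\<forall>v. Ck_on k S (\<lambda>x. frechet_derivative h (at x) v))"

definition smooth_on :: "'v::real_normed_vector set \<Rightarrow> ('v \<Rightarrow> 'w::real_normed_vector) \<Rightarrow> bool" where
  "smooth_on S h \<longleftrightarrow> (\<forall>k. Ck_on k S h)"

section \<open>Compact smooth manifolds\<close>

text \<open>A chart is a domain together with a coordinate map; only the values of the coordinate map
  on the domain matter.  The manifold is a subset \<open>M\<close> of a Hausdorff space with the subspace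
  topology, its smooth structure is given by an atlas \<open>A\<close> (maximality is not required), and its
  dimension is \<open>CARD('n)\<close>.  Charts have open images, so there is no boundary.\<close>

type_synonym ('a, 'n) chart = "'a set \<times> ('a \<Rightarrow> real^'n)"

definition dom :: "('a, 'n::finite) chart \<Rightarrow> 'a set" where
  "dom c = fst c"

definition coord :: "('a, 'n::finite) chart \<Rightarrow> 'a \<Rightarrow> real^'n" where
  "coord c = snd c"

definition coord_inv :: "('a, 'n::finite) chart \<Rightarrow> real^'n \<Rightarrow> 'a" where
  "coord_inv c = inv_into (dom c) (coord c)"

definition smooth_atlas :: "'a::t2_space set \<Rightarrow> ('a, 'n::finite) chart set \<Rightarrow> bool" where
  "smooth_atlas M A \<longleftrightarrow>
     M = (\<Union>c\<in>A. dom c) \<and>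
     (\<forall>c\<in>A. openin (top_of_set M) (dom c) \<and> open (coord c ` dom c) \<and>
        homeomorphism (dom c) (coord c ` dom c) (coord c) (coord_inv c)) \<and>
     (\<forall>c\<in>A. \<forall>d\<in>A. smooth_on (coord c ` (dom c \<inter> dom d)) (coord d \<circ> coord_inv c))"

definition Ck_function :: "('a, 'n::finite) chart set \<Rightarrow> nat \<Rightarrow> ('a \<Rightarrow> real) \<Rightarrow> bool" where
  "Ck_function A k h \<longleftrightarrow> (\<forall>c\<in>A. Ck_on k (coord c ` dom c) (h \<circ> coord_inv c))"

text \<open>Joint smoothness on $M \times I$ for an open interval \<open>I\<close>; the time argument comes first.\<close>

definition smooth_spacetime ::
    "('a, 'n::finite) chart set \<Rightarrow> real set \<Rightarrow> (real \<Rightarrow> 'a \<Rightarrow> real) \<Rightarrow> bool" where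
  "smooth_spacetime A I h \<longleftrightarrow>
     (\<forall>c\<in>A. smooth_on (coord c ` dom c \<times> I) (\<lambda>(z, t). h t (coord_inv c z)))"

section \<open>Tensor fields and Riemannian metrics\<close>

text \<open>Vector fields and covariant 2-tensor fields are families of components: the value at
  a chart \<open>c\<close> and a point \<open>p\<close> of its domain is the vector (or matrix) of components at \<open>p\<close> with
  respect to the coordinate frame of \<open>c\<close>.\<close>

type_synonym ('a, 'n) vector_field = "('a, 'n) chart \<Rightarrow> 'a \<Rightarrow> real^'n"
type_synonym ('a, 'n) tensor2 = "('a, 'n) chart \<Rightarrow> 'a \<Rightarrow> real^'n^'n"

definition jacobian_at ::
    "('a, 'n::finite) chart \<Rightarrow> ('a, 'n) chart \<Rightarrow> 'a \<Rightarrow> real^'n^'n" where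
  "jacobian_at c d p = matrix (frechet_derivative (coord d \<circ> coord_inv c) (at (coord c p)))"

definition riemannian_metric ::
    "('a, 'n::finite) chart set \<Rightarrow> ('a, 'n) tensor2 \<Rightarrow> bool" where
  "riemannian_metric A g \<longleftrightarrow>
     (\<forall>c\<in>A. smooth_on (coord c ` dom c) (g c \<circ> coord_inv c)) \<and>
     (\<forall>c\<in>A. \<forall>p\<in>dom c. transpose (g c p) = g c p \<and> (\<forall>v. v \<noteq> 0 \<longrightarrow> v \<bullet> (g c p *v v) > 0)) \<and>
     (\<forall>c\<in>A. \<forall>d\<in>A. \<forall>p\<in>dom c \<inter> dom d.
        g c p = transpose (jacobian_at c d p) ** g d p ** jacobian_at c d p)"

definition compact_riemannian_manifold ::
    "'a::t2_space set \<Rightarrow> ('a, 'n::finite) chart set \<Rightarrow> ('a, 'n) tensor2 \<Rightarrow> bool" where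
  "compact_riemannian_manifold M A g \<longleftrightarrow>
     compact M \<and> smooth_atlas M A \<and> riemannian_metric A g"

text \<open>The Riemannian volume is the Borel measure on \<open>M\<close> that in each chart has density
  $\sqrt{\det (g_{ij})}$ with respect to Lebesgue measure; this determines it uniquely.\<close>

definition riemannian_volume ::
    "'a::t2_space set \<Rightarrow> ('a, 'n::finite) chart set \<Rightarrow> ('a, 'n) tensor2 \<Rightarrow> 'a measure \<Rightarrow> bool" where
  "riemannian_volume M A g \<nu> \<longleftrightarrow>
     sets \<nu> = sets (restrict_space borel M) \<and>
     (\<forall>c\<in>A. \<forall>V\<in>sets borel. emeasure \<nu> {p \<in> dom c. coord c p \<in> V} =
        (\<integral>\<^sup>+z\<in>coord c ` dom c \<inter> V. ennreal (sqrt (det (g c (coord_inv c z)))) \<partial>lborel))"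

section \<open>Differential operators in local coordinates\<close>

definition partial :: "('a, 'n::finite) chart \<Rightarrow> 'n \<Rightarrow> ('a \<Rightarrow> real) \<Rightarrow> 'a \<Rightarrow> real" where
  "partial c i h p = frechet_derivative (h \<circ> coord_inv c) (at (coord c p)) (axis i 1)"

definition christoffel ::
    "('a, 'n::finite) tensor2 \<Rightarrow> ('a, 'n) chart \<Rightarrow> 'n \<Rightarrow> 'n \<Rightarrow> 'n \<Rightarrow> 'a \<Rightarrow> real" where
  "christoffel g c k i j p = (\<Sum>l\<in>UNIV. matrix_inv (g c p) $ k $ l *
     (partial c i (\<lambda>q. g c q $ j $ l) p + partial c j (\<lambda>q. g c q $ i $ l) p
        - partial c l (\<lambda>q. g c q $ i $ j) p)) / 2"

definition grad :: "('a, 'n::finite) tensor2 \<Rightarrow> ('a \<Rightarrow> real) \<Rightarrow> ('a, 'n) vector_field" where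
  "grad g h c p = matrix_inv (g c p) *v (\<chi> i. partial c i h p)"

definition Hess :: "('a, 'n::finite) tensor2 \<Rightarrow> ('a \<Rightarrow> real) \<Rightarrow> ('a, 'n) tensor2" where
  "Hess g h c p = (\<chi> i j. partial c i (partial c j h) p
     - (\<Sum>k\<in>UNIV. christoffel g c k i j p * partial c k h p))"

text \<open>\<open>curvature g c l k i j\<close> is $R^l{}_{kij}$, where
  $R(\partial_i,\partial_j)\partial_k = R^l{}_{kij}\,\partial_l$ and
  $R(X,Y) = \nabla_X\nabla_Y - \nabla_Y\nabla_X - \nabla_{[X,Y]}$.
  \<open>Ric(Y,Z)\<close> is the trace of $X \mapsto R(X,Y)Z$, which is positive on round spheres.\<close>

definition curvature ::
    "('a, 'n::finite) tensor2 \<Rightarrow> ('a, 'n) chart \<Rightarrow> 'n \<Rightarrow> 'n \<Rightarrow> 'n \<Rightarrow> 'n \<Rightarrow> 'a \<Rightarrow> real" where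
  "curvature g c l k i j p =
     partial c i (christoffel g c l j k) p - partial c j (christoffel g c l i k) p
     + (\<Sum>s\<in>UNIV. christoffel g c l i s p * christoffel g c s j k p
                - christoffel g c l j s p * christoffel g c s i k p)"

definition Ric :: "('a, 'n::finite) tensor2 \<Rightarrow> ('a, 'n) tensor2" where
  "Ric g c p = (\<chi> j k. \<Sum>i\<in>UNIV. curvature g c i k i j p)"

text \<open>Scalars built from component families do not depend on the chart; they are evaluated in
  an arbitrary chart around the point.\<close>

definition chart_at :: "('a, 'n::finite) chart set \<Rightarrow> 'a \<Rightarrow> ('a, 'n) chart" where
  "chart_at A p = (SOME c. c \<in> A \<and> p \<in> dom c)"

definition tensor_eval ::
    "('a, 'n::finite) chart set \<Rightarrow> ('a, 'n) tensor2 \<Rightarrow> ('a, 'n) vector_field \<Rightarrow>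
       ('a, 'n) vector_field \<Rightarrow> 'a \<Rightarrow> real" where
  "tensor_eval A S X Y p = (let c = chart_at A p in X c p \<bullet> (S c p *v Y c p))"

definition rinner ::
    "('a, 'n::finite) chart set \<Rightarrow> ('a, 'n) tensor2 \<Rightarrow> ('a, 'n) vector_field \<Rightarrow>
       ('a, 'n) vector_field \<Rightarrow> 'a \<Rightarrow> real" where
  "rinner A g X Y = tensor_eval A g X Y"

definition tensor_norm2 ::
    "('a, 'n::finite) chart set \<Rightarrow> ('a, 'n) tensor2 \<Rightarrow> ('a, 'n) tensor2 \<Rightarrow> 'a \<Rightarrow> real" where
  "tensor_norm2 A g S p = (let c = chart_at A p; h = matrix_inv (g c p) in
     \<Sum>i\<in>UNIV. \<Sum>j\<in>UNIV. \<Sum>k\<in>UNIV. \<Sum>l\<in>UNIV. h $ i $ k * h $ j $ l * S c p $ i $ j * S c p $ k $ l)"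

text \<open>The divergence is the trace of the covariant derivative.\<close>

definition divergence ::
    "('a, 'n::finite) chart set \<Rightarrow> ('a, 'n) tensor2 \<Rightarrow> ('a, 'n) vector_field \<Rightarrow> 'a \<Rightarrow> real" where
  "divergence A g X p = (let c = chart_at A p in
     \<Sum>i\<in>UNIV. partial c i (\<lambda>q. X c q $ i) p + (\<Sum>j\<in>UNIV. christoffel g c i i j p * X c p $ j))"

section \<open>Weighted objects\<close>

definition weighted_measure :: "'a measure \<Rightarrow> ('a \<Rightarrow> real) \<Rightarrow> 'a measure" where
  "weighted_measure \<nu> f = density \<nu> (\<lambda>p. ennreal (exp (- f p)))"

definition nabla_mu_adj ::
    "('a, 'n::finite) chart set \<Rightarrow> ('a, 'n) tensor2 \<Rightarrow> ('a \<Rightarrow> real) \<Rightarrow>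
       ('a, 'n) vector_field \<Rightarrow> 'a \<Rightarrow> real" where
  "nabla_mu_adj A g f X p = - divergence A g X p + rinner A g (grad g f) X p"

definition Ric_mn ::
    "real \<Rightarrow> ('a, 'n::finite) tensor2 \<Rightarrow> ('a \<Rightarrow> real) \<Rightarrow> ('a, 'n) tensor2" where
  "Ric_mn m g f c p =
     (if m = real CARD('n) then Ric g c p
      else Ric g c p + Hess g f c p
        - (\<chi> i j. partial c i f p * partial c j f p / (m - real CARD('n))))"

definition tensor_nonneg ::
    "('a, 'n::finite) chart set \<Rightarrow> ('a, 'n) tensor2 \<Rightarrow> bool" where
  "tensor_nonneg A S \<longleftrightarrow> (\<forall>c\<in>A. \<forall>p\<in>dom c. \<forall>v. v \<bullet> (S c p *v v) \<ge> 0)"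

definition Ent :: "'a measure \<Rightarrow> ('a \<Rightarrow> real) \<Rightarrow> real" where
  "Ent \<mu> r = (\<integral>p. r p * ln (r p) \<partial>\<mu>)"

end

(*
  Write L for the weighted Laplacian and <.,.> for the inner product of gradients.  The continuity
  equation reads rho_t = -(rho L phi + <rho, phi>), so Green's formula
  int <psi, phi> dmu = - int psi L phi dmu gives Ent' = int <rho, phi> dmu = - int rho L phi dmu.
  Differentiating once more and inserting the equation for phi_t,

    Ent'' + (Ent' + int |grad rho|^2 / rho dmu) / c^2
      = int rho (L (|grad phi|^2 / 2) - <phi, L phi>) dmu,

  and by the weighted Bochner formula the integrand on the right is
  rho (|Hess phi|^2 + (Ric + Hess f)(grad phi, grad phi)).  Since Laplace phi = L phi + <f, phi>,
  completing the two squares changes this by 2 alpha Ent' + m alpha^2.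

  Green's formula is reduced by a partition of unity to a single chart, where it says that the
  integral of a partial derivative of a compactly supported function vanishes.  The volume measure
  is given, so no change of variables is needed; and testing Green's formula in two charts against
  bump functions shows that L does not depend on the chart.
*)
theory Submission
  imports Defs
begin

section \<open>Functions of class $C^k$\<close>

text \<open>Tensors are families of components, and scalars are read in the chart
  \<open>chart_at A p\<close>, which varies with \<open>p\<close> without any regularity. For
  identities at a single point this is harmless, so the Bochner formula is proved in one chart.
  Integrating or differentiating L phi requires more: it has to be the same function in all charts.
  The transformation law of the Christoffel symbols would give this through second derivatives of
  the transition maps; the weak argument replaces it by the first-order law for gradients and the
  full support of the measure. Regularity is tight at one point: \<open>f\<close> is only C^2, hence
  L phi is only C^1, which just suffices for a test function in Green's formula. Ent' is
  differentiated in the form int <rho, phi> dmu. This form contains only first derivatives in space,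
  so a single mixed derivative in space and time has to be controlled.\<close>

lemma Ck_on_cong:
  assumes "open S" "\<And>x. x \<in> S \<Longrightarrow> h x = h' x"
  shows "Ck_on k S h \<longleftrightarrow> Ck_on k S h'"
  using assms(2)
proof (induction k arbitrary: h h')
  case 0
  then show ?case by (auto intro!: continuous_on_cong)
next
  case (Suc k)
  have d: "(h differentiable at x) \<longleftrightarrow> (h' differentiable at x)" if "x \<in> S" for x
    using has_derivative_transform_within_open[OF _ assms(1) that] Suc.prems
    unfolding differentiable_def by metis
  have e: "frechet_derivative h (at x) = frechet_derivative h' (at x)"
    if "x \<in> S" "h differentiable at x" for x
    using frechet_derivative_transform_within_open[OF that(2) assms(1) that(1)] Suc.prems by blast
  have "(\<forall>v. Ck_on k S (\<lambda>x. frechet_derivative h (at x) v)) \<longleftrightarrow>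
        (\<forall>v. Ck_on k S (\<lambda>x. frechet_derivative h' (at x) v))"
    if "\<forall>x\<in>S. h differentiable at x"
  proof (rule all_cong1)
    fix v
    show "Ck_on k S (\<lambda>x. frechet_derivative h (at x) v) = Ck_on k S (\<lambda>x. frechet_derivative h' (at x) v)"
      by (rule Suc.IH) (use e that in simp)
  qed
  then show ?case using d by (auto simp: Ck_on.simps)
qed

text \<open>Naming the derivative as an explicit \<open>D\<close> keeps the choice operator inside
  \<open>frechet_derivative\<close> out of the closure proofs that follow.\<close>

lemma Ck_on_SucI:
  assumes "open S" "\<And>x. x \<in> S \<Longrightarrow> (h has_derivative D x) (at x)" "\<And>v. Ck_on k S (\<lambda>x. D x v)"
  shows "Ck_on (Suc k) S h"
proof -
  have "D x = frechet_derivative h (at x)" if "x \<in> S" for x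
    using frechet_derivative_at assms(2) that by blast
  then have "Ck_on k S (\<lambda>x. frechet_derivative h (at x) v)" for v
    using Ck_on_cong[OF assms(1), of "\<lambda>x. D x v" "\<lambda>x. frechet_derivative h (at x) v" k] assms(3) by simp
  then show ?thesis using assms(2) by (auto simp: differentiable_def)
qed

lemma Ck_on_SucD:
  assumes "Ck_on (Suc k) S h" "x \<in> S"
  shows "(h has_derivative frechet_derivative h (at x)) (at x)"
  using assms frechet_derivative_works by auto

lemma Ck_on_Suc_imp: "Ck_on (Suc k) S h \<Longrightarrow> Ck_on k S h"
proof (induction k arbitrary: h)
  case 0
  then show ?case
    by (auto intro!: continuous_at_imp_continuous_on differentiable_imp_continuous_within)
next
  case (Suc k)
  then show ?case by (auto simp del: Ck_on.simps simp: Ck_on.simps(2)[of "Suc k"])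
       (auto simp: Suc.IH Ck_on.simps)
qed

lemma Ck_on_le: "Ck_on k S h \<Longrightarrow> j \<le> k \<Longrightarrow> Ck_on j S h"
  by (induction k) (use Ck_on_Suc_imp le_SucE in blast)+

lemma Ck_on_imp_continuous: "Ck_on k S h \<Longrightarrow> continuous_on S h"
  using Ck_on_le[of k S h 0] by simp

lemma Ck_on_const: "open S \<Longrightarrow> Ck_on k S (\<lambda>x. a)"
proof (induction k arbitrary: a)
  case (Suc k)
  then show ?case by (intro Ck_on_SucI[where D="\<lambda>_ _. 0"]) auto
qed auto

section \<open>Closure properties of the classes C^k\<close>

lemma Ck_on_bounded_linear:
  assumes "open S" "bounded_linear L" "Ck_on k S h"
  shows "Ck_on k S (\<lambda>x. L (h x))"
  using assms(3)
proof (induction k arbitrary: h)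
  case 0
  then show ?case using bounded_linear.continuous_on[OF assms(2)] by auto
next
  case (Suc k)
  then show ?case
    by (intro Ck_on_SucI[where D="\<lambda>x v. L (frechet_derivative h (at x) v)"] assms
         bounded_linear.has_derivative[OF assms(2)] Ck_on_SucD[OF Suc.prems]) auto
qed

lemma Ck_on_ident:
  assumes "open S" shows "Ck_on k S (\<lambda>x. x)"
proof (cases k)
  case (Suc j)
  then show ?thesis
    using Ck_on_SucI[of S "\<lambda>x. x" "\<lambda>_ v. v" j] assms Ck_on_const by auto
qed auto

lemma Ck_on_linear:
  assumes "open S" "bounded_linear L" shows "Ck_on k S L"
  using Ck_on_bounded_linear[OF assms Ck_on_ident[OF assms(1)]] by simp

lemma Ck_on_add:
  assumes "open S" "Ck_on k S h" "Ck_on k S h'"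
  shows "Ck_on k S (\<lambda>x. h x + h' x)"
  using assms(2,3)
proof (induction k arbitrary: h h')
  case 0
  then show ?case by (auto intro: continuous_on_add)
next
  case (Suc k)
  show ?case
    by (intro Ck_on_SucI[where D="\<lambda>x v. frechet_derivative h (at x) v + frechet_derivative h' (at x) v"]
         assms(1) has_derivative_add Ck_on_SucD[OF Suc.prems(1)] Ck_on_SucD[OF Suc.prems(2)] Suc.IH)
       (use Suc.prems in auto)
qed

lemma Ck_on_minus: "open S \<Longrightarrow> Ck_on k S h \<Longrightarrow> Ck_on k S (\<lambda>x. - h x)"
  using Ck_on_bounded_linear[of S uminus k h] bounded_linear_minus[OF bounded_linear_ident] by auto

lemma Ck_on_diff:
  assumes "open S" "Ck_on k S h" "Ck_on k S h'"
  shows "Ck_on k S (\<lambda>x. h x - h' x)"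
  using Ck_on_add[OF assms(1,2) Ck_on_minus[OF assms(1,3)]] by simp

lemma Ck_on_sum:
  assumes "open S" "\<And>i. i \<in> I \<Longrightarrow> Ck_on k S (h i)"
  shows "Ck_on k S (\<lambda>x. \<Sum>i\<in>I. h i x)"
proof (cases "finite I")
  case True
  then show ?thesis using assms(2)
    by (induction I rule: finite_induct) (auto intro: Ck_on_const Ck_on_add assms(1))
qed (simp add: Ck_on_const assms)

lemma Ck_on_scaleR:
  fixes h :: "'v::real_normed_vector \<Rightarrow> real" and h' :: "'v \<Rightarrow> 'w::real_normed_vector"
  assumes "open S" "Ck_on k S h" "Ck_on k S h'"
  shows "Ck_on k S (\<lambda>x. h x *\<^sub>R h' x)"
  using assms(2,3)
proof (induction k arbitrary: h h')
  case 0
  then show ?case by (auto intro: continuous_on_scaleR)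
next
  case (Suc k)
  show ?case
    by (intro Ck_on_SucI[where D="\<lambda>x v. h x *\<^sub>R frechet_derivative h' (at x) v + frechet_derivative h (at x) v *\<^sub>R h' x"]
         assms(1) has_derivative_scaleR Ck_on_SucD[OF Suc.prems(1)] Ck_on_SucD[OF Suc.prems(2)] Suc.IH Ck_on_add)
       (use Suc.prems Ck_on_Suc_imp[of k S] in auto)
qed

lemma Ck_on_mult:
  fixes h h' :: "'v::real_normed_vector \<Rightarrow> real"
  assumes "open S" "Ck_on k S h" "Ck_on k S h'"
  shows "Ck_on k S (\<lambda>x. h x * h' x)"
  using Ck_on_scaleR[OF assms] by simp

lemma Ck_on_prod:
  fixes h :: "'i \<Rightarrow> 'v::real_normed_vector \<Rightarrow> real"
  assumes "open S" "\<And>i. i \<in> I \<Longrightarrow> Ck_on k S (h i)"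
  shows "Ck_on k S (\<lambda>x. \<Prod>i\<in>I. h i x)"
proof (cases "finite I")
  case True
  then show ?thesis using assms(2)
    by (induction I rule: finite_induct) (auto intro: Ck_on_const Ck_on_mult assms(1))
qed (simp add: Ck_on_const assms)

lemma Ck_on_inverse:
  fixes h :: "'v::real_normed_vector \<Rightarrow> real"
  assumes "open S" "\<And>x. x \<in> S \<Longrightarrow> h x \<noteq> 0" "Ck_on k S h"
  shows "Ck_on k S (\<lambda>x. inverse (h x))"
  using assms(3)
proof (induction k)
  case 0
  then show ?case using assms(2) by (auto intro: continuous_on_inverse)
next
  case (Suc k)
  have "Ck_on k S (\<lambda>x. inverse (h x))" using Suc Ck_on_Suc_imp by blast
  then show ?case
    by (intro Ck_on_SucI[where D="\<lambda>x v. - (inverse (h x) * frechet_derivative h (at x) v * inverse (h x))"]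
         assms(1) Deriv.has_derivative_inverse assms(2) Ck_on_SucD[OF Suc.prems] Ck_on_minus Ck_on_mult)
       (use Suc.prems in auto)
qed

lemma Ck_on_divide:
  fixes h h' :: "'v::real_normed_vector \<Rightarrow> real"
  assumes "open S" "\<And>x. x \<in> S \<Longrightarrow> h' x \<noteq> 0" "Ck_on k S h" "Ck_on k S h'"
  shows "Ck_on k S (\<lambda>x. h x / h' x)"
  unfolding divide_inverse by (intro Ck_on_mult Ck_on_inverse assms) (use assms in auto)

lemma Ck_on_exp:
  fixes h :: "'v::real_normed_vector \<Rightarrow> real"
  assumes "open S" "Ck_on k S h"
  shows "Ck_on k S (\<lambda>x. exp (h x))"
  using assms(2)
proof (induction k)
  case 0
  then show ?case by (auto intro: continuous_on_exp)
next
  case (Suc k)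
  have "Ck_on k S (\<lambda>x. exp (h x))" using Suc Ck_on_Suc_imp by blast
  then show ?case
    by (intro Ck_on_SucI[where D="\<lambda>x v. exp (h x) * frechet_derivative h (at x) v"] assms(1) Ck_on_mult)
       (use Suc.prems Ck_on_SucD[OF Suc.prems] in \<open>auto intro!: derivative_eq_intros\<close>)
qed

lemma Ck_on_ln:
  fixes h :: "'v::real_normed_vector \<Rightarrow> real"
  assumes "open S" "\<And>x. x \<in> S \<Longrightarrow> h x > 0" "Ck_on k S h"
  shows "Ck_on k S (\<lambda>x. ln (h x))"
proof (cases k)
  case 0
  then show ?thesis using assms by (auto intro!: continuous_on_ln) fastforce
next
  case (Suc j)
  then have c: "Ck_on (Suc j) S h" using assms(3) by simp
  have nz: "x \<in> S \<Longrightarrow> h x \<noteq> 0" for x using assms(2)[of x] by simp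
  have "Ck_on (Suc j) S (\<lambda>x. ln (h x))"
    by (intro Ck_on_SucI[where D="\<lambda>x v. frechet_derivative h (at x) v * inverse (h x)"] assms(1) Ck_on_mult Ck_on_inverse)
       (use c Ck_on_Suc_imp[OF c] Ck_on_SucD[OF c] assms(2) nz in \<open>auto intro!: derivative_eq_intros simp: divide_inverse\<close>)
  then show ?thesis using Suc by simp
qed

text \<open>In the chain rule the outer derivative is applied to a direction that moves with the
  point, whereas the induction hypothesis concerns fixed directions. Expanding the moving direction
  in \<open>Basis\<close> gives a finite sum of scalar coefficients times derivatives of
  \<open>h\<close> in fixed directions; hence the Euclidean target of \<open>\<tau>\<close>.\<close>

lemma Ck_on_compose:
  fixes \<tau> :: "'v::real_normed_vector \<Rightarrow> 'w::euclidean_space" and h :: "'w \<Rightarrow> 'z::real_normed_vector"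
  assumes "open T" "\<tau> ` T \<subseteq> S" "Ck_on k T \<tau>" "Ck_on k S h"
  shows "Ck_on k T (\<lambda>x. h (\<tau> x))"
  using assms(3,4)
proof (induction k arbitrary: h)
  case 0
  then show ?case using assms(2) by (auto intro: continuous_on_compose2)
next
  case (Suc k)
  have dt: "(\<tau> has_derivative frechet_derivative \<tau> (at x)) (at x)" if "x \<in> T" for x
    using Ck_on_SucD[OF Suc.prems(1) that] .
  have dh: "(h has_derivative frechet_derivative h (at (\<tau> x))) (at (\<tau> x))" if "x \<in> T" for x
    using Ck_on_SucD[OF Suc.prems(2)] assms(2) that by blast
  show ?case
  proof (rule Ck_on_SucI[OF assms(1), where D="\<lambda>x v. \<Sum>b\<in>Basis. (frechet_derivative \<tau> (at x) v \<bullet> b) *\<^sub>R frechet_derivative h (at (\<tau> x)) b"])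
    fix x assume x: "x \<in> T"
    interpret l: linear "frechet_derivative h (at (\<tau> x))" using dh[OF x] has_derivative_linear by blast
    have eq: "frechet_derivative h (at (\<tau> x)) w = (\<Sum>b\<in>Basis. (w \<bullet> b) *\<^sub>R frechet_derivative h (at (\<tau> x)) b)" for w
      by (subst euclidean_representation[of w, symmetric]) (simp only: l.sum l.scaleR)
    have "((\<lambda>x. h (\<tau> x)) has_derivative (\<lambda>v. frechet_derivative h (at (\<tau> x)) (frechet_derivative \<tau> (at x) v))) (at x)"
      using has_derivative_compose[OF dt[OF x] dh[OF x]] .
    then show "((\<lambda>x. h (\<tau> x)) has_derivative (\<lambda>v. \<Sum>b\<in>Basis. (frechet_derivative \<tau> (at x) v \<bullet> b) *\<^sub>R frechet_derivative h (at (\<tau> x)) b)) (at x)"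
      by (simp only: eq[symmetric])
  next
    fix v
    show "Ck_on k T (\<lambda>x. \<Sum>b\<in>Basis. (frechet_derivative \<tau> (at x) v \<bullet> b) *\<^sub>R frechet_derivative h (at (\<tau> x)) b)"
      by (intro Ck_on_sum Ck_on_scaleR assms(1) Ck_on_bounded_linear[OF _ bounded_linear_inner_left] Suc.IH Ck_on_Suc_imp[OF Suc.prems(1)])
         (use Suc.prems in auto)
  qed
qed

text \<open>Schwarz's theorem by the second difference over a small parallelogram, which is
  symmetric in the two directions. Either order of the mean value theorem writes it as
  \<open>r * r\<close> times a mixed derivative at a nearby point, and continuity moves both points
  to \<open>x\<close>.\<close>

lemma frechet_derivative_symmetric:
  fixes h :: "'v::real_normed_vector \<Rightarrow> real"
  assumes S: "open S" and h: "Ck_on 2 S h" and x: "x \<in> S"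
  shows "frechet_derivative (\<lambda>y. frechet_derivative h (at y) v) (at x) w
       = frechet_derivative (\<lambda>y. frechet_derivative h (at y) w) (at x) v"
proof (rule ccontr)
  define D2 where "D2 = (\<lambda>a b y. frechet_derivative (\<lambda>y. frechet_derivative h (at y) a) (at y) b)"
  have h2: "Ck_on (Suc (Suc 0)) S h" using h by (simp add: numeral_2_eq_2)
  have d1: "(h has_derivative frechet_derivative h (at y)) (at y)" if "y \<in> S" for y
    using Ck_on_SucD[OF h2 that] .
  have h1: "Ck_on (Suc 0) S (\<lambda>y. frechet_derivative h (at y) a)" for a using h2 by (simp only: Ck_on.simps(2)[of "Suc 0"]) 
  have d2: "((\<lambda>y. frechet_derivative h (at y) a) has_derivative (\<lambda>b. D2 a b y)) (at y)" if "y \<in> S" for y a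
    unfolding D2_def using Ck_on_SucD[OF h1 that] .
  have cont: "continuous_on S (D2 a b)" for a b
    using h1[of a] unfolding D2_def by simp
  assume "\<not> ?thesis"
  then have ne: "D2 v w x \<noteq> D2 w v x" unfolding D2_def .
  \<comment> \<open>Half the supposed gap: two errors below \<open>e\<close> cannot bridge
    it.\<close>
  define e where "e = \<bar>D2 v w x - D2 w v x\<bar> / 2"
  have e: "e > 0" using ne e_def by simp
  have "\<exists>d>0. \<forall>y\<in>S. dist y x < d \<longrightarrow> \<bar>D2 a b y - D2 a b x\<bar> < e" for a b
    using cont[of a b] x e unfolding continuous_on_iff dist_real_def by blast
  then obtain d1' d2' where dd: "d1' > 0" "d2' > 0"
      "\<And>y. y \<in> S \<Longrightarrow> dist y x < d1' \<Longrightarrow> \<bar>D2 v w y - D2 v w x\<bar> < e"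
      "\<And>y. y \<in> S \<Longrightarrow> dist y x < d2' \<Longrightarrow> \<bar>D2 w v y - D2 w v x\<bar> < e" by metis
  obtain d0 where d0: "d0 > 0" "ball x d0 \<subseteq> S" using S x open_contains_ball by blast
  define d where "d = min d0 (min d1' d2')"
  have d: "d > 0" using dd d0 d_def by simp
  \<comment> \<open>Chosen so that the parallelogram with sides \<open>r\<close> times
    \<open>v\<close> and \<open>w\<close> stays within distance \<open>d\<close> of
    \<open>x\<close>; the summand 1 keeps the denominator positive when both directions
    vanish.\<close>
  define r where "r = d / (2 * (norm v + norm w + 1))"
  have nn: "norm v + norm w + 1 > 0" using norm_ge_zero[of v] norm_ge_zero[of w] by linarith
  have r: "r > 0" using d nn r_def by simp
  have close: "dist (x + s *\<^sub>R v + t *\<^sub>R w) x < d" if "0 \<le> s" "s \<le> r" "0 \<le> t" "t \<le> r" for s t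
  proof -
    have "norm (s *\<^sub>R v + t *\<^sub>R w) \<le> s * norm v + t * norm w"
      using norm_triangle_ineq[of "s *\<^sub>R v" "t *\<^sub>R w"] that by simp
    also have "\<dots> \<le> r * norm v + r * norm w" using that by (intro add_mono mult_right_mono) auto
    also have "\<dots> < r * (2 * (norm v + norm w + 1))" using r nn norm_ge_zero[of v] norm_ge_zero[of w]
      by (simp add: algebra_simps add_nonneg_pos add_pos_nonneg)
    also have "\<dots> = d" using nn r_def by simp
    finally show ?thesis by (simp add: dist_norm add.assoc)
  qed
  have inS: "x + s *\<^sub>R v + t *\<^sub>R w \<in> S" if "0 \<le> s" "s \<le> r" "0 \<le> t" "t \<le> r" for s t
    using close[OF that] d0(2) unfolding d_def by (auto simp: dist_commute subset_iff)
  \<comment> \<open>The mean value theorem is used twice: in direction \<open>a\<close> for the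
    increment \<open>q\<close> across the \<open>b\<close> side, then in direction \<open>b\<close>
    for the resulting derivative.\<close>
  have mv: "\<exists>s t. 0 \<le> s \<and> s \<le> r \<and> 0 \<le> t \<and> t \<le> r \<and>
      h (x + r *\<^sub>R a + r *\<^sub>R b) - h (x + r *\<^sub>R a) - h (x + r *\<^sub>R b) + h x = r * r * D2 a b (x + s *\<^sub>R a + t *\<^sub>R b)"
    if inS: "\<And>s t. \<lbrakk>0 \<le> s; s \<le> r; 0 \<le> t; t \<le> r\<rbrakk> \<Longrightarrow> x + s *\<^sub>R a + t *\<^sub>R b \<in> S" for a b
  proof -
    define q where "q = (\<lambda>s. h (x + s *\<^sub>R a + r *\<^sub>R b) - h (x + s *\<^sub>R a))"
    define q' where "q' = (\<lambda>s. frechet_derivative h (at (x + s *\<^sub>R a + r *\<^sub>R b)) a - frechet_derivative h (at (x + s *\<^sub>R a)) a)"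
    have "(q has_real_derivative q' s) (at s)" if "0 \<le> s" "s \<le> r" for s
    proof -
      have i1: "x + s *\<^sub>R a + r *\<^sub>R b \<in> S" using inS[OF that, of r] r by simp
      have i2: "x + s *\<^sub>R a \<in> S" using inS[OF that, of 0] r by simp
      interpret l1: linear "frechet_derivative h (at (x + s *\<^sub>R a + r *\<^sub>R b))" using d1[OF i1] has_derivative_linear by blast
      interpret l2: linear "frechet_derivative h (at (x + s *\<^sub>R a))" using d1[OF i2] has_derivative_linear by blast
      have a1: "((\<lambda>s. x + s *\<^sub>R a + r *\<^sub>R b) has_derivative (\<lambda>u. u *\<^sub>R a)) (at s)" by (auto intro!: derivative_eq_intros)
      have a2: "((\<lambda>s. x + s *\<^sub>R a) has_derivative (\<lambda>u. u *\<^sub>R a)) (at s)" by (auto intro!: derivative_eq_intros)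
      show ?thesis
        unfolding has_field_derivative_def q_def
        using has_derivative_diff[OF has_derivative_compose[OF a1 d1[OF i1]] has_derivative_compose[OF a2 d1[OF i2]]]
        by (rule has_derivative_eq_rhs) (simp add: q'_def l1.scaleR l2.scaleR right_diff_distrib fun_eq_iff mult.commute)
    qed
    then obtain s where s: "0 < s" "s < r" "q r - q 0 = (r - 0) * q' s"
      using MVT2[of 0 r q q'] r by auto
    define p where "p = (\<lambda>t. frechet_derivative h (at (x + s *\<^sub>R a + t *\<^sub>R b)) a)"
    have "(p has_real_derivative D2 a b (x + s *\<^sub>R a + t *\<^sub>R b)) (at t)" if "0 \<le> t" "t \<le> r" for t
    proof -
      have i1: "x + s *\<^sub>R a + t *\<^sub>R b \<in> S" using inS[of s t] s that by simp
      interpret l1: linear "\<lambda>c. D2 a c (x + s *\<^sub>R a + t *\<^sub>R b)" using d2[OF i1, of a] has_derivative_linear by blast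
      have a1: "((\<lambda>t. x + s *\<^sub>R a + t *\<^sub>R b) has_derivative (\<lambda>u. u *\<^sub>R b)) (at t)" by (auto intro!: derivative_eq_intros)
      show ?thesis
        unfolding has_field_derivative_def p_def
        using has_derivative_compose[OF a1 d2[OF i1, of a]]
        by (rule has_derivative_eq_rhs) (simp add: l1.scaleR fun_eq_iff mult.commute)
    qed
    then obtain t where t: "0 < t" "t < r" "p r - p 0 = (r - 0) * D2 a b (x + s *\<^sub>R a + t *\<^sub>R b)"
      using MVT2[of 0 r p "\<lambda>t. D2 a b (x + s *\<^sub>R a + t *\<^sub>R b)"] r by auto
    have "q' s = p r - p 0" unfolding q'_def p_def by simp
    then have "q r - q 0 = r * r * D2 a b (x + s *\<^sub>R a + t *\<^sub>R b)" using s t by simp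
    then show ?thesis using s t unfolding q_def
      by (intro exI[of _ s] exI[of _ t]) (auto simp: algebra_simps)
  qed
  obtain s t where st: "0 \<le> s" "s \<le> r" "0 \<le> t" "t \<le> r"
     "h (x + r *\<^sub>R v + r *\<^sub>R w) - h (x + r *\<^sub>R v) - h (x + r *\<^sub>R w) + h x = r * r * D2 v w (x + s *\<^sub>R v + t *\<^sub>R w)"
    using mv[of v w] inS by blast
  have inS': "x + s *\<^sub>R w + t *\<^sub>R v \<in> S" if "0 \<le> s" "s \<le> r" "0 \<le> t" "t \<le> r" for s t
    using inS[of t s] that by (simp add: algebra_simps)
  obtain s' t' where st': "0 \<le> s'" "s' \<le> r" "0 \<le> t'" "t' \<le> r"
     "h (x + r *\<^sub>R w + r *\<^sub>R v) - h (x + r *\<^sub>R w) - h (x + r *\<^sub>R v) + h x = r * r * D2 w v (x + s' *\<^sub>R w + t' *\<^sub>R v)"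
    using mv[of w v] inS' by blast
  have sw: "x + s' *\<^sub>R w + t' *\<^sub>R v = x + t' *\<^sub>R v + s' *\<^sub>R w" by (simp add: algebra_simps)
  have sw2: "x + r *\<^sub>R w + r *\<^sub>R v = x + r *\<^sub>R v + r *\<^sub>R w" by (simp add: algebra_simps)
  have "r * r * D2 v w (x + s *\<^sub>R v + t *\<^sub>R w) = r * r * D2 w v (x + s' *\<^sub>R w + t' *\<^sub>R v)"
    using st(5) st'(5) unfolding sw2 by linarith
  then have "D2 v w (x + s *\<^sub>R v + t *\<^sub>R w) = D2 w v (x + s' *\<^sub>R w + t' *\<^sub>R v)" using r by simp
  moreover have "\<bar>D2 v w (x + s *\<^sub>R v + t *\<^sub>R w) - D2 v w x\<bar> < e"
    using dd(3) inS[OF st(1-4)] close[OF st(1-4)] d_def by simp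
  moreover have "\<bar>D2 w v (x + s' *\<^sub>R w + t' *\<^sub>R v) - D2 w v x\<bar> < e"
    unfolding sw using dd(4) inS[OF st'(3,4,1,2)] close[OF st'(3,4,1,2)] d_def by simp
  ultimately show False unfolding e_def by (simp add: abs_if split: if_splits)
qed

text \<open>Only the corner at 0 is delicate: there the square makes the difference quotient at most
  \<open>\<bar>y\<bar>\<close>.\<close>

lemma has_derivative_pos_part_square:
  "((\<lambda>s::real. (max 0 s)\<^sup>2) has_derivative (\<lambda>u. 2 * max 0 s * u)) (at s)"
proof -
  consider "s > 0" | "s < 0" | "s = 0" by linarith
  then show ?thesis
  proof cases
    case 1
    have "((\<lambda>s::real. s\<^sup>2) has_derivative (\<lambda>u. 2 * max 0 s * u)) (at s)"
      using 1 by (auto intro!: derivative_eq_intros)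
    then show ?thesis
      by (rule has_derivative_transform_within_open[where s="{0<..}"]) (use 1 in auto)
  next
    case 2
    have "((\<lambda>s::real. 0) has_derivative (\<lambda>u. 2 * max 0 s * u)) (at s)"
      using 2 by (auto intro!: derivative_eq_intros)
    then show ?thesis
      by (rule has_derivative_transform_within_open[where s="{..<0}"]) (use 2 in auto)
  next
    case 3
    have "((\<lambda>y. (max 0 y)\<^sup>2 / y) \<longlongrightarrow> (0::real)) (at 0)"
    proof (rule Lim_null_comparison)
      show "eventually (\<lambda>y::real. norm ((max 0 y)\<^sup>2 / y) \<le> \<bar>y\<bar>) (at 0)"
        by (rule always_eventually) (auto simp: max_def power2_eq_square)
      show "((\<lambda>y::real. \<bar>y\<bar>) \<longlongrightarrow> 0) (at 0)" by (rule tendsto_rabs_zero) auto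
    qed
    then have "((\<lambda>s::real. (max 0 s)\<^sup>2) has_real_derivative 0) (at 0)"
      by (simp add: has_field_derivative_iff)
    then show ?thesis using 3 by (simp add: has_field_derivative_def lambda_zero)
  qed
qed

text \<open>The square makes this bump function $C^1$, which is all that Green's formula asks of a test function.\<close>

definition bump :: "'v::real_inner \<Rightarrow> real \<Rightarrow> 'v \<Rightarrow> real" where
  "bump a r z = (max 0 (r\<^sup>2 - (z - a) \<bullet> (z - a)))\<^sup>2"

lemma bump_nonneg: "bump a r z \<ge> 0" by (simp add: bump_def)

lemma bump_pos: "r > 0 \<Longrightarrow> z \<in> ball a r \<Longrightarrow> bump a r z > 0"
  unfolding bump_def
  by (simp add: dist_norm norm_minus_commute power2_norm_eq_inner[symmetric] max_def power_strict_mono)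

lemma bump_zero: "r > 0 \<Longrightarrow> z \<notin> ball a r \<Longrightarrow> bump a r z = 0"
  unfolding bump_def
  by (simp add: dist_norm norm_minus_commute power2_norm_eq_inner[symmetric] max_def power_mono)

lemma Ck_on_bump: "Ck_on 1 UNIV (bump (a::'v::real_inner) r)"
proof -
  have "Ck_on (Suc 0) UNIV (bump a r)"
  proof (rule Ck_on_SucI[where D="\<lambda>z v. 2 * max 0 (r\<^sup>2 - (z - a) \<bullet> (z - a)) * (- 2 * ((z - a) \<bullet> v))"])
    fix z :: 'v
    have "((\<lambda>z. r\<^sup>2 - (z - a) \<bullet> (z - a)) has_derivative (\<lambda>v. - 2 * ((z - a) \<bullet> v))) (at z)"
      by (auto intro!: derivative_eq_intros simp: inner_commute)
    from has_derivative_compose[OF this has_derivative_pos_part_square]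
    show "(bump a r has_derivative (\<lambda>v. 2 * max 0 (r\<^sup>2 - (z - a) \<bullet> (z - a)) * (- 2 * ((z - a) \<bullet> v)))) (at z)"
      unfolding bump_def[abs_def] .
  qed (auto intro!: continuous_intros)
  then show ?thesis by simp
qed

section \<open>Positive definite matrices and determinants\<close>

lemma invertible_matrix_inv:
  assumes "invertible (A :: real^'n^'n)"
  shows "A ** matrix_inv A = mat 1" "matrix_inv A ** A = mat 1"
  using someI_ex[OF assms[unfolded invertible_def]] unfolding matrix_inv_def by auto

lemma sum_swap4:
  "(\<Sum>i\<in>A. \<Sum>j\<in>B. \<Sum>a\<in>C. \<Sum>b\<in>D. F i j a b) = (\<Sum>a\<in>C. \<Sum>b\<in>D. \<Sum>i\<in>A. \<Sum>j\<in>B. F i j a b)"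
proof -
  have "(\<Sum>i\<in>A. \<Sum>j\<in>B. \<Sum>a\<in>C. \<Sum>b\<in>D. F i j a b) = (\<Sum>i\<in>A. \<Sum>a\<in>C. \<Sum>j\<in>B. \<Sum>b\<in>D. F i j a b)"
    by (rule sum.cong[OF refl], rule sum.swap)
  also have "\<dots> = (\<Sum>a\<in>C. \<Sum>i\<in>A. \<Sum>j\<in>B. \<Sum>b\<in>D. F i j a b)" by (rule sum.swap)
  also have "\<dots> = (\<Sum>a\<in>C. \<Sum>i\<in>A. \<Sum>b\<in>D. \<Sum>j\<in>B. F i j a b)"
    by (intro sum.cong[OF refl], rule sum.swap)
  also have "\<dots> = (\<Sum>a\<in>C. \<Sum>b\<in>D. \<Sum>i\<in>A. \<Sum>j\<in>B. F i j a b)"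
    by (rule sum.cong[OF refl], rule sum.swap)
  finally show ?thesis .
qed

lemma matrix_inv_unique:
  fixes A B :: "real^'n^'n"
  assumes "A ** B = mat 1"
  shows "matrix_inv A = B"
proof -
  have "invertible A" using assms invertible_right_inverse by blast
  then have "matrix_inv A ** A = mat 1" by (rule invertible_matrix_inv)
  then have "matrix_inv A ** A ** B = B" by simp
  then show ?thesis using assms by (simp add: matrix_mul_assoc[symmetric])
qed

text \<open>Induction over the index set. Fewer than \<open>CARD('n)\<close> vectors
  \<open>A *v e b\<close> do not span, so some nonzero vector is Euclidean-orthogonal to all of
  them, that is, orthogonal to the \<open>e b\<close> for the form \<open>A\<close>; positivity
  allows its normalisation.\<close>

lemma gram_schmidt:
  fixes A :: "real^'n^'n"
  assumes sym: "transpose A = A" and pos: "\<And>v. v \<noteq> 0 \<Longrightarrow> v \<bullet> (A *v v) > 0"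
  shows "\<exists>e::'n \<Rightarrow> real^'n. \<forall>a b. e a \<bullet> (A *v e b) = (if a = b then 1 else 0)"
proof -
  have comm: "v \<bullet> (A *v w) = w \<bullet> (A *v v)" for v w
    using dot_lmul_matrix[of v A w] sym
    by (metis inner_commute transpose_matrix_vector)
  have "\<exists>e::'n \<Rightarrow> real^'n. \<forall>a\<in>B. \<forall>b\<in>B. e a \<bullet> (A *v e b) = (if a = b then 1 else 0)" for B :: "'n set"
  proof (induction B rule: finite_induct[OF finite])
    case 1
    then show ?case by simp
  next
    case (2 x B)
    then obtain e :: "'n \<Rightarrow> real^'n" where e: "\<forall>a\<in>B. \<forall>b\<in>B. e a \<bullet> (A *v e b) = (if a = b then 1 else 0)" by blast
    have "card B < card (insert x B)" using 2 by simp
    also have "\<dots> \<le> CARD('n)" by (intro card_mono) auto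
    finally have "card B < CARD('n)" .
    moreover have "dim ((\<lambda>b. A *v e b) ` B) \<le> card B"
      using dim_le_card'[of "(\<lambda>b. A *v e b) ` B"] card_image_le[of B "\<lambda>b. A *v e b"] by simp
    ultimately have "dim ((\<lambda>b. A *v e b) ` B) < DIM(real^'n)" by simp
    then obtain v where v: "v \<noteq> 0" "\<And>y. y \<in> span ((\<lambda>b. A *v e b) ` B) \<Longrightarrow> orthogonal v y"
      using orthogonal_to_subspace_exists by blast
    have vb: "v \<bullet> (A *v e b) = 0" if "b \<in> B" for b
      using v(2)[OF span_base, of "A *v e b"] that by (auto simp: orthogonal_def)
    define N where "N = v \<bullet> (A *v v)"
    have N: "N > 0" using pos v N_def by simp
    define e' where "e' = e(x := (1 / sqrt N) *\<^sub>R v)"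
    have "e' a \<bullet> (A *v e' b) = (if a = b then 1 else 0)" if "a \<in> insert x B" "b \<in> insert x B" for a b
    proof -
      have xx: "e' x \<bullet> (A *v e' x) = 1"
        using N by (simp add: e'_def matrix_vector_mult_scaleR N_def[symmetric])
      have xb: "e' x \<bullet> (A *v e' b) = 0" if "b \<in> B" for b
        using that vb 2(2) by (auto simp: e'_def)
      have bx: "e' b \<bullet> (A *v e' x) = 0" if "b \<in> B" for b
        using xb[OF that] comm by metis
      have eB: "e' b = e b" if "b \<in> B" for b using that 2(2) by (auto simp: e'_def)
      show ?thesis using that xx xb bx e 2(2) eB by (cases "a = x"; cases "b = x") auto
    qed
    then show ?case by blast
  qed
  from this[of UNIV] show ?thesis by simp
qed

text \<open>The columns of \<open>E\<close> are orthonormal for \<open>A\<close>. The factorisation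
  of the inverse yields its symmetry and the positivity of tensor norms, and the first identity
  yields a positive determinant.\<close>

lemma orthonormal_frame:
  fixes A :: "real^'n^'n"
  assumes sym: "transpose A = A" and pos: "\<And>v. v \<noteq> 0 \<Longrightarrow> v \<bullet> (A *v v) > 0"
  obtains E :: "real^'n^'n" where "transpose E ** A ** E = mat 1" "matrix_inv A = E ** transpose E"
proof -
  obtain e :: "'n \<Rightarrow> real^'n" where e: "\<And>a b. e a \<bullet> (A *v e b) = (if a = b then 1 else 0)"
    using gram_schmidt[OF assms] by blast
  define E :: "real^'n^'n" where "E = (\<chi> i j. e j $ i)"
  have "(transpose E ** A ** E) $ a $ b = e a \<bullet> (A *v e b)" for a b
    unfolding matrix_mul_assoc[symmetric]
    by (simp add: E_def matrix_matrix_mult_def transpose_def inner_vec_def matrix_vector_mult_def)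
  then have 1: "transpose E ** A ** E = mat 1"
    by (simp add: vec_eq_iff e mat_def)
  then have "E ** (transpose E ** A) = mat 1" using matrix_left_right_inverse by blast
  then have "A ** (E ** transpose E) = mat 1"
    using matrix_left_right_inverse by (metis matrix_mul_assoc)
  then have "matrix_inv A = E ** transpose E" by (rule matrix_inv_unique)
  with 1 that show thesis by blast
qed

lemma posdef_det_pos:
  fixes A :: "real^'n^'n"
  assumes sym: "transpose A = A" and pos: "\<And>v. v \<noteq> 0 \<Longrightarrow> v \<bullet> (A *v v) > 0"
  shows "det A > 0"
proof -
  obtain E :: "real^'n^'n" where "transpose E ** A ** E = mat 1" using orthonormal_frame[OF assms] by blast
  then have "det E * det A * det E = 1" by (metis det_I det_mul det_transpose)
  then have "det A * (det E)\<^sup>2 = 1" by (simp add: power2_eq_square algebra_simps)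
  then show ?thesis by (metis zero_less_mult_pos2 zero_less_one zero_less_power2 mult_zero_right power_zero_numeral zero_neq_one)
qed

lemma posdef_matrix_inv:
  fixes A :: "real^'n^'n"
  assumes sym: "transpose A = A" and pos: "\<And>v. v \<noteq> 0 \<Longrightarrow> v \<bullet> (A *v v) > 0"
  shows "A ** matrix_inv A = mat 1" "matrix_inv A ** A = mat 1" "transpose (matrix_inv A) = matrix_inv A"
proof -
  have i: "invertible A" using posdef_det_pos[OF assms] by (simp add: invertible_det_nz)
  show "A ** matrix_inv A = mat 1" "matrix_inv A ** A = mat 1"
    using invertible_matrix_inv[OF i] by auto
  obtain E :: "real^'n^'n" where "matrix_inv A = E ** transpose E" using orthonormal_frame[OF assms] by blast
  then show "transpose (matrix_inv A) = matrix_inv A" by (simp add: matrix_transpose_mul)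
qed

text \<open>In an orthonormal frame the contraction is the sum of the squares of the frame
  components \<open>w a b\<close> of \<open>S\<close>.\<close>

lemma posdef_double_contraction_nonneg:
  fixes A S :: "real^'n^'n"
  assumes sym: "transpose A = A" and pos: "\<And>v. v \<noteq> 0 \<Longrightarrow> v \<bullet> (A *v v) > 0"
  shows "0 \<le> (\<Sum>i\<in>UNIV. \<Sum>j\<in>UNIV. \<Sum>k\<in>UNIV. \<Sum>l\<in>UNIV.
      matrix_inv A $ i $ k * matrix_inv A $ j $ l * S $ i $ j * S $ k $ l)"
proof -
  obtain E :: "real^'n^'n" where E: "matrix_inv A = E ** transpose E" using orthonormal_frame[OF assms] by blast
  have h: "matrix_inv A $ i $ k = (\<Sum>a\<in>UNIV. E $ i $ a * E $ k $ a)" for i k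
    by (simp add: E matrix_matrix_mult_def transpose_def)
  define w where "w = (\<lambda>a b. \<Sum>k\<in>UNIV. \<Sum>l\<in>UNIV. E $ k $ a * E $ l $ b * S $ k $ l)"
  have inner: "(\<Sum>k\<in>UNIV. \<Sum>l\<in>UNIV. matrix_inv A $ i $ k * matrix_inv A $ j $ l * S $ i $ j * S $ k $ l)
      = (\<Sum>a\<in>UNIV. \<Sum>b\<in>UNIV. E $ i $ a * E $ j $ b * S $ i $ j * w a b)" for i j
  proof -
    have "(\<Sum>k\<in>UNIV. \<Sum>l\<in>UNIV. matrix_inv A $ i $ k * matrix_inv A $ j $ l * S $ i $ j * S $ k $ l)
      = (\<Sum>k\<in>UNIV. \<Sum>l\<in>UNIV. \<Sum>a\<in>UNIV. \<Sum>b\<in>UNIV.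
           E $ i $ a * E $ j $ b * S $ i $ j * (E $ k $ a * E $ l $ b * S $ k $ l))"
      unfolding h unfolding sum_product unfolding sum_distrib_right by (intro sum.cong refl) (simp only: mult_ac)
    also have "\<dots> = (\<Sum>a\<in>UNIV. \<Sum>b\<in>UNIV. E $ i $ a * E $ j $ b * S $ i $ j * w a b)"
      unfolding w_def by (subst sum_swap4) (simp add: sum_distrib_left)
    finally show ?thesis .
  qed
  have "(\<Sum>i\<in>UNIV. \<Sum>j\<in>UNIV. \<Sum>k\<in>UNIV. \<Sum>l\<in>UNIV.
      matrix_inv A $ i $ k * matrix_inv A $ j $ l * S $ i $ j * S $ k $ l)
    = (\<Sum>a\<in>UNIV. \<Sum>b\<in>UNIV. \<Sum>i\<in>UNIV. \<Sum>j\<in>UNIV. E $ i $ a * E $ j $ b * S $ i $ j * w a b)"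
    unfolding inner by (rule sum_swap4)
  also have "\<dots> = (\<Sum>a\<in>UNIV. \<Sum>b\<in>UNIV. (w a b)\<^sup>2)"
    unfolding power2_eq_square sum_distrib_right[symmetric] by (simp only: w_def)
  also have "\<dots> \<ge> 0" by (intro sum_nonneg) auto
  finally show ?thesis by simp
qed

text \<open>Cramer's rule. It makes every entry of the inverse a quotient of polynomials in the
  entries of \<open>A\<close>, from which smoothness of the inverse metric follows.\<close>

lemma matrix_inv_entry:
  fixes A :: "real^'n^'n"
  assumes "det A \<noteq> 0"
  shows "matrix_inv A $ i $ j = det (\<chi> a b. if b = i then axis j 1 $ a else A $ a $ b) / det A"
proof -
  have "A ** matrix_inv A = mat 1" using assms by (simp add: invertible_det_nz invertible_matrix_inv)
  then have "A *v (matrix_inv A *v axis j 1) = axis j 1" by (simp add: matrix_vector_mul_assoc)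
  then have "matrix_inv A *v axis j 1 = (\<chi> k. det (\<chi> a b. if b = k then axis j 1 $ a else A $ a $ b) / det A)"
    using cramer[OF assms] by blast
  then have "(matrix_inv A *v axis j 1) $ i = det (\<chi> a b. if b = i then axis j 1 $ a else A $ a $ b) / det A"
    by simp
  moreover have "(matrix_inv A *v axis j 1) $ i = matrix_inv A $ i $ j"
    by (simp add: matrix_vector_mult_def axis_def if_distrib[of "\<lambda>x. _ * x"] cong: if_cong)
  ultimately show ?thesis by simp
qed

section \<open>Smoothness and differentiation of determinants and inverses\<close>

lemma Ck_on_det:
  fixes G :: "'v::real_normed_vector \<Rightarrow> real^'n^'n"
  assumes "open S" "\<And>i j. Ck_on k S (\<lambda>z. G z $ i $ j)"
  shows "Ck_on k S (\<lambda>z. det (G z))"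
  unfolding det_def by (intro Ck_on_sum Ck_on_mult Ck_on_prod Ck_on_const assms)

lemma Ck_on_matrix_inv:
  fixes G :: "'v::real_normed_vector \<Rightarrow> real^'n^'n"
  assumes "open S" "\<And>i j. Ck_on k S (\<lambda>z. G z $ i $ j)" "\<And>z. z \<in> S \<Longrightarrow> det (G z) \<noteq> 0"
  shows "Ck_on k S (\<lambda>z. matrix_inv (G z) $ i $ j)"
proof -
  have "Ck_on k S (\<lambda>z. det (\<chi> a b. if b = i then axis j 1 $ a else G z $ a $ b) / det (G z))"
  proof (intro Ck_on_divide Ck_on_det assms)
    fix a b
    show "Ck_on k S (\<lambda>z. (\<chi> a b. if b = i then axis j 1 $ a else G z $ a $ b) $ a $ b)"
      using assms Ck_on_const[OF assms(1)] by (cases "b = i") auto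
  qed
  then show ?thesis
    by (subst Ck_on_cong[OF assms(1) matrix_inv_entry[OF assms(3)]])
qed

text \<open>Jacobi's formula. Differentiating the Leibniz expansion factor by factor yields the
  determinants in which one row is replaced by its derivative, and Cramer's rule evaluates each of
  them.\<close>

lemma has_derivative_det:
  fixes G :: "'v::real_normed_vector \<Rightarrow> real^'n^'n"
  assumes D: "\<And>i j. ((\<lambda>z. G z $ i $ j) has_derivative D i j) (at x)" and nz: "det (G x) \<noteq> 0"
  shows "((\<lambda>z. det (G z)) has_derivative
           (\<lambda>v. det (G x) * (\<Sum>i\<in>UNIV. \<Sum>j\<in>UNIV. matrix_inv (G x) $ i $ j * D j i v))) (at x)"
proof -
  have "((\<lambda>z. det (G z)) has_derivative
      (\<lambda>v. \<Sum>p | p permutes (UNIV :: 'n set). of_int (sign p) *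
          (\<Sum>i\<in>UNIV. D i (p i) v * (\<Prod>j\<in>UNIV - {i}. G x $ j $ p j)))) (at x)"
    unfolding det_def by (intro has_derivative_sum has_derivative_mult_right has_derivative_prod D)
  moreover have "(\<Sum>p | p permutes (UNIV :: 'n set). of_int (sign p) *
          (\<Sum>i\<in>UNIV. D i (p i) v * (\<Prod>j\<in>UNIV - {i}. G x $ j $ p j)))
      = det (G x) * (\<Sum>i\<in>UNIV. \<Sum>j\<in>UNIV. matrix_inv (G x) $ i $ j * D j i v)" for v
  proof -
    have inv: "matrix_inv (G x) ** G x = mat 1" using nz by (simp add: invertible_det_nz invertible_matrix_inv)
    have row: "det (\<chi> k. if k = i then (\<chi> j. D i j v) else row k (G x))
        = (\<Sum>j\<in>UNIV. D i j v * matrix_inv (G x) $ j $ i) * det (G x)" for i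
    proof -
      \<comment> \<open>The coefficients that express the differentiated row in terms of the rows of
        \<open>G x\<close>; they come from multiplying by the inverse from the right.\<close>
      define X :: "real^'n" where "X = (\<chi> k. \<Sum>j\<in>UNIV. D i j v * matrix_inv (G x) $ j $ k)"
      have "(\<Sum>k\<in>UNIV. X $ k *s row k (G x)) = (\<chi> j. D i j v)"
      proof (rule vec_eq_iff[THEN iffD2], rule allI)
        fix l
        have "(\<Sum>k\<in>UNIV. X $ k *s row k (G x)) $ l = (\<Sum>k\<in>UNIV. \<Sum>j\<in>UNIV. D i j v * (matrix_inv (G x) $ j $ k * G x $ k $ l))"
          by (simp add: X_def row_def sum_distrib_left mult_ac)
        also have "\<dots> = (\<Sum>j\<in>UNIV. D i j v * (matrix_inv (G x) ** G x) $ j $ l)"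
          by (subst sum.swap) (simp add: matrix_matrix_mult_def sum_distrib_left)
        also have "\<dots> = D i l v"
          by (simp add: inv mat_def if_distrib[of "\<lambda>x. _ * x"] cong: if_cong)
        finally show "(\<Sum>k\<in>UNIV. X $ k *s row k (G x)) $ l = (\<chi> j. D i j v) $ l" by simp
      qed
      then show ?thesis using cramer_lemma_transpose[of i X "G x"]
        by (simp add: X_def cong: if_cong)
    qed
    have "(\<Sum>p | p permutes (UNIV :: 'n set). of_int (sign p) *
          (\<Sum>i\<in>UNIV. D i (p i) v * (\<Prod>j\<in>UNIV - {i}. G x $ j $ p j)))
        = (\<Sum>i\<in>UNIV. \<Sum>p | p permutes (UNIV :: 'n set). of_int (sign p) *
             (D i (p i) v * (\<Prod>j\<in>UNIV - {i}. G x $ j $ p j)))"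
      by (subst sum.swap) (simp add: sum_distrib_left)
    also have "\<dots> = (\<Sum>i\<in>UNIV. det (\<chi> k. if k = i then (\<chi> j. D i j v) else row k (G x)))"
    proof (rule sum.cong[OF refl])
      fix i
      have "(\<Prod>k\<in>UNIV. (\<chi> k. if k = i then (\<chi> j. D i j v) else row k (G x)) $ k $ p k)
          = D i (p i) v * (\<Prod>j\<in>UNIV - {i}. G x $ j $ p j)" for p
        by (subst prod.remove[of _ i]) (auto simp: row_def intro!: prod.cong)
      then show "(\<Sum>p | p permutes (UNIV :: 'n set). of_int (sign p) *
             (D i (p i) v * (\<Prod>j\<in>UNIV - {i}. G x $ j $ p j)))
           = det (\<chi> k. if k = i then (\<chi> j. D i j v) else row k (G x))"
        unfolding det_def by simp
    qed
    also have "\<dots> = det (G x) * (\<Sum>i\<in>UNIV. \<Sum>j\<in>UNIV. D i j v * matrix_inv (G x) $ j $ i)"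
      unfolding row by (simp add: sum_distrib_left mult_ac)
    also have "(\<Sum>i\<in>UNIV. \<Sum>j\<in>UNIV. D i j v * matrix_inv (G x) $ j $ i)
        = (\<Sum>i\<in>UNIV. \<Sum>j\<in>UNIV. matrix_inv (G x) $ i $ j * D j i v)"
      by (subst sum.swap) (simp add: mult_ac)
    finally show ?thesis .
  qed
  ultimately show ?thesis by simp
qed

section \<open>Calculus in a chart\<close>

lemma sum_delta_mult:
  fixes F :: "'n::finite \<Rightarrow> real"
  shows "(\<Sum>l\<in>UNIV. (if i = l then 1 else 0) * F l) = F i" "(\<Sum>l\<in>UNIV. F l * (if l = i then 1 else 0)) = F i"
  by (simp_all add: if_distrib[of "\<lambda>x. x * _"] if_distrib[of "\<lambda>x. _ * x"] cong: if_cong)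

definition chart_Ck :: "('a, 'n::finite) chart \<Rightarrow> nat \<Rightarrow> ('a \<Rightarrow> real) \<Rightarrow> bool" where
  "chart_Ck c k h \<longleftrightarrow> Ck_on k (coord c ` dom c) (h \<circ> coord_inv c)"

text \<open>The divergence of the gradient with the chart as an argument, so that the values in two
  charts can be compared; \<open>divergence\<close> has its chart fixed by
  \<open>chart_at\<close>.\<close>

definition lap :: "('a, 'n::finite) tensor2 \<Rightarrow> ('a, 'n) chart \<Rightarrow> ('a \<Rightarrow> real) \<Rightarrow> 'a \<Rightarrow> real" where
  "lap g c h p = (\<Sum>i\<in>UNIV. partial c i (\<lambda>q. grad g h c q $ i) p
     + (\<Sum>j\<in>UNIV. christoffel g c i i j p * grad g h c p $ j))"

text \<open>The inner product of the gradients, written as the differential of \<open>a\<close>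
  applied to the gradient of \<open>b\<close>, so that no index has to be lowered.\<close>

definition grad_inner :: "('a, 'n::finite) tensor2 \<Rightarrow> ('a, 'n) chart \<Rightarrow> ('a \<Rightarrow> real) \<Rightarrow> ('a \<Rightarrow> real) \<Rightarrow> 'a \<Rightarrow> real" where
  "grad_inner g c a b p = (\<Sum>i\<in>UNIV. partial c i a p * grad g b c p $ i)"

text \<open>The data of one chart without compatibility with others: the local calculus, the Bochner
  formula and the local Green formula live here.\<close>

locale riemannian_chart =
  fixes c :: "('a::topological_space, 'n::finite) chart" and g :: "('a, 'n) tensor2"
  assumes open_range: "open (coord c ` dom c)"
    and homeo: "homeomorphism (dom c) (coord c ` dom c) (coord c) (coord_inv c)"
    and smooth_metric: "smooth_on (coord c ` dom c) (g c \<circ> coord_inv c)"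
    and metric_sym: "\<And>p. p \<in> dom c \<Longrightarrow> transpose (g c p) = g c p"
    and metric_pos: "\<And>p v. p \<in> dom c \<Longrightarrow> v \<noteq> 0 \<Longrightarrow> v \<bullet> (g c p *v v) > 0"
begin

abbreviation "U \<equiv> coord c ` dom c"

lemma coord_inv_coord [simp]: "p \<in> dom c \<Longrightarrow> coord_inv c (coord c p) = p"
  using homeo by (simp add: homeomorphism_def)

lemma coord_coord_inv [simp]: "z \<in> U \<Longrightarrow> coord c (coord_inv c z) = z"
  by auto

lemma coord_inv_dom: "z \<in> U \<Longrightarrow> coord_inv c z \<in> dom c"
  by auto

section \<open>Functions of class C^k in a chart\<close>

lemma chart_Ck_const: "chart_Ck c k (\<lambda>p. a)"
  unfolding chart_Ck_def o_def using Ck_on_const open_range by blast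

lemma chart_Ck_add: "chart_Ck c k h \<Longrightarrow> chart_Ck c k h' \<Longrightarrow> chart_Ck c k (\<lambda>p. h p + h' p)"
  unfolding chart_Ck_def o_def using Ck_on_add open_range by blast

lemma chart_Ck_diff: "chart_Ck c k h \<Longrightarrow> chart_Ck c k h' \<Longrightarrow> chart_Ck c k (\<lambda>p. h p - h' p)"
  unfolding chart_Ck_def o_def using Ck_on_diff open_range by blast

lemma chart_Ck_minus: "chart_Ck c k h \<Longrightarrow> chart_Ck c k (\<lambda>p. - h p)"
  unfolding chart_Ck_def o_def using Ck_on_minus open_range by blast

lemma chart_Ck_mult: "chart_Ck c k h \<Longrightarrow> chart_Ck c k h' \<Longrightarrow> chart_Ck c k (\<lambda>p. h p * h' p)"
  unfolding chart_Ck_def o_def using Ck_on_mult open_range by blast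

lemma chart_Ck_sum: "(\<And>i. i \<in> I \<Longrightarrow> chart_Ck c k (h i)) \<Longrightarrow> chart_Ck c k (\<lambda>p. \<Sum>i\<in>I. h i p)"
  unfolding chart_Ck_def o_def by (rule Ck_on_sum[OF open_range])

lemma chart_Ck_divide_const: "chart_Ck c k h \<Longrightarrow> chart_Ck c k (\<lambda>p. h p / a)"
  unfolding divide_inverse by (intro chart_Ck_mult chart_Ck_const)

lemma chart_Ck_ln: "chart_Ck c k h \<Longrightarrow> (\<And>p. p \<in> dom c \<Longrightarrow> h p > 0) \<Longrightarrow> chart_Ck c k (\<lambda>p. ln (h p))"
  unfolding chart_Ck_def o_def by (intro Ck_on_ln open_range) (auto simp: coord_inv_dom)

lemma chart_Ck_exp: "chart_Ck c k h \<Longrightarrow> chart_Ck c k (\<lambda>p. exp (h p))"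
  unfolding chart_Ck_def o_def using Ck_on_exp open_range by blast

lemma chart_Ck_divide:
  "chart_Ck c k h \<Longrightarrow> chart_Ck c k h' \<Longrightarrow> (\<And>p. p \<in> dom c \<Longrightarrow> h' p \<noteq> 0) \<Longrightarrow> chart_Ck c k (\<lambda>p. h p / h' p)"
  unfolding chart_Ck_def o_def by (intro Ck_on_divide open_range) (auto simp: coord_inv_dom)

lemma chart_Ck_le: "chart_Ck c k h \<Longrightarrow> j \<le> k \<Longrightarrow> chart_Ck c j h"
  unfolding chart_Ck_def by (rule Ck_on_le)

lemma chart_Ck_cong:
  assumes "\<And>p. p \<in> dom c \<Longrightarrow> h p = h' p"
  shows "chart_Ck c k h \<longleftrightarrow> chart_Ck c k h'"
  unfolding chart_Ck_def by (rule Ck_on_cong[OF open_range]) (use assms coord_inv_dom in auto)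

lemma chart_C1_has_derivative:
  assumes "chart_Ck c 1 h" "z \<in> U"
  shows "(h \<circ> coord_inv c has_derivative frechet_derivative (h \<circ> coord_inv c) (at z)) (at z)"
  using assms Ck_on_SucD[of 0 U "h \<circ> coord_inv c" z] unfolding chart_Ck_def One_nat_def by blast

section \<open>Rules for partial derivatives in a chart\<close>

lemma partial_eq:
  assumes "((h \<circ> coord_inv c) has_derivative D) (at (coord c p))"
  shows "partial c i h p = D (axis i 1)"
  using frechet_derivative_at[OF assms] by (simp add: partial_def)

lemma partial_cong:
  assumes "chart_Ck c 1 h" "\<And>q. q \<in> dom c \<Longrightarrow> h q = h' q" "p \<in> dom c"
  shows "partial c i h p = partial c i h' p"
proof -
  have "h \<circ> coord_inv c differentiable at (coord c p)"
    using chart_C1_has_derivative[OF assms(1)] assms(3) unfolding differentiable_def by blast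
  then have "frechet_derivative (h \<circ> coord_inv c) (at (coord c p)) = frechet_derivative (h' \<circ> coord_inv c) (at (coord c p))"
    by (rule frechet_derivative_transform_within_open[OF _ open_range]) (use assms in auto)
  then show ?thesis by (simp add: partial_def)
qed

lemma chart_Ck_partial: "chart_Ck c (Suc k) h \<Longrightarrow> chart_Ck c k (partial c i h)"
proof -
  assume "chart_Ck c (Suc k) h"
  then have "Ck_on k U (\<lambda>z. frechet_derivative (h \<circ> coord_inv c) (at z) (axis i 1))"
    unfolding chart_Ck_def by simp
  then show ?thesis unfolding chart_Ck_def
    by (subst Ck_on_cong[OF open_range, of _ "\<lambda>z. frechet_derivative (h \<circ> coord_inv c) (at z) (axis i 1)"])
       (auto simp: partial_def)
qed

lemma partial_const [simp]: "partial c i (\<lambda>p. a) p = 0"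
  unfolding partial_def by (simp add: comp_def frechet_derivative_const)

lemma partial_add:
  assumes "chart_Ck c 1 h" "chart_Ck c 1 h'" "p \<in> dom c"
  shows "partial c i (\<lambda>p. h p + h' p) p = partial c i h p + partial c i h' p"
  using partial_eq[of "\<lambda>p. h p + h' p"] has_derivative_add[OF chart_C1_has_derivative[OF assms(1)] chart_C1_has_derivative[OF assms(2)], of "coord c p"] assms(3)
  by (auto simp: partial_def comp_def)

lemma partial_diff:
  assumes "chart_Ck c 1 h" "chart_Ck c 1 h'" "p \<in> dom c"
  shows "partial c i (\<lambda>p. h p - h' p) p = partial c i h p - partial c i h' p"
  using partial_eq[of "\<lambda>p. h p - h' p"] has_derivative_diff[OF chart_C1_has_derivative[OF assms(1)] chart_C1_has_derivative[OF assms(2)], of "coord c p"] assms(3)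
  by (auto simp: partial_def comp_def)

lemma partial_mult:
  assumes "chart_Ck c 1 h" "chart_Ck c 1 h'" "p \<in> dom c"
  shows "partial c i (\<lambda>p. h p * h' p) p = partial c i h p * h' p + h p * partial c i h' p"
  using partial_eq[of "\<lambda>p. h p * h' p"] has_derivative_mult[OF chart_C1_has_derivative[OF assms(1)] chart_C1_has_derivative[OF assms(2)], of "coord c p"] assms(3)
  by (auto simp: partial_def comp_def)

lemma partial_sum:
  assumes "\<And>i. i \<in> I \<Longrightarrow> chart_Ck c 1 (h i)" "p \<in> dom c"
  shows "partial c j (\<lambda>p. \<Sum>i\<in>I. h i p) p = (\<Sum>i\<in>I. partial c j (h i) p)"
proof -
  have "((\<lambda>z. \<Sum>i\<in>I. (h i \<circ> coord_inv c) z) has_derivative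
      (\<lambda>v. \<Sum>i\<in>I. frechet_derivative (h i \<circ> coord_inv c) (at (coord c p)) v)) (at (coord c p))"
    by (rule has_derivative_sum) (use chart_C1_has_derivative[OF assms(1)] assms(2) in blast)
  then show ?thesis
    using partial_eq[of "\<lambda>p. \<Sum>i\<in>I. h i p"] by (simp add: partial_def comp_def)
qed

lemma partial_cmult:
  assumes "chart_Ck c 1 h" "p \<in> dom c"
  shows "partial c i (\<lambda>p. a * h p) p = a * partial c i h p"
  using partial_mult[OF chart_Ck_const assms, of i a] by simp

lemma partial_ln:
  assumes "chart_Ck c 1 h" "p \<in> dom c" "h p > 0"
  shows "partial c i (\<lambda>p. ln (h p)) p = partial c i h p / h p"
proof -
  have D: "(h \<circ> coord_inv c has_derivative frechet_derivative (h \<circ> coord_inv c) (at (coord c p))) (at (coord c p))"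
    using chart_C1_has_derivative assms by blast
  have "((\<lambda>p. ln (h p)) \<circ> coord_inv c has_derivative (\<lambda>v. frechet_derivative (h \<circ> coord_inv c) (at (coord c p)) v * inverse (h p))) (at (coord c p))"
    using has_derivative_ln[OF _ D] assms by (auto simp: comp_def)
  from partial_eq[OF this] show ?thesis by (simp add: partial_def divide_inverse)
qed

lemma partial_exp:
  assumes "chart_Ck c 1 h" "p \<in> dom c"
  shows "partial c i (\<lambda>p. exp (h p)) p = exp (h p) * partial c i h p"
proof -
  have D: "(h \<circ> coord_inv c has_derivative frechet_derivative (h \<circ> coord_inv c) (at (coord c p))) (at (coord c p))"
    using chart_C1_has_derivative assms by blast
  have "((\<lambda>p. exp (h p)) \<circ> coord_inv c has_derivative (\<lambda>v. exp (h p) * frechet_derivative (h \<circ> coord_inv c) (at (coord c p)) v)) (at (coord c p))"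
    using has_derivative_exp[OF D] assms by (auto simp: comp_def mult.commute)
  from partial_eq[OF this] show ?thesis by (simp add: partial_def)
qed

lemma partial_commute:
  assumes "chart_Ck c 2 h" "p \<in> dom c"
  shows "partial c i (partial c j h) p = partial c j (partial c i h) p"
proof -
  have e: "partial c i (partial c j h) p = frechet_derivative (\<lambda>y. frechet_derivative (h \<circ> coord_inv c) (at y) (axis j 1)) (at (coord c p)) (axis i 1)" for i j
  proof -
    have c1: "chart_Ck c 1 (partial c j h)" using chart_Ck_partial[of 1 h j] assms by (simp add: numeral_2_eq_2)
    have "frechet_derivative (partial c j h \<circ> coord_inv c) (at (coord c p)) = 
       frechet_derivative (\<lambda>y. frechet_derivative (h \<circ> coord_inv c) (at y) (axis j 1)) (at (coord c p))"
      by (rule frechet_derivative_transform_within_open[OF _ open_range])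
         (use assms chart_C1_has_derivative[OF c1] in \<open>auto simp: differentiable_def partial_def\<close>)
    then show ?thesis by (simp add: partial_def)
  qed
  show ?thesis unfolding e
    by (rule frechet_derivative_symmetric[OF open_range]) (use assms in \<open>auto simp: chart_Ck_def\<close>)
qed

section \<open>The metric and its inverse in a chart\<close>

lemma chart_Ck_metric: "chart_Ck c k (\<lambda>p. g c p $ i $ j)"
proof -
  have "Ck_on k U (\<lambda>z. (\<lambda>B. B $ i $ j) ((g c \<circ> coord_inv c) z))"
  proof (rule Ck_on_bounded_linear[OF open_range, where L="\<lambda>B. B $ i $ j"])
    show "bounded_linear (\<lambda>B::real^'n^'n. B $ i $ j)"
      using bounded_linear_compose[OF bounded_linear_vec_nth[of j] bounded_linear_vec_nth[of i]] by simp
  qed (use smooth_metric in \<open>simp add: smooth_on_def comp_def\<close>)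
  then show ?thesis by (simp add: chart_Ck_def comp_def)
qed

lemma det_metric_pos: "p \<in> dom c \<Longrightarrow> det (g c p) > 0"
  using posdef_det_pos metric_sym metric_pos by blast

lemma chart_Ck_inverse_metric: "chart_Ck c k (\<lambda>p. matrix_inv (g c p) $ i $ j)"
  unfolding chart_Ck_def comp_def
proof (rule Ck_on_matrix_inv[OF open_range])
  show "Ck_on k U (\<lambda>z. g c (coord_inv c z) $ i $ j)" for i j
    using chart_Ck_metric[of k i j] by (simp add: chart_Ck_def comp_def)
  show "z \<in> U \<Longrightarrow> det (g c (coord_inv c z)) \<noteq> 0" for z
    using det_metric_pos coord_inv_dom by force
qed

lemma metric_entry_sym: "p \<in> dom c \<Longrightarrow> g c p $ i $ j = g c p $ j $ i"
  using metric_sym[of p] by (metis transpose_def vec_lambda_beta)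

lemma inverse_metric_sym: "p \<in> dom c \<Longrightarrow> matrix_inv (g c p) $ i $ j = matrix_inv (g c p) $ j $ i"
proof -
  assume "p \<in> dom c"
  then have "transpose (matrix_inv (g c p)) $ i $ j = matrix_inv (g c p) $ i $ j"
    using posdef_matrix_inv(3)[OF metric_sym metric_pos] by simp
  then show ?thesis by (simp add: transpose_def)
qed

lemma metric_inverse: 
  assumes "p \<in> dom c"
  shows "(\<Sum>k\<in>UNIV. g c p $ i $ k * matrix_inv (g c p) $ k $ j) = (if i = j then 1 else 0)"
    "(\<Sum>k\<in>UNIV. matrix_inv (g c p) $ i $ k * g c p $ k $ j) = (if i = j then 1 else 0)"
proof -
  have "(g c p ** matrix_inv (g c p)) $ i $ j = (if i = j then 1 else 0)"
       "(matrix_inv (g c p) ** g c p) $ i $ j = (if i = j then 1 else 0)"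
    using posdef_matrix_inv(1,2)[of "g c p"] metric_sym[OF assms] metric_pos[OF assms]
    by (auto simp: mat_def)
  then show "(\<Sum>k\<in>UNIV. g c p $ i $ k * matrix_inv (g c p) $ k $ j) = (if i = j then 1 else 0)"
    "(\<Sum>k\<in>UNIV. matrix_inv (g c p) $ i $ k * g c p $ k $ j) = (if i = j then 1 else 0)"
    by (auto simp: matrix_matrix_mult_def)
qed

section \<open>Christoffel symbols, gradients and the Laplacian\<close>

lemma chart_Ck_christoffel: "chart_Ck c k (christoffel g c l i j)"
proof -
  have "chart_Ck c k (\<lambda>p. (\<Sum>m\<in>UNIV. matrix_inv (g c p) $ l $ m *
     (partial c i (\<lambda>q. g c q $ j $ m) p + partial c j (\<lambda>q. g c q $ i $ m) p
        - partial c m (\<lambda>q. g c q $ i $ j) p)) / 2)"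
    by (intro chart_Ck_divide_const chart_Ck_sum chart_Ck_mult chart_Ck_inverse_metric chart_Ck_diff chart_Ck_add
        chart_Ck_partial chart_Ck_metric)
  then show ?thesis by (simp add: christoffel_def[abs_def])
qed

lemma grad_nth: "grad g h c p $ i = (\<Sum>j\<in>UNIV. matrix_inv (g c p) $ i $ j * partial c j h p)"
  by (simp add: grad_def matrix_vector_mult_def)

lemma chart_Ck_grad: "chart_Ck c (Suc k) h \<Longrightarrow> chart_Ck c k (\<lambda>p. grad g h c p $ i)"
  unfolding grad_nth by (intro chart_Ck_sum chart_Ck_mult chart_Ck_inverse_metric chart_Ck_partial)

lemma chart_Ck_grad_inner: "chart_Ck c (Suc k) a \<Longrightarrow> chart_Ck c (Suc k) b \<Longrightarrow> chart_Ck c k (grad_inner g c a b)"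
  unfolding grad_inner_def[abs_def] by (intro chart_Ck_sum chart_Ck_mult chart_Ck_grad chart_Ck_partial)

lemma chart_Ck_lap: "chart_Ck c (Suc (Suc k)) h \<Longrightarrow> chart_Ck c k (lap g c h)"
  unfolding lap_def[abs_def]
  by (intro chart_Ck_sum chart_Ck_mult chart_Ck_add chart_Ck_partial chart_Ck_grad chart_Ck_christoffel)
     (simp_all add: chart_Ck_le[of "Suc (Suc k)"])

lemma partial_metric_sym: "p \<in> dom c \<Longrightarrow> partial c k (\<lambda>q. g c q $ i $ j) p = partial c k (\<lambda>q. g c q $ j $ i) p"
  by (rule partial_cong) (auto simp: chart_Ck_metric metric_entry_sym)

lemma christoffel_sym: "p \<in> dom c \<Longrightarrow> christoffel g c k i j p = christoffel g c k j i p"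
  unfolding christoffel_def by (simp add: partial_metric_sym[of p _ i j] add.commute)

lemma grad_inner_commute: "p \<in> dom c \<Longrightarrow> grad_inner g c a b p = grad_inner g c b a p"
  unfolding grad_inner_def grad_nth sum_distrib_left
  by (subst sum.swap) (simp add: inverse_metric_sym mult_ac)

lemma partial_grad_inverse:
  assumes "p \<in> dom c"
  shows "partial c i h p = (\<Sum>k\<in>UNIV. g c p $ i $ k * grad g h c p $ k)"
proof -
  have "(\<Sum>k\<in>UNIV. g c p $ i $ k * grad g h c p $ k)
      = (\<Sum>j\<in>UNIV. (\<Sum>k\<in>UNIV. g c p $ i $ k * matrix_inv (g c p) $ k $ j) * partial c j h p)"
    unfolding grad_nth sum_distrib_left sum_distrib_right by (subst sum.swap) (simp add: mult_ac)
  then show ?thesis unfolding metric_inverse[OF assms] by (simp only: sum_delta_mult)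
qed

text \<open>Lowering the index cancels the inverse metric and leaves the Christoffel symbols of the
  first kind.\<close>

lemma christoffel_lower:
  assumes "p \<in> dom c"
  shows "(\<Sum>k\<in>UNIV. g c p $ m $ k * christoffel g c k i j p) =
     (partial c i (\<lambda>q. g c q $ j $ m) p + partial c j (\<lambda>q. g c q $ i $ m) p - partial c m (\<lambda>q. g c q $ i $ j) p) / 2"
proof -
  define F where "F = (\<lambda>l. (partial c i (\<lambda>q. g c q $ j $ l) p + partial c j (\<lambda>q. g c q $ i $ l) p - partial c l (\<lambda>q. g c q $ i $ j) p) / 2)"
  have "christoffel g c k i j p = (\<Sum>l\<in>UNIV. matrix_inv (g c p) $ k $ l * F l)" for k
    by (simp add: christoffel_def F_def sum_divide_distrib)
  then have "(\<Sum>k\<in>UNIV. g c p $ m $ k * christoffel g c k i j p) =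
      (\<Sum>l\<in>UNIV. (\<Sum>k\<in>UNIV. g c p $ m $ k * matrix_inv (g c p) $ k $ l) * F l)"
    unfolding sum_distrib_right by (simp only: sum_distrib_left) (subst sum.swap, simp add: mult_ac)
  then show ?thesis unfolding metric_inverse[OF assms] by (simp only: sum_delta_mult F_def)
qed

text \<open>Metric compatibility of the Levi-Civita connection, in coordinates: in the sum of two
  symbols of the first kind, all but one derivative of the metric cancel.\<close>

lemma partial_metric:
  assumes "p \<in> dom c"
  shows "partial c k (\<lambda>q. g c q $ i $ j) p =
    (\<Sum>l\<in>UNIV. g c p $ j $ l * christoffel g c l k i p) + (\<Sum>l\<in>UNIV. g c p $ i $ l * christoffel g c l k j p)"
  unfolding christoffel_lower[OF assms]
  by (simp add: partial_metric_sym[OF assms, of _ k] partial_metric_sym[OF assms, of _ j i] field_simps)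

text \<open>The inverse metric is parallel as well: differentiate the constant product of the
  inverse metric with the metric, and insert \<open>partial_metric\<close>.\<close>

lemma partial_inverse_metric:
  assumes p: "p \<in> dom c"
  shows "partial c k (\<lambda>q. matrix_inv (g c q) $ i $ j) p =
    - (\<Sum>l\<in>UNIV. christoffel g c i k l p * matrix_inv (g c p) $ l $ j) - (\<Sum>l\<in>UNIV. christoffel g c j k l p * matrix_inv (g c p) $ i $ l)"
proof -
  define h where "h = (\<lambda>i j. matrix_inv (g c p) $ i $ j)"
  define G where "G = (\<lambda>i j. g c p $ i $ j)"
  define \<Gamma> where "\<Gamma> = (\<lambda>i j. christoffel g c i k j p)"
  define dh where "dh = (\<lambda>i j. partial c k (\<lambda>q. matrix_inv (g c q) $ i $ j) p)"
  define dg where "dg = (\<lambda>i j. partial c k (\<lambda>q. g c q $ i $ j) p)"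
  have hG: "(\<Sum>k\<in>UNIV. h i k * G k j) = (if i = j then 1 else 0)" and Gh: "(\<Sum>k\<in>UNIV. G i k * h k j) = (if i = j then 1 else 0)" for i j
    using metric_inverse[OF p] by (simp_all add: h_def G_def)
  have dg: "dg a b = (\<Sum>l\<in>UNIV. G b l * \<Gamma> l a) + (\<Sum>l\<in>UNIV. G a l * \<Gamma> l b)" for a b
    unfolding dg_def G_def \<Gamma>_def by (rule partial_metric[OF p])
  have "partial c k (\<lambda>q. \<Sum>b\<in>UNIV. matrix_inv (g c q) $ i $ b * g c q $ b $ a) p = 0" for a
  proof -
    have "partial c k (\<lambda>q. \<Sum>b\<in>UNIV. matrix_inv (g c q) $ i $ b * g c q $ b $ a) p = partial c k (\<lambda>q. if i = a then 1 else 0) p"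
      by (rule partial_cong) (auto simp: p metric_inverse intro!: chart_Ck_sum chart_Ck_mult chart_Ck_inverse_metric chart_Ck_metric)
    then show ?thesis by simp
  qed
  then have "(\<Sum>b\<in>UNIV. dh i b * G b a + h i b * dg b a) = 0" for a
    by (subst (asm) partial_sum) (auto simp: p partial_mult chart_Ck_mult chart_Ck_inverse_metric chart_Ck_metric dh_def dg_def h_def G_def)
  then have z: "(\<Sum>b\<in>UNIV. dh i b * G b a) = - (\<Sum>b\<in>UNIV. h i b * dg b a)" for a
    by (simp add: sum.distrib eq_neg_iff_add_eq_0)
  have hdg: "(\<Sum>b\<in>UNIV. h i b * dg b a) = (\<Sum>b\<in>UNIV. h i b * (\<Sum>l\<in>UNIV. G a l * \<Gamma> l b)) + \<Gamma> i a" for a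
  proof -
    have "(\<Sum>b\<in>UNIV. h i b * (\<Sum>l\<in>UNIV. G b l * \<Gamma> l a)) = (\<Sum>l\<in>UNIV. (\<Sum>b\<in>UNIV. h i b * G b l) * \<Gamma> l a)"
      unfolding sum_distrib_left sum_distrib_right by (subst sum.swap) (simp add: mult_ac)
    also have "\<dots> = \<Gamma> i a" unfolding hG by (simp only: sum_delta_mult)
    finally show ?thesis unfolding dg by (simp add: distrib_left sum.distrib)
  qed
  have hsym: "h a b = h b a" for a b unfolding h_def by (rule inverse_metric_sym[OF p])
  \<comment> \<open>Of the two terms of \<open>dg\<close>, this one has its metric factor next to
    the inverse metric on the right; the other has met the one on the left in
    \<open>hdg\<close>.\<close>
  have "(\<Sum>a\<in>UNIV. (\<Sum>b\<in>UNIV. h i b * (\<Sum>l\<in>UNIV. G a l * \<Gamma> l b)) * h a j)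
      = (\<Sum>a\<in>UNIV. \<Sum>b\<in>UNIV. \<Sum>l\<in>UNIV. h i b * (h j a * G a l * \<Gamma> l b))"
    unfolding sum_distrib_left sum_distrib_right by (simp only: hsym[of _ j] mult_ac)
  also have "\<dots> = (\<Sum>b\<in>UNIV. \<Sum>l\<in>UNIV. \<Sum>a\<in>UNIV. h i b * (h j a * G a l * \<Gamma> l b))"
    by (subst sum.swap, rule sum.cong[OF refl], rule sum.swap)
  also have "\<dots> = (\<Sum>b\<in>UNIV. h i b * (\<Sum>l\<in>UNIV. (\<Sum>a\<in>UNIV. h j a * G a l) * \<Gamma> l b))"
    by (simp only: sum_distrib_left sum_distrib_right)
  also have "\<dots> = (\<Sum>b\<in>UNIV. h i b * \<Gamma> j b)"
    unfolding hG by (simp only: sum_delta_mult)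
  finally have e: "(\<Sum>a\<in>UNIV. (\<Sum>b\<in>UNIV. h i b * (\<Sum>l\<in>UNIV. G a l * \<Gamma> l b)) * h a j) = (\<Sum>b\<in>UNIV. h i b * \<Gamma> j b)" .
  \<comment> \<open>Inserting the identity as \<open>G\<close> times \<open>h\<close> produces the
    contraction of \<open>dh\<close> with \<open>G\<close>, which \<open>z\<close>
    determines.\<close>
  have "dh i j = (\<Sum>b\<in>UNIV. dh i b * (\<Sum>a\<in>UNIV. G b a * h a j))"
    unfolding Gh by (simp only: sum_delta_mult)
  also have "\<dots> = (\<Sum>a\<in>UNIV. (\<Sum>b\<in>UNIV. dh i b * G b a) * h a j)"
    unfolding sum_distrib_left sum_distrib_right by (subst sum.swap) (simp add: mult_ac)
  also have "\<dots> = - (\<Sum>a\<in>UNIV. ((\<Sum>b\<in>UNIV. h i b * (\<Sum>l\<in>UNIV. G a l * \<Gamma> l b)) + \<Gamma> i a) * h a j)"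
    unfolding z hdg by (simp only: mult_minus_left sum_negf)
  also have "\<dots> = - ((\<Sum>b\<in>UNIV. h i b * \<Gamma> j b) + (\<Sum>a\<in>UNIV. \<Gamma> i a * h a j))"
    by (simp only: distrib_right sum.distrib e)
  finally show ?thesis unfolding dh_def h_def \<Gamma>_def by (simp add: mult_ac)
qed

text \<open>Jacobi's formula combined with metric compatibility: both Christoffel terms contribute
  the same trace, and the resulting 2 cancels the 1/2 from the square root. This identity turns a
  Riemannian divergence into a sum of plain partial derivatives.\<close>

lemma partial_sqrt_det:
  assumes p: "p \<in> dom c"
  shows "partial c k (\<lambda>q. sqrt (det (g c q))) p = sqrt (det (g c p)) * (\<Sum>i\<in>UNIV. christoffel g c i i k p)"
proof -
  define h where "h = (\<lambda>i j. matrix_inv (g c p) $ i $ j)"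
  define G where "G = (\<lambda>i j. g c p $ i $ j)"
  define \<Gamma> where "\<Gamma> = (\<lambda>i j. christoffel g c i k j p)"
  have D: "((\<lambda>z. g c (coord_inv c z) $ i $ j) has_derivative frechet_derivative ((\<lambda>q. g c q $ i $ j) \<circ> coord_inv c) (at (coord c p))) (at (coord c p))" for i j
    using chart_C1_has_derivative[OF chart_Ck_metric[of 1 i j]] p by (auto simp: comp_def)
  have pos: "det (g c p) > 0" using det_metric_pos p by blast
  have "((\<lambda>z. det (g c (coord_inv c z))) has_derivative
      (\<lambda>v. det (g c p) * (\<Sum>i\<in>UNIV. \<Sum>j\<in>UNIV. h i j * frechet_derivative ((\<lambda>q. g c q $ j $ i) \<circ> coord_inv c) (at (coord c p)) v))) (at (coord c p))"
    using has_derivative_det[where G="\<lambda>z. g c (coord_inv c z)" and D="\<lambda>i j. frechet_derivative ((\<lambda>q. g c q $ i $ j) \<circ> coord_inv c) (at (coord c p))" and x="coord c p", OF D]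
      pos p by (simp add: h_def)
  from has_derivative_real_sqrt[OF _ this]
  have "((\<lambda>q. sqrt (det (g c q))) \<circ> coord_inv c has_derivative
      (\<lambda>v. det (g c p) * (\<Sum>i\<in>UNIV. \<Sum>j\<in>UNIV. h i j * frechet_derivative ((\<lambda>q. g c q $ j $ i) \<circ> coord_inv c) (at (coord c p)) v) * (inverse (sqrt (det (g c p))) / 2))) (at (coord c p))"
    using pos p by (simp add: comp_def)
  from partial_eq[OF this] have "partial c k (\<lambda>q. sqrt (det (g c q))) p =
      det (g c p) * inverse (sqrt (det (g c p))) / 2 * (\<Sum>i\<in>UNIV. \<Sum>j\<in>UNIV. h i j * partial c k (\<lambda>q. g c q $ j $ i) p)"
    by (simp add: partial_def)
  also have "det (g c p) * inverse (sqrt (det (g c p))) = sqrt (det (g c p))"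
    using pos by (simp add: field_simps)
  also have "(\<Sum>i\<in>UNIV. \<Sum>j\<in>UNIV. h i j * partial c k (\<lambda>q. g c q $ j $ i) p)
     = 2 * (\<Sum>i\<in>UNIV. \<Gamma> i i)"
  proof -
    have hG: "(\<Sum>k\<in>UNIV. h i k * G k j) = (if i = j then 1 else 0)" for i j
      using metric_inverse[OF p] by (simp add: h_def G_def)
    have hsym: "h a b = h b a" for a b unfolding h_def by (rule inverse_metric_sym[OF p])
    have e: "partial c k (\<lambda>q. g c q $ j $ i) p = (\<Sum>l\<in>UNIV. G i l * \<Gamma> l j) + (\<Sum>l\<in>UNIV. G j l * \<Gamma> l i)" for i j
      unfolding G_def \<Gamma>_def by (rule partial_metric[OF p])
    have a: "(\<Sum>i\<in>UNIV. \<Sum>j\<in>UNIV. h i j * (\<Sum>l\<in>UNIV. G j l * \<Gamma> l i)) = (\<Sum>i\<in>UNIV. \<Gamma> i i)"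
    proof (rule sum.cong[OF refl])
      fix i
      have "(\<Sum>j\<in>UNIV. h i j * (\<Sum>l\<in>UNIV. G j l * \<Gamma> l i)) = (\<Sum>l\<in>UNIV. (\<Sum>j\<in>UNIV. h i j * G j l) * \<Gamma> l i)"
        unfolding sum_distrib_left sum_distrib_right by (subst sum.swap) (simp add: mult_ac)
      then show "(\<Sum>j\<in>UNIV. h i j * (\<Sum>l\<in>UNIV. G j l * \<Gamma> l i)) = \<Gamma> i i"
        unfolding hG by (simp only: sum_delta_mult)
    qed
    have b: "(\<Sum>i\<in>UNIV. \<Sum>j\<in>UNIV. h i j * (\<Sum>l\<in>UNIV. G i l * \<Gamma> l j)) = (\<Sum>i\<in>UNIV. \<Gamma> i i)"
      by (subst sum.swap, subst hsym, rule a)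
    show ?thesis unfolding e by (simp add: distrib_left sum.distrib a b)
  qed
  finally show ?thesis by (simp add: \<Gamma>_def christoffel_sym[OF p, of _ k])
qed

text \<open>The square root is written as \<open>exp (ln (det (g c q)) / 2)\<close>, so that closure
  under \<open>exp\<close> and \<open>ln\<close> suffices.\<close>

lemma chart_Ck_sqrt_det: "chart_Ck c k (\<lambda>q. sqrt (det (g c q)))"
proof -
  have "chart_Ck c k (\<lambda>q. det (g c q))"
    unfolding chart_Ck_def comp_def
    by (rule Ck_on_det[OF open_range]) (use chart_Ck_metric in \<open>simp add: chart_Ck_def comp_def\<close>)
  then have "chart_Ck c k (\<lambda>q. exp (ln (det (g c q)) / 2))"
    by (intro chart_Ck_exp chart_Ck_divide_const chart_Ck_ln det_metric_pos)
  moreover have "sqrt (det (g c q)) = exp (ln (det (g c q)) / 2)" if "q \<in> dom c" for q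
    using det_metric_pos[OF that] by (simp add: powr_half_sqrt[symmetric] powr_def)
  ultimately show ?thesis by (subst chart_Ck_cong[of _ "\<lambda>q. exp (ln (det (g c q)) / 2)"]) simp_all
qed

end

section \<open>The weighted Bochner formula in a chart\<close>

text \<open>Here \<open>X\<close> stands for the components of a vector field at a point, \<open>dX\<close> and \<open>ddX\<close> for their
  partial derivatives, \<open>G\<close> for the Christoffel symbols, \<open>DG\<close> for their partial derivatives, and
  \<open>A\<close> for the components of $\nabla X$.  The identity reads
  $\mathrm{div}(\nabla_X X) - X(\mathrm{div} X) = \mathrm{tr}((\nabla X)^2) + \mathrm{Ric}(X,X)$; it holds for
  every torsion-free connection, so no metric enters.\<close>

lemma ricci_identity_algebra:
  fixes X :: "'n::finite \<Rightarrow> real" and dX :: "'n \<Rightarrow> 'n \<Rightarrow> real"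
    and ddX dG :: "'n \<Rightarrow> 'n \<Rightarrow> 'n \<Rightarrow> real" and G :: "'n \<Rightarrow> 'n \<Rightarrow> 'n \<Rightarrow> real"
    and A :: "'n \<Rightarrow> 'n \<Rightarrow> real" and DG :: "'n \<Rightarrow> 'n \<Rightarrow> 'n \<Rightarrow> 'n \<Rightarrow> real"
  assumes sym: "\<And>i j k. G i j k = G i k j" and dd: "\<And>i j k. ddX k j i = ddX j k i"
    and A: "\<And>i j. A i j = dX j i + (\<Sum>k\<in>UNIV. G i j k * X k)"
    and dA: "\<And>l i j. dA l i j = ddX l j i + (\<Sum>k\<in>UNIV. DG l i j k * X k + G i j k * dX l k)"
  shows "(\<Sum>i\<in>UNIV. (\<Sum>k\<in>UNIV. dA i i k * X k + A i k * dX i k) + (\<Sum>j\<in>UNIV. G i i j * (\<Sum>k\<in>UNIV. A j k * X k)))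
      - (\<Sum>k\<in>UNIV. X k * (\<Sum>i\<in>UNIV. dA k i i))
    = (\<Sum>i\<in>UNIV. \<Sum>k\<in>UNIV. A i k * A k i)
      + (\<Sum>j\<in>UNIV. \<Sum>k\<in>UNIV. X j * X k * (\<Sum>i\<in>UNIV. DG i i j k - DG j i i k + (\<Sum>s\<in>UNIV. G i i s * G s j k - G i j s * G s i k)))"
proof -
  define C where "C = (\<lambda>i j. \<Sum>k\<in>UNIV. G i j k * X k)"
  have AC: "A i j = dX j i + C i j" for i j unfolding A C_def ..
  \<comment> \<open>\<open>C\<close> is the connection part of \<open>A\<close>. \<open>R1\<close>
    to \<open>R4\<close> are the four parts of the Ricci term, \<open>DD\<close> collects the second
    derivatives, and \<open>P\<close> and \<open>V\<close> collect products of a Christoffel symbol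
    with a first derivative. In the end \<open>DD\<close> and \<open>V\<close> cancel on the left,
    \<open>P\<close> occurs on both sides, and \<open>R4\<close> cancels on the right.\<close>
  define R1 where "R1 = (\<Sum>j\<in>UNIV. \<Sum>k\<in>UNIV. X j * X k * (\<Sum>i\<in>UNIV. DG i i j k))"
  define R2 where "R2 = (\<Sum>j\<in>UNIV. \<Sum>k\<in>UNIV. X j * X k * (\<Sum>i\<in>UNIV. DG j i i k))"
  define R3 where "R3 = (\<Sum>j\<in>UNIV. \<Sum>k\<in>UNIV. X j * X k * (\<Sum>i\<in>UNIV. \<Sum>s\<in>UNIV. G i i s * G s j k))"
  define R4 where "R4 = (\<Sum>j\<in>UNIV. \<Sum>k\<in>UNIV. X j * X k * (\<Sum>i\<in>UNIV. \<Sum>s\<in>UNIV. G i j s * G s i k))"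
  define DD where "DD = (\<Sum>i\<in>UNIV. \<Sum>k\<in>UNIV. ddX i k i * X k)"
  define P where "P = (\<Sum>i\<in>UNIV. \<Sum>k\<in>UNIV. C i k * dX i k)"
  define V where "V = (\<Sum>i\<in>UNIV. \<Sum>l\<in>UNIV. \<Sum>k\<in>UNIV. G i i l * dX k l * X k)"
  have ric: "(\<Sum>j\<in>UNIV. \<Sum>k\<in>UNIV. X j * X k * (\<Sum>i\<in>UNIV. DG i i j k - DG j i i k + (\<Sum>s\<in>UNIV. G i i s * G s j k - G i j s * G s i k)))
      = R1 - R2 + (R3 - R4)"
    unfolding R1_def R2_def R3_def R4_def
    by (simp only: sum.distrib sum_subtractf distrib_left right_diff_distrib)
  have t1: "(\<Sum>i\<in>UNIV. \<Sum>k\<in>UNIV. dA i i k * X k) = DD + R1 + P"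
  proof -
    have "dA i i k * X k = ddX i k i * X k + (\<Sum>l\<in>UNIV. X k * X l * DG i i k l) + (\<Sum>l\<in>UNIV. X k * (G i k l * dX i l))" for i k
      unfolding dA by (simp add: sum.distrib sum_distrib_left algebra_simps)
    then have "(\<Sum>i\<in>UNIV. \<Sum>k\<in>UNIV. dA i i k * X k) = DD
        + (\<Sum>i\<in>UNIV. \<Sum>k\<in>UNIV. \<Sum>l\<in>UNIV. X k * X l * DG i i k l)
        + (\<Sum>i\<in>UNIV. \<Sum>k\<in>UNIV. \<Sum>l\<in>UNIV. X k * (G i k l * dX i l))"
      by (simp only: DD_def sum.distrib)
    also have "(\<Sum>i\<in>UNIV. \<Sum>k\<in>UNIV. \<Sum>l\<in>UNIV. X k * X l * DG i i k l) = R1"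
      unfolding R1_def sum_distrib_left by (subst sum.swap, rule sum.cong[OF refl], rule sum.swap)
    also have "(\<Sum>i\<in>UNIV. \<Sum>k\<in>UNIV. \<Sum>l\<in>UNIV. X k * (G i k l * dX i l)) = P"
      unfolding P_def C_def sum_distrib_right
      by (rule sum.cong[OF refl], subst sum.swap) (simp add: mult_ac sym[of _ _ ])
    finally show ?thesis .
  qed
  have t2: "(\<Sum>i\<in>UNIV. \<Sum>j\<in>UNIV. G i i j * (\<Sum>k\<in>UNIV. A j k * X k)) = V + R3"
  proof -
    have "G i i j * (\<Sum>k\<in>UNIV. A j k * X k) = (\<Sum>k\<in>UNIV. G i i j * dX k j * X k) + (\<Sum>k\<in>UNIV. \<Sum>l\<in>UNIV. X k * X l * (G i i j * G j k l))" for i j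
      unfolding AC C_def by (simp add: sum.distrib sum_distrib_left sum_distrib_right algebra_simps)
    then have "(\<Sum>i\<in>UNIV. \<Sum>j\<in>UNIV. G i i j * (\<Sum>k\<in>UNIV. A j k * X k)) = V
        + (\<Sum>i\<in>UNIV. \<Sum>j\<in>UNIV. \<Sum>k\<in>UNIV. \<Sum>l\<in>UNIV. X k * X l * (G i i j * G j k l))"
      by (simp only: V_def sum.distrib)
    also have "(\<Sum>i\<in>UNIV. \<Sum>j\<in>UNIV. \<Sum>k\<in>UNIV. \<Sum>l\<in>UNIV. X k * X l * (G i i j * G j k l)) = R3"
      unfolding R3_def sum_distrib_left by (rule sum_swap4)
    finally show ?thesis .
  qed
  have t3: "(\<Sum>k\<in>UNIV. X k * (\<Sum>i\<in>UNIV. dA k i i)) = DD + R2 + V"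
  proof -
    have "X k * (\<Sum>i\<in>UNIV. dA k i i) = (\<Sum>i\<in>UNIV. ddX k i i * X k) + (\<Sum>i\<in>UNIV. \<Sum>l\<in>UNIV. X k * X l * DG k i i l)
        + (\<Sum>i\<in>UNIV. \<Sum>l\<in>UNIV. G i i l * dX k l * X k)" for k
      unfolding dA by (simp add: sum.distrib sum_distrib_left algebra_simps)
    then have "(\<Sum>k\<in>UNIV. X k * (\<Sum>i\<in>UNIV. dA k i i)) = (\<Sum>k\<in>UNIV. \<Sum>i\<in>UNIV. ddX k i i * X k)
        + (\<Sum>k\<in>UNIV. \<Sum>i\<in>UNIV. \<Sum>l\<in>UNIV. X k * X l * DG k i i l)
        + (\<Sum>k\<in>UNIV. \<Sum>i\<in>UNIV. \<Sum>l\<in>UNIV. G i i l * dX k l * X k)"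
      by (simp only: sum.distrib)
    also have "(\<Sum>k\<in>UNIV. \<Sum>i\<in>UNIV. ddX k i i * X k) = DD"
      unfolding DD_def by (subst sum.swap) (simp add: dd)
    also have "(\<Sum>k\<in>UNIV. \<Sum>i\<in>UNIV. \<Sum>l\<in>UNIV. X k * X l * DG k i i l) = R2"
      unfolding R2_def sum_distrib_left by (rule sum.cong[OF refl], rule sum.swap)
    also have "(\<Sum>k\<in>UNIV. \<Sum>i\<in>UNIV. \<Sum>l\<in>UNIV. G i i l * dX k l * X k) = V"
      unfolding V_def by (subst sum.swap, rule sum.cong[OF refl], rule sum.swap)
    finally show ?thesis .
  qed
  have t4: "(\<Sum>i\<in>UNIV. \<Sum>k\<in>UNIV. A i k * A k i) = (\<Sum>i\<in>UNIV. \<Sum>k\<in>UNIV. A i k * dX i k) + P + R4"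
  proof -
    have "A i k * A k i = A i k * dX i k + dX k i * C k i + C i k * C k i" for i k
      by (simp add: AC algebra_simps)
    then have "(\<Sum>i\<in>UNIV. \<Sum>k\<in>UNIV. A i k * A k i) = (\<Sum>i\<in>UNIV. \<Sum>k\<in>UNIV. A i k * dX i k)
       + (\<Sum>i\<in>UNIV. \<Sum>k\<in>UNIV. dX k i * C k i) + (\<Sum>i\<in>UNIV. \<Sum>k\<in>UNIV. C i k * C k i)"
      by (simp only: sum.distrib)
    also have "(\<Sum>i\<in>UNIV. \<Sum>k\<in>UNIV. dX k i * C k i) = P"
      unfolding P_def by (subst sum.swap) (simp add: mult_ac)
    also have "(\<Sum>i\<in>UNIV. \<Sum>k\<in>UNIV. C i k * C k i) = R4"
    proof -
      \<comment> \<open>The symmetry of the symbols puts the indices in the order in which the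
        curvature contracts them.\<close>
      have "C i s * C s i = (\<Sum>j\<in>UNIV. \<Sum>k\<in>UNIV. X j * X k * (G i j s * G s i k))" for i s
        unfolding C_def sum_product by (simp add: sym[of i s] mult_ac)
      then have "(\<Sum>i\<in>UNIV. \<Sum>k\<in>UNIV. C i k * C k i)
          = (\<Sum>i\<in>UNIV. \<Sum>s\<in>UNIV. \<Sum>j\<in>UNIV. \<Sum>k\<in>UNIV. X j * X k * (G i j s * G s i k))" by simp
      then show ?thesis unfolding R4_def sum_distrib_left by (rule trans) (rule sum_swap4)
    qed
    finally show ?thesis .
  qed
  show ?thesis unfolding ric t4 by (simp only: sum.distrib t1 t2 t3)
qed

text \<open>Component \<open>i\<close> of the covariant derivative of the gradient in direction
  \<open>j\<close>, that is, the Hessian with one index raised. In this form its trace and the trace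
  of its square involve no metric.\<close>

definition cov_grad :: "('a, 'n::finite) tensor2 \<Rightarrow> ('a, 'n) chart \<Rightarrow> ('a \<Rightarrow> real) \<Rightarrow> 'n \<Rightarrow> 'n \<Rightarrow> 'a \<Rightarrow> real" where
  "cov_grad g c h i j p = partial c j (\<lambda>q. grad g h c q $ i) p
     + (\<Sum>k\<in>UNIV. christoffel g c i j k p * grad g h c p $ k)"

lemma lap_eq_cov_grad: "lap g c h p = (\<Sum>i\<in>UNIV. cov_grad g c h i i p)"
  by (simp add: lap_def cov_grad_def sum.distrib)

context riemannian_chart
begin

lemma partial_sum_mult:
  assumes "\<And>k. chart_Ck c 1 (a k)" "\<And>k. chart_Ck c 1 (b k)" "p \<in> dom c"
  shows "partial c j (\<lambda>q. \<Sum>k\<in>K. a k q * b k q) p = (\<Sum>k\<in>K. partial c j (a k) p * b k p + a k p * partial c j (b k) p)"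
proof -
  have "partial c j (\<lambda>q. \<Sum>k\<in>K. a k q * b k q) p = (\<Sum>k\<in>K. partial c j (\<lambda>q. a k q * b k q) p)"
    by (rule partial_sum) (use assms chart_Ck_mult in blast)+
  also have "\<dots> = (\<Sum>k\<in>K. partial c j (a k) p * b k p + a k p * partial c j (b k) p)"
    by (intro sum.cong refl partial_mult assms)
  finally show ?thesis .
qed

lemma Hess_sym:
  assumes "chart_Ck c 2 h" "p \<in> dom c"
  shows "Hess g h c p $ i $ j = Hess g h c p $ j $ i"
  using partial_commute[OF assms] by (simp add: Hess_def christoffel_sym[OF assms(2), of _ i j])

text \<open>Raising an index commutes with covariant differentiation. Of the two Christoffel terms
  in the derivative of the inverse metric, one cancels the connection term of
  \<open>cov_grad\<close> and the other completes the second partial derivative to the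
  Hessian.\<close>

lemma cov_grad_eq:
  assumes h: "chart_Ck c 2 h" and p: "p \<in> dom c"
  shows "cov_grad g c h i j p = (\<Sum>k\<in>UNIV. matrix_inv (g c p) $ i $ k * Hess g h c p $ k $ j)"
proof -
  have h1: "chart_Ck c 1 (partial c k h)" for k
    using chart_Ck_partial[of 1 h k] h by (simp add: numeral_2_eq_2)
  define \<Gamma> where "\<Gamma> = (\<lambda>i k. christoffel g c i j k p)"
  define H where "H = (\<lambda>i k. matrix_inv (g c p) $ i $ k)"
  define d where "d = (\<lambda>k. partial c k h p)"
  define dd where "dd = (\<lambda>k. partial c j (partial c k h) p)"
  have "partial c j (\<lambda>q. grad g h c q $ i) p =
      (\<Sum>k\<in>UNIV. partial c j (\<lambda>q. matrix_inv (g c q) $ i $ k) p * d k + H i k * dd k)"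
    unfolding grad_nth H_def d_def dd_def by (rule partial_sum_mult[OF chart_Ck_inverse_metric h1 p])
  also have "\<dots> = (\<Sum>k\<in>UNIV. (- (\<Sum>l\<in>UNIV. \<Gamma> i l * H l k) - (\<Sum>l\<in>UNIV. \<Gamma> k l * H i l)) * d k + H i k * dd k)"
    unfolding partial_inverse_metric[OF p] \<Gamma>_def H_def ..
  also have "\<dots> = - (\<Sum>k\<in>UNIV. \<Sum>l\<in>UNIV. \<Gamma> i l * (H l k * d k)) - (\<Sum>k\<in>UNIV. \<Sum>l\<in>UNIV. \<Gamma> k l * (H i l * d k)) + (\<Sum>k\<in>UNIV. H i k * dd k)"
    by (simp only: sum.distrib sum_subtractf sum_negf left_diff_distrib sum_distrib_right mult.assoc mult_minus_left)
  also have "(\<Sum>k\<in>UNIV. \<Sum>l\<in>UNIV. \<Gamma> i l * (H l k * d k)) = (\<Sum>l\<in>UNIV. \<Gamma> i l * grad g h c p $ l)"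
    by (subst sum.swap) (simp only: grad_nth H_def d_def sum_distrib_left)
  also have "(\<Sum>k\<in>UNIV. \<Sum>l\<in>UNIV. \<Gamma> k l * (H i l * d k)) = (\<Sum>l\<in>UNIV. H i l * (\<Sum>k\<in>UNIV. \<Gamma> k l * d k))"
    by (subst sum.swap) (simp only: sum_distrib_left mult.left_commute)
  finally have "cov_grad g c h i j p = (\<Sum>k\<in>UNIV. H i k * (dd k - (\<Sum>l\<in>UNIV. \<Gamma> l k * d l)))"
    unfolding cov_grad_def \<Gamma>_def by (simp add: sum_subtractf right_diff_distrib)
  moreover have "Hess g h c p $ k $ j = dd k - (\<Sum>l\<in>UNIV. \<Gamma> l k * d l)" for k
    unfolding Hess_sym[OF h p, of k j] by (simp add: Hess_def dd_def \<Gamma>_def d_def)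
  ultimately show ?thesis by (simp add: H_def)
qed

lemma chart_Ck_cov_grad: "chart_Ck c (Suc (Suc k)) h \<Longrightarrow> chart_Ck c k (cov_grad g c h i j)"
  unfolding cov_grad_def[abs_def]
  by (intro chart_Ck_sum chart_Ck_mult chart_Ck_add chart_Ck_partial chart_Ck_grad chart_Ck_christoffel)
     (simp_all add: chart_Ck_le[of "Suc (Suc k)"])

text \<open>By metric compatibility both factors of the squared gradient contribute the Hessian
  applied to the gradient, and the two copies absorb the factor 1/2.\<close>

lemma partial_grad_inner_self:
  assumes h: "chart_Ck c 2 h" and p: "p \<in> dom c"
  shows "partial c j (\<lambda>q. grad_inner g c h h q / 2) p = (\<Sum>k\<in>UNIV. Hess g h c p $ j $ k * grad g h c p $ k)"
proof -
  have h1: "chart_Ck c 1 (partial c k h)" and h2: "chart_Ck c 1 (\<lambda>q. grad g h c q $ k)" for k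
    using chart_Ck_partial[of 1 h k] chart_Ck_grad[of 1 h k] h by (simp_all add: numeral_2_eq_2)
  define X where "X = (\<lambda>k. grad g h c p $ k)"
  define \<Gamma> where "\<Gamma> = (\<lambda>i k. christoffel g c i j k p)"
  define d where "d = (\<lambda>k. partial c k h p)"
  define dd where "dd = (\<lambda>k. partial c j (partial c k h) p)"
  define H where "H = (\<lambda>k. Hess g h c p $ j $ k)"
  have "partial c j (\<lambda>q. grad_inner g c h h q / 2) p = partial c j (\<lambda>q. 1/2 * grad_inner g c h h q) p" by simp
  also have "\<dots> = 1/2 * partial c j (grad_inner g c h h) p"
    by (rule partial_cmult) (use h p chart_Ck_grad_inner[of 1 h h] in \<open>auto simp: numeral_2_eq_2\<close>)
  also have "partial c j (grad_inner g c h h) p = (\<Sum>k\<in>UNIV. dd k * X k + d k * partial c j (\<lambda>q. grad g h c q $ k) p)"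
    unfolding grad_inner_def[abs_def] X_def d_def dd_def by (rule partial_sum_mult[OF h1 h2 p])
  also have "\<dots> = (\<Sum>k\<in>UNIV. (H k + (\<Sum>l\<in>UNIV. \<Gamma> l k * d l)) * X k + d k * (cov_grad g c h k j p - (\<Sum>l\<in>UNIV. \<Gamma> k l * X l)))"
    by (simp add: H_def dd_def \<Gamma>_def d_def X_def Hess_def cov_grad_def)
  also have "\<dots> = (\<Sum>k\<in>UNIV. H k * X k) + (\<Sum>k\<in>UNIV. d k * cov_grad g c h k j p)
      + (\<Sum>k\<in>UNIV. \<Sum>l\<in>UNIV. \<Gamma> l k * d l * X k) - (\<Sum>k\<in>UNIV. \<Sum>l\<in>UNIV. \<Gamma> k l * d k * X l)"
  proof -
    have "(H k + (\<Sum>l\<in>UNIV. \<Gamma> l k * d l)) * X k + d k * (cov_grad g c h k j p - (\<Sum>l\<in>UNIV. \<Gamma> k l * X l))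
      = H k * X k + d k * cov_grad g c h k j p + (\<Sum>l\<in>UNIV. \<Gamma> l k * d l * X k) - (\<Sum>l\<in>UNIV. \<Gamma> k l * d k * X l)" for k
    proof -
      have "d k * (\<Sum>l\<in>UNIV. \<Gamma> k l * X l) = (\<Sum>l\<in>UNIV. \<Gamma> k l * d k * X l)"
        unfolding sum_distrib_left by (simp only: mult_ac)
      then show ?thesis by (simp only: distrib_right right_diff_distrib sum_distrib_right)
    qed
    then show ?thesis by (simp only: sum.distrib sum_subtractf)
  qed
  \<comment> \<open>Up to the names of the indices the two Christoffel sums agree, so they
    cancel.\<close>
  also have "(\<Sum>k\<in>UNIV. \<Sum>l\<in>UNIV. \<Gamma> l k * d l * X k) = (\<Sum>k\<in>UNIV. \<Sum>l\<in>UNIV. \<Gamma> k l * d k * X l)"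
    by (rule sum.swap)
  also have "(\<Sum>k\<in>UNIV. d k * cov_grad g c h k j p) = (\<Sum>k\<in>UNIV. H k * X k)"
  proof -
    have "(\<Sum>k\<in>UNIV. d k * cov_grad g c h k j p) = (\<Sum>k\<in>UNIV. \<Sum>l\<in>UNIV. d k * (matrix_inv (g c p) $ l $ k * H l))"
      unfolding cov_grad_eq[OF h p] sum_distrib_left H_def
      by (simp only: Hess_sym[OF h p, of j] inverse_metric_sym[OF p])
    also have "\<dots> = (\<Sum>l\<in>UNIV. \<Sum>k\<in>UNIV. H l * (matrix_inv (g c p) $ l $ k * d k))"
      by (subst sum.swap) (simp only: mult_ac)
    also have "\<dots> = (\<Sum>l\<in>UNIV. H l * X l)"
      by (simp only: X_def grad_nth d_def sum_distrib_left)
    finally show ?thesis .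
  qed
  finally show ?thesis by (simp add: H_def X_def)
qed

text \<open>With X the gradient of \<open>h\<close>, this says that the gradient of half of its
  squared length is nabla_X X. It is the link between the Bochner formula and the algebraic identity
  for div(nabla_X X).\<close>

lemma grad_grad_inner_self:
  assumes h: "chart_Ck c 2 h" and p: "p \<in> dom c"
  shows "grad g (\<lambda>q. grad_inner g c h h q / 2) c p $ i = (\<Sum>k\<in>UNIV. cov_grad g c h i k p * grad g h c p $ k)"
  unfolding grad_nth[of "\<lambda>q. grad_inner g c h h q / 2"] partial_grad_inner_self[OF h p] cov_grad_eq[OF h p] sum_distrib_left sum_distrib_right
  by (subst sum.swap) (simp only: mult_ac)

text \<open>Because the Hessian is symmetric, its squared norm is the trace of the square of its
  mixed form, the term which the Ricci identity produces.\<close>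

lemma tensor_square_eq_trace:
  assumes h: "chart_Ck c 2 h" and p: "p \<in> dom c"
  shows "(\<Sum>i\<in>UNIV. \<Sum>j\<in>UNIV. \<Sum>k\<in>UNIV. \<Sum>l\<in>UNIV. matrix_inv (g c p) $ i $ k * matrix_inv (g c p) $ j $ l
            * Hess g h c p $ i $ j * Hess g h c p $ k $ l)
       = (\<Sum>i\<in>UNIV. \<Sum>k\<in>UNIV. cov_grad g c h i k p * cov_grad g c h k i p)"
proof -
  define H where "H = (\<lambda>i j. Hess g h c p $ i $ j)"
  define I where "I = (\<lambda>i j. matrix_inv (g c p) $ i $ j)"
  have Hs: "H i j = H j i" for i j unfolding H_def by (rule Hess_sym[OF h p])
  have Is: "I i j = I j i" for i j unfolding I_def by (rule inverse_metric_sym[OF p])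
  have "(\<Sum>a\<in>UNIV. \<Sum>b\<in>UNIV. cov_grad g c h a b p * cov_grad g c h b a p)
      = (\<Sum>a\<in>UNIV. \<Sum>b\<in>UNIV. \<Sum>k\<in>UNIV. \<Sum>l\<in>UNIV. (I a k * H k b) * (I b l * H l a))"
    unfolding cov_grad_eq[OF h p] H_def I_def sum_product ..
  also have "\<dots> = (\<Sum>a\<in>UNIV. \<Sum>k\<in>UNIV. \<Sum>b\<in>UNIV. \<Sum>l\<in>UNIV. (I a k * H k b) * (I b l * H l a))"
    by (rule sum.cong[OF refl], rule sum.swap)
  also have "\<dots> = (\<Sum>a\<in>UNIV. \<Sum>k\<in>UNIV. \<Sum>l\<in>UNIV. \<Sum>b\<in>UNIV. (I a k * H k b) * (I b l * H l a))"
    by (rule sum.cong[OF refl], rule sum.cong[OF refl], rule sum.swap)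
  also have "\<dots> = (\<Sum>a\<in>UNIV. \<Sum>l\<in>UNIV. \<Sum>k\<in>UNIV. \<Sum>b\<in>UNIV. (I a k * H k b) * (I b l * H l a))"
    by (rule sum.cong[OF refl], rule sum.swap)
  also have "\<dots> = (\<Sum>i\<in>UNIV. \<Sum>j\<in>UNIV. \<Sum>k\<in>UNIV. \<Sum>l\<in>UNIV. I i k * I j l * H i j * H k l)"
  proof (intro sum.cong[OF refl])
    fix i j k l
    show "I i k * H k l * (I l j * H j i) = I i k * I j l * H i j * H k l"
      using Hs[of j i] Is[of l j] by simp
  qed
  finally show ?thesis unfolding H_def I_def by simp
qed

text \<open>The Ricci identity for the gradient field X: div(nabla_X X) is the Laplacian of half the
  squared gradient, and X(div X) is the product of the gradients of \<open>h\<close> and of its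
  Laplacian.\<close>

lemma bochner:
  assumes h: "chart_Ck c 3 h" and p: "p \<in> dom c"
  shows "lap g c (\<lambda>q. grad_inner g c h h q / 2) p - grad_inner g c h (lap g c h) p
    = (\<Sum>i\<in>UNIV. \<Sum>j\<in>UNIV. \<Sum>k\<in>UNIV. \<Sum>l\<in>UNIV. matrix_inv (g c p) $ i $ k * matrix_inv (g c p) $ j $ l
            * Hess g h c p $ i $ j * Hess g h c p $ k $ l)
      + grad g h c p \<bullet> (Ric g c p *v grad g h c p)"
proof -
  have h2: "chart_Ck c 2 h" using h chart_Ck_le by fastforce
  have cX: "chart_Ck c 2 (\<lambda>q. grad g h c q $ i)" "chart_Ck c 1 (\<lambda>q. grad g h c q $ i)" for i
    using chart_Ck_grad[of 2 h i] h chart_Ck_le[of 2 _ 1] by simp_all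
  have cA: "chart_Ck c 1 (cov_grad g c h i j)" for i j
    using chart_Ck_cov_grad[of 1 h i j] h by (simp add: numeral_3_eq_3)
  have cdX: "chart_Ck c 1 (partial c j (\<lambda>q. grad g h c q $ i))" for i j
    using chart_Ck_partial[of 1 _ j] cX(1)[of i] by (simp add: numeral_2_eq_2)
  define Q where "Q = (\<lambda>q. grad_inner g c h h q / 2)"
  have cQ: "chart_Ck c 2 Q" unfolding Q_def using h
    by (intro chart_Ck_divide_const chart_Ck_grad_inner) simp_all
  have cgQ: "chart_Ck c 1 (\<lambda>q. grad g Q c q $ i)" for i
    using chart_Ck_grad[of 1 Q i] cQ by (simp add: numeral_2_eq_2)
  define X where "X = (\<lambda>i. grad g h c p $ i)"
  define dX where "dX = (\<lambda>j i. partial c j (\<lambda>q. grad g h c q $ i) p)"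
  define ddX where "ddX = (\<lambda>k j i. partial c k (partial c j (\<lambda>q. grad g h c q $ i)) p)"
  define G where "G = (\<lambda>i j k. christoffel g c i j k p)"
  define DG where "DG = (\<lambda>l i j k. partial c l (christoffel g c i j k) p)"
  define A where "A = (\<lambda>i j. cov_grad g c h i j p)"
  define dA where "dA = (\<lambda>l i j. partial c l (cov_grad g c h i j) p)"
  have sym: "G i j k = G i k j" for i j k unfolding G_def by (rule christoffel_sym[OF p])
  \<comment> \<open>Three derivatives of \<open>h\<close> are spent here: the components of the
    gradient must be of class C^2.\<close>
  have dd: "ddX k j i = ddX j k i" for i j k unfolding ddX_def by (rule partial_commute[OF cX(1) p])
  have A: "A i j = dX j i + (\<Sum>k\<in>UNIV. G i j k * X k)" for i j
    by (simp add: A_def dX_def G_def X_def cov_grad_def)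
  have dA: "dA l i j = ddX l j i + (\<Sum>k\<in>UNIV. DG l i j k * X k + G i j k * dX l k)" for l i j
  proof -
    have "dA l i j = ddX l j i + partial c l (\<lambda>q. \<Sum>k\<in>UNIV. christoffel g c i j k q * grad g h c q $ k) p"
      unfolding dA_def ddX_def cov_grad_def[abs_def]
      by (rule partial_add[OF cdX _ p]) (intro chart_Ck_sum chart_Ck_mult chart_Ck_christoffel cX)
    also have "partial c l (\<lambda>q. \<Sum>k\<in>UNIV. christoffel g c i j k q * grad g h c q $ k) p
        = (\<Sum>k\<in>UNIV. DG l i j k * X k + G i j k * dX l k)"
      unfolding DG_def X_def G_def dX_def by (rule partial_sum_mult[OF chart_Ck_christoffel cX(2) p])
    finally show ?thesis .
  qed
  have "partial c i (\<lambda>q. grad g Q c q $ i) p = (\<Sum>k\<in>UNIV. dA i i k * X k + A i k * dX i k)" for i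
  proof -
    have "partial c i (\<lambda>q. grad g Q c q $ i) p = partial c i (\<lambda>q. \<Sum>k\<in>UNIV. cov_grad g c h i k q * grad g h c q $ k) p"
      by (rule partial_cong[OF cgQ _ p]) (unfold Q_def, rule grad_grad_inner_self[OF h2])
    also have "\<dots> = (\<Sum>k\<in>UNIV. dA i i k * X k + A i k * dX i k)"
      unfolding dA_def X_def A_def dX_def by (rule partial_sum_mult[OF cA cX(2) p])
    finally show ?thesis .
  qed
  then have lapQ: "lap g c Q p = (\<Sum>i\<in>UNIV. (\<Sum>k\<in>UNIV. dA i i k * X k + A i k * dX i k) + (\<Sum>j\<in>UNIV. G i i j * (\<Sum>k\<in>UNIV. A j k * X k)))"
    unfolding lap_def Q_def grad_grad_inner_self[OF h2 p] by (simp add: G_def A_def X_def)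
  have "partial c k (lap g c h) p = (\<Sum>i\<in>UNIV. dA k i i)" for k
    unfolding lap_eq_cov_grad[abs_def] dA_def by (rule partial_sum[OF cA p])
  then have lap': "grad_inner g c h (lap g c h) p = (\<Sum>k\<in>UNIV. X k * (\<Sum>i\<in>UNIV. dA k i i))"
    unfolding grad_inner_commute[OF p, of h] by (simp add: grad_inner_def X_def mult.commute)
  have "grad g h c p \<bullet> (Ric g c p *v grad g h c p)
      = (\<Sum>j\<in>UNIV. \<Sum>k\<in>UNIV. X j * X k * (\<Sum>i\<in>UNIV. DG i i j k - DG j i i k + (\<Sum>s\<in>UNIV. G i i s * G s j k - G i j s * G s i k)))"
    unfolding inner_vec_def matrix_vector_mult_def Ric_def curvature_def
    by (simp add: X_def DG_def G_def sum_distrib_left mult_ac)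
  then show ?thesis
    unfolding tensor_square_eq_trace[OF h2 p]
    using ricci_identity_algebra[of G ddX A dX X dA DG, OF sym dd A dA] lapQ lap' unfolding Q_def A_def by simp
qed

text \<open>The drift contributes the difference <h, <f, h>> - <f, |grad h|^2 / 2>. Its derivatives
  of the gradient of \<open>h\<close> cancel, and the second derivatives of \<open>f\<close> combine
  to the Hessian of \<open>f\<close>.\<close>

lemma weighted_bochner:
  assumes h: "chart_Ck c 3 h" and f: "chart_Ck c 2 f" and p: "p \<in> dom c"
  shows "lap g c (\<lambda>q. grad_inner g c h h q / 2) p - grad_inner g c f (\<lambda>q. grad_inner g c h h q / 2) p
      - grad_inner g c h (\<lambda>q. lap g c h q - grad_inner g c f h q) p
    = (\<Sum>i\<in>UNIV. \<Sum>j\<in>UNIV. \<Sum>k\<in>UNIV. \<Sum>l\<in>UNIV. matrix_inv (g c p) $ i $ k * matrix_inv (g c p) $ j $ l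
            * Hess g h c p $ i $ j * Hess g h c p $ k $ l)
      + grad g h c p \<bullet> (Ric g c p *v grad g h c p) + grad g h c p \<bullet> (Hess g f c p *v grad g h c p)"
proof -
  have h2: "chart_Ck c 2 h" using h chart_Ck_le by fastforce
  have f1: "chart_Ck c 1 f" using f chart_Ck_le by fastforce
  have df: "chart_Ck c 1 (partial c j f)" for j
    using chart_Ck_partial[of 1 f j] f by (simp add: numeral_2_eq_2)
  have cX: "chart_Ck c 1 (\<lambda>q. grad g h c q $ i)" for i
    using chart_Ck_grad[of 1 h i] h2 by (simp add: numeral_2_eq_2)
  have cL: "chart_Ck c 1 (lap g c h)" using chart_Ck_lap[of 1 h] h by (simp add: numeral_3_eq_3)
  have cfh: "chart_Ck c 1 (grad_inner g c f h)" using chart_Ck_grad_inner[of 1 f h] f h2 by (simp add: numeral_2_eq_2)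
  define X where "X = (\<lambda>i. grad g h c p $ i)"
  define F where "F = (\<lambda>i. partial c i f p)"
  define G where "G = (\<lambda>i j k. christoffel g c i j k p)"
  have "grad_inner g c h (\<lambda>q. lap g c h q - grad_inner g c f h q) p
      = grad_inner g c h (lap g c h) p - grad_inner g c h (grad_inner g c f h) p"
  proof -
    have gi: "grad_inner g c h b p = (\<Sum>i\<in>UNIV. partial c i b p * X i)" for b
      unfolding grad_inner_commute[OF p, of h] by (simp add: grad_inner_def X_def)
    show ?thesis unfolding gi partial_diff[OF cL cfh p] by (simp add: left_diff_distrib sum_subtractf)
  qed
  moreover have "grad_inner g c h (grad_inner g c f h) p - grad_inner g c f (\<lambda>q. grad_inner g c h h q / 2) p
     = grad g h c p \<bullet> (Hess g f c p *v grad g h c p)"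
  proof -
    have "partial c j (grad_inner g c f h) p = (\<Sum>i\<in>UNIV. partial c j (partial c i f) p * X i + F i * partial c j (\<lambda>q. grad g h c q $ i) p)" for j
      unfolding grad_inner_def[abs_def] X_def F_def by (rule partial_sum_mult[OF df cX p])
    then have "grad_inner g c h (grad_inner g c f h) p
        = (\<Sum>j\<in>UNIV. (\<Sum>i\<in>UNIV. partial c j (partial c i f) p * X i + F i * partial c j (\<lambda>q. grad g h c q $ i) p) * X j)"
      unfolding grad_inner_commute[OF p, of h] by (simp add: grad_inner_def[of _ _ _ h] X_def)
    also have "\<dots> = (\<Sum>j\<in>UNIV. \<Sum>i\<in>UNIV. X j * (partial c j (partial c i f) p * X i))
         + (\<Sum>j\<in>UNIV. \<Sum>i\<in>UNIV. F i * (partial c j (\<lambda>q. grad g h c q $ i) p * X j))"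
      unfolding sum_distrib_right sum.distrib[symmetric] by (intro sum.cong refl) (simp add: algebra_simps)
    also have "(\<Sum>j\<in>UNIV. \<Sum>i\<in>UNIV. F i * (partial c j (\<lambda>q. grad g h c q $ i) p * X j))
        = (\<Sum>i\<in>UNIV. \<Sum>j\<in>UNIV. F i * (partial c j (\<lambda>q. grad g h c q $ i) p * X j))" by (rule sum.swap)
    finally have 1: "grad_inner g c h (grad_inner g c f h) p = (\<Sum>j\<in>UNIV. \<Sum>i\<in>UNIV. X j * (partial c j (partial c i f) p * X i))
         + (\<Sum>i\<in>UNIV. \<Sum>j\<in>UNIV. F i * (partial c j (\<lambda>q. grad g h c q $ i) p * X j))" .
    have "F i * (\<Sum>j\<in>UNIV. cov_grad g c h i j p * X j)
       = (\<Sum>j\<in>UNIV. F i * (partial c j (\<lambda>q. grad g h c q $ i) p * X j)) + (\<Sum>j\<in>UNIV. \<Sum>k\<in>UNIV. X j * (G i j k * F i * X k))" for i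
      unfolding sum_distrib_left sum.distrib[symmetric]
    proof (rule sum.cong[OF refl])
      fix j
      have "X j * F i * (\<Sum>k\<in>UNIV. G i j k * X k) = (\<Sum>k\<in>UNIV. X j * (G i j k * F i * X k))"
        unfolding sum_distrib_left by (simp only: mult_ac)
      then show "F i * (cov_grad g c h i j p * X j) = F i * (partial c j (\<lambda>q. grad g h c q $ i) p * X j) + (\<Sum>k\<in>UNIV. X j * (G i j k * F i * X k))"
        by (simp add: cov_grad_def G_def X_def algebra_simps)
    qed
    \<comment> \<open>The gradient of half the squared gradient is replaced by the covariant
      derivative of the gradient; its first sum agrees with the one in 1, and its second sum is the
      Christoffel part of the Hessian of \<open>f\<close>.\<close>
    then have 2: "grad_inner g c f (\<lambda>q. grad_inner g c h h q / 2) p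
       = (\<Sum>i\<in>UNIV. \<Sum>j\<in>UNIV. F i * (partial c j (\<lambda>q. grad g h c q $ i) p * X j)) + (\<Sum>i\<in>UNIV. \<Sum>j\<in>UNIV. \<Sum>k\<in>UNIV. X j * (G i j k * F i * X k))"
      unfolding grad_inner_def[of _ _ f] grad_grad_inner_self[OF h2 p] by (simp add: F_def X_def sum.distrib)
    have "grad g h c p \<bullet> (Hess g f c p *v grad g h c p)
        = (\<Sum>j\<in>UNIV. \<Sum>i\<in>UNIV. X j * (partial c j (partial c i f) p * X i)) - (\<Sum>j\<in>UNIV. \<Sum>k\<in>UNIV. \<Sum>i\<in>UNIV. X j * (G i j k * F i * X k))"
      unfolding inner_vec_def matrix_vector_mult_def Hess_def
      by (simp add: X_def F_def G_def left_diff_distrib right_diff_distrib sum_subtractf sum_distrib_left sum_distrib_right)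
    moreover have "(\<Sum>j\<in>UNIV. \<Sum>k\<in>UNIV. \<Sum>i\<in>UNIV. X j * (G i j k * F i * X k)) = (\<Sum>i\<in>UNIV. \<Sum>j\<in>UNIV. \<Sum>k\<in>UNIV. X j * (G i j k * F i * X k))"
      by (subst (2) sum.swap, rule sum.cong[OF refl], rule sum.swap)
    ultimately show ?thesis using 1 2 by simp
  qed
  ultimately show ?thesis using bochner[OF h p] by simp
qed

text \<open>Expansion of a square. A contraction with the metric in one slot collapses to a trace,
  and the trace of the metric itself is the dimension.\<close>

lemma tensor_square_shift:
  fixes S :: "real^'n^'n"
  assumes p: "p \<in> dom c" and S: "\<And>i j. S $ i $ j = S $ j $ i"
  shows "(\<Sum>i\<in>UNIV. \<Sum>j\<in>UNIV. \<Sum>k\<in>UNIV. \<Sum>l\<in>UNIV. matrix_inv (g c p) $ i $ k * matrix_inv (g c p) $ j $ l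
            * (S - a *\<^sub>R g c p) $ i $ j * (S - a *\<^sub>R g c p) $ k $ l)
       = (\<Sum>i\<in>UNIV. \<Sum>j\<in>UNIV. \<Sum>k\<in>UNIV. \<Sum>l\<in>UNIV. matrix_inv (g c p) $ i $ k * matrix_inv (g c p) $ j $ l
            * S $ i $ j * S $ k $ l)
         - 2 * a * (\<Sum>i\<in>UNIV. \<Sum>k\<in>UNIV. matrix_inv (g c p) $ i $ k * S $ k $ i) + a\<^sup>2 * real CARD('n)"
proof -
  define I where "I = (\<lambda>i j. matrix_inv (g c p) $ i $ j)"
  define G where "G = (\<lambda>i j. g c p $ i $ j)"
  have Is: "I i j = I j i" for i j unfolding I_def by (rule inverse_metric_sym[OF p])
  have Gs: "G i j = G j i" for i j unfolding G_def by (rule metric_entry_sym[OF p])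
  have GI: "(\<Sum>l\<in>UNIV. G k l * I l j) = (if k = j then 1 else 0)" for k j
    using metric_inverse[OF p] by (simp add: I_def G_def)
  have c1: "(\<Sum>i\<in>UNIV. \<Sum>j\<in>UNIV. \<Sum>k\<in>UNIV. \<Sum>l\<in>UNIV. I i k * I j l * T i j * G k l) = (\<Sum>i\<in>UNIV. \<Sum>j\<in>UNIV. I i j * T j i)"
    if T: "\<And>i j. T i j = T j i" for T :: "'n \<Rightarrow> 'n \<Rightarrow> real"
  proof (intro sum.cong refl)
    fix i j
    have "(\<Sum>k\<in>UNIV. \<Sum>l\<in>UNIV. I i k * I j l * T i j * G k l) = (\<Sum>k\<in>UNIV. I i k * T i j * (\<Sum>l\<in>UNIV. G k l * I l j))"
      unfolding sum_distrib_left by (simp only: Is[of _ j] mult_ac)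
    also have "\<dots> = I i j * T j i" unfolding GI by (simp only: sum_delta_mult T[of j i])
    finally show "(\<Sum>k\<in>UNIV. \<Sum>l\<in>UNIV. I i k * I j l * T i j * G k l) = I i j * T j i" .
  qed
  have c2: "(\<Sum>i\<in>UNIV. \<Sum>j\<in>UNIV. \<Sum>k\<in>UNIV. \<Sum>l\<in>UNIV. I i k * I j l * G i j * T k l) = (\<Sum>i\<in>UNIV. \<Sum>j\<in>UNIV. I i j * T j i)"
    if T: "\<And>i j. T i j = T j i" for T :: "'n \<Rightarrow> 'n \<Rightarrow> real"
  proof -
    have "(\<Sum>i\<in>UNIV. \<Sum>j\<in>UNIV. \<Sum>k\<in>UNIV. \<Sum>l\<in>UNIV. I i k * I j l * G i j * T k l)
        = (\<Sum>k\<in>UNIV. \<Sum>l\<in>UNIV. \<Sum>i\<in>UNIV. \<Sum>j\<in>UNIV. I i k * I j l * G i j * T k l)" by (rule sum_swap4)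
    also have "\<dots> = (\<Sum>k\<in>UNIV. \<Sum>l\<in>UNIV. \<Sum>i\<in>UNIV. \<Sum>j\<in>UNIV. I k i * I l j * T k l * G i j)"
    proof (intro sum.cong refl)
      fix i j k l show "I i k * I j l * G i j * T k l = I k i * I l j * T k l * G i j"
        using Is[of i k] Is[of j l] by simp
    qed
    also have "\<dots> = (\<Sum>i\<in>UNIV. \<Sum>j\<in>UNIV. I i j * T j i)" by (rule c1[OF T])
    finally show ?thesis .
  qed
  have c3: "(\<Sum>i\<in>UNIV. \<Sum>j\<in>UNIV. I i j * G j i) = real CARD('n)"
    using metric_inverse(2)[OF p] by (simp add: I_def G_def)
  have "I i k * I j l * (S $ i $ j - a * G i j) * (S $ k $ l - a * G k l)
      = I i k * I j l * S $ i $ j * S $ k $ l - a * (I i k * I j l * S $ i $ j * G k l)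
        - a * (I i k * I j l * G i j * S $ k $ l) + a\<^sup>2 * (I i k * I j l * G i j * G k l)" for i j k l
    by (simp add: algebra_simps power2_eq_square)
  then have "(\<Sum>i\<in>UNIV. \<Sum>j\<in>UNIV. \<Sum>k\<in>UNIV. \<Sum>l\<in>UNIV. I i k * I j l * (S $ i $ j - a * G i j) * (S $ k $ l - a * G k l))
    = (\<Sum>i\<in>UNIV. \<Sum>j\<in>UNIV. \<Sum>k\<in>UNIV. \<Sum>l\<in>UNIV. I i k * I j l * S $ i $ j * S $ k $ l)
     - a * (\<Sum>i\<in>UNIV. \<Sum>j\<in>UNIV. \<Sum>k\<in>UNIV. \<Sum>l\<in>UNIV. I i k * I j l * S $ i $ j * G k l)
     - a * (\<Sum>i\<in>UNIV. \<Sum>j\<in>UNIV. \<Sum>k\<in>UNIV. \<Sum>l\<in>UNIV. I i k * I j l * G i j * S $ k $ l)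
     + a\<^sup>2 * (\<Sum>i\<in>UNIV. \<Sum>j\<in>UNIV. \<Sum>k\<in>UNIV. \<Sum>l\<in>UNIV. I i k * I j l * G i j * G k l)"
    by (simp only: sum.distrib sum_subtractf sum_distrib_left)
  also have "\<dots> = (\<Sum>i\<in>UNIV. \<Sum>j\<in>UNIV. \<Sum>k\<in>UNIV. \<Sum>l\<in>UNIV. I i k * I j l * S $ i $ j * S $ k $ l)
     - 2 * a * (\<Sum>i\<in>UNIV. \<Sum>j\<in>UNIV. I i j * S $ j $ i) + a\<^sup>2 * real CARD('n)"
    using c1[of "\<lambda>i j. S $ i $ j", OF S] c2[of "\<lambda>i j. S $ i $ j", OF S] c1[of G, OF Gs] c3 by simp
  finally show ?thesis by (simp add: I_def G_def)
qed

lemma lap_eq_trace_Hess: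
  assumes "chart_Ck c 2 h" "p \<in> dom c"
  shows "lap g c h p = (\<Sum>i\<in>UNIV. \<Sum>k\<in>UNIV. matrix_inv (g c p) $ i $ k * Hess g h c p $ k $ i)"
  unfolding lap_eq_cov_grad cov_grad_eq[OF assms] ..

end

section \<open>Integration by parts in a chart\<close>

lemma Ck_on_Un:
  assumes "open S" "open T" "Ck_on k S h" "Ck_on k T h"
  shows "Ck_on k (S \<union> T) h"
  using assms(3,4) by (induction k arbitrary: h) (auto simp: continuous_on_open_Un assms(1,2))

text \<open>The open sets \<open>S\<close> and \<open>- K\<close> cover the space. The extension
  agrees with \<open>h\<close> on the first and vanishes on the second.\<close>

lemma Ck_on_extend_zero:
  fixes h :: "'v::{real_normed_vector,t2_space} \<Rightarrow> 'w::real_normed_vector"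
  assumes "open S" "compact K" "K \<subseteq> S" "Ck_on k S h" "\<And>z. z \<in> S - K \<Longrightarrow> h z = 0"
  shows "Ck_on k UNIV (\<lambda>z. if z \<in> S then h z else 0)"
proof -
  have o: "open (- K)" using assms(2) compact_imp_closed by blast
  have "Ck_on k S (\<lambda>z. if z \<in> S then h z else 0)"
    by (subst Ck_on_cong[OF assms(1), of _ h]) (auto simp: assms)
  moreover have "Ck_on k (- K) (\<lambda>z. if z \<in> S then h z else 0)"
    by (subst Ck_on_cong[OF o, of _ "\<lambda>_. 0"]) (auto simp: assms Ck_on_const o)
  ultimately have "Ck_on k (S \<union> - K) (\<lambda>z. if z \<in> S then h z else 0)"
    using Ck_on_Un assms(1) o by blast
  moreover have "S \<union> - K = UNIV" using assms(3) by auto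
  ultimately show ?thesis by simp
qed

lemma integrable_compact_support:
  fixes F :: "'v::euclidean_space \<Rightarrow> real"
  assumes "continuous_on UNIV F" "compact K" "\<And>z. z \<notin> K \<Longrightarrow> F z = 0"
  shows "integrable lborel F"
proof -
  have "integrable lborel (\<lambda>z. indicator K z *\<^sub>R F z)"
    using borel_integrable_compact[OF assms(2)] continuous_on_subset[OF assms(1)] by blast
  moreover have "(\<lambda>z. indicator K z *\<^sub>R F z) = F" using assms(3) by (auto simp: indicator_def fun_eq_iff)
  ultimately show ?thesis by simp
qed

text \<open>Translation invariance makes the integral of every difference quotient vanish.\<close>

lemma integral_directional_derivative_zero:
  fixes G :: "'v::euclidean_space \<Rightarrow> real"
  assumes G: "Ck_on 1 UNIV G" and K: "compact K" "\<And>z. z \<notin> K \<Longrightarrow> G z = 0"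
  shows "integrable lborel (\<lambda>z. frechet_derivative G (at z) v)"
    and "(\<integral>z. frechet_derivative G (at z) v \<partial>lborel) = 0"
proof -
  define D where "D = (\<lambda>z. frechet_derivative G (at z))"
  have der: "(G has_derivative D z) (at z)" for z
    using Ck_on_SucD[of 0 UNIV G z] G unfolding D_def One_nat_def by blast
  have cont: "continuous_on UNIV (\<lambda>z. D z v)" using G by (simp add: D_def)
  have contG: "continuous_on UNIV G" using G by (rule Ck_on_imp_continuous)
  have D0: "D z v = 0" if "z \<notin> K" for z
  proof -
    have "((\<lambda>_. 0) has_derivative (\<lambda>_. 0)) (at z)" by simp
    then have "(G has_derivative (\<lambda>_. 0)) (at z)"
      by (rule has_derivative_transform_within_open[where s="- K"])
         (use that K compact_imp_closed in auto)
    then show ?thesis using has_derivative_unique[OF der] by metis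
  qed
  show int: "integrable lborel (\<lambda>z. frechet_derivative G (at z) v)"
    using integrable_compact_support[OF cont K(1) D0] unfolding D_def by blast
  have intG: "integrable lborel G" using integrable_compact_support[OF contG K] by blast
  have "bounded ((\<lambda>z. D z v) ` K)"
    using compact_continuous_image[OF continuous_on_subset[OF cont] K(1)] compact_imp_bounded by blast
  then obtain B where B: "B > 0" "\<And>z. z \<in> K \<Longrightarrow> \<bar>D z v\<bar> \<le> B"
    by (auto simp: bounded_pos)
  have B': "\<bar>D z v\<bar> \<le> B" for z using B D0[of z] by (cases "z \<in> K") auto
  obtain R where R: "\<And>z. z \<in> K \<Longrightarrow> norm z \<le> R" using compact_imp_bounded[OF K(1)] by (auto simp: bounded_iff)
  \<comment> \<open>Steps of length at most 1 keep all translated supports in the ball of radius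
    \<open>R + norm v\<close>.\<close>
  define s where "s = (\<lambda>n::nat. 1 / real (Suc n))"
  have s: "0 < s n" "s n \<le> 1" for n by (auto simp: s_def)
  have s0: "s \<longlonglongrightarrow> 0" unfolding s_def by (rule LIMSEQ_Suc[OF lim_const_over_n])
  define F where "F = (\<lambda>n z. (G (z + s n *\<^sub>R v) - G z) / s n)"
  have line: "((\<lambda>t. G (z + t *\<^sub>R v)) has_real_derivative D (z + t *\<^sub>R v) v) (at t)" for z t
  proof -
    have a: "((\<lambda>t. z + t *\<^sub>R v) has_derivative (\<lambda>u. u *\<^sub>R v)) (at t)" by (auto intro!: derivative_eq_intros)
    interpret l: linear "D (z + t *\<^sub>R v)" using der has_derivative_linear by blast
    show ?thesis unfolding has_field_derivative_def
      using has_derivative_compose[OF a der] by (rule has_derivative_eq_rhs) (simp add: l.scaleR fun_eq_iff mult.commute)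
  qed
  \<comment> \<open>The dominating function: inside the ball the mean value theorem bounds the
    quotient by \<open>B\<close>; outside it, both points lie off \<open>K\<close> and the quotient
    is 0.\<close>
  have Fb: "\<bar>F n z\<bar> \<le> B * indicator (cball 0 (R + norm v)) z" for n z
  proof (cases "z \<in> cball 0 (R + norm v)")
    case True
    obtain t where "G (z + s n *\<^sub>R v) - G (z + 0 *\<^sub>R v) = (s n - 0) * D (z + t *\<^sub>R v) v"
      using MVT2[of 0 "s n" "\<lambda>t. G (z + t *\<^sub>R v)" "\<lambda>t. D (z + t *\<^sub>R v) v"] s line by blast
    then have "F n z = D (z + t *\<^sub>R v) v" using s(1)[of n] by (simp add: F_def)
    then show ?thesis using True B' by simp
  next
    case False
    then have "z \<notin> K" using R[of z] norm_ge_zero[of v] by auto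
    have "norm (s n *\<^sub>R v) \<le> norm v" using s[of n] mult_right_mono[of "s n" 1 "norm v"] by simp
    then have "norm (z + s n *\<^sub>R v) > R" using False norm_triangle_ineq2[of z "- s n *\<^sub>R v"] by auto
    then have "z + s n *\<^sub>R v \<notin> K" using R by force
    then show ?thesis using \<open>z \<notin> K\<close> K B(1) by (simp add: F_def)
  qed
  have Fint: "(\<integral>z. F n z \<partial>lborel) = 0" for n
  proof -
    have mG: "G \<in> borel_measurable borel" using contG by (rule borel_measurable_continuous_onI)
    have i: "integrable lborel (\<lambda>z. G (s n *\<^sub>R v + z))"
      using integrable_distr_eq[of "(+) (s n *\<^sub>R v)" lborel borel G] lborel_distr_plus[of "s n *\<^sub>R v"] intG mG by simp
    have "(\<integral>z. G z \<partial>lborel) = (\<integral>z. G (s n *\<^sub>R v + z) \<partial>lborel)"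
      using integral_distr[of "(+) (s n *\<^sub>R v)" lborel borel G] lborel_distr_plus[of "s n *\<^sub>R v"] mG by simp
    then show ?thesis unfolding F_def using i intG by (simp add: add.commute)
  qed
  have lim: "(\<lambda>n. F n z) \<longlonglongrightarrow> D z v" for z
  proof -
    have "((\<lambda>h. (G (z + h *\<^sub>R v) - G z) / h) \<longlongrightarrow> D z v) (at 0)"
      using line[of z 0] by (simp add: has_field_derivative_iff)
    then show ?thesis unfolding F_def
      by (rule filterlim_compose) (use s0 s(1) in \<open>auto simp: filterlim_at intro!: always_eventually less_imp_neq[symmetric]\<close>)
  qed
  have "(\<lambda>n. \<integral>z. F n z \<partial>lborel) \<longlonglongrightarrow> (\<integral>z. D z v \<partial>lborel)"
  proof (rule integral_dominated_convergence)
    show "(\<lambda>z. D z v) \<in> borel_measurable lborel" using cont borel_measurable_continuous_onI by auto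
    show "F n \<in> borel_measurable lborel" for n
      unfolding F_def using s(1)[of n]
      by (auto intro!: borel_measurable_continuous_onI continuous_intros continuous_on_compose2[OF contG])
    show "integrable lborel (\<lambda>z. B * indicator (cball 0 (R + norm v)) z)"
      by (intro integrable_mult_right integrable_real_indicator) (use emeasure_bounded_finite[OF bounded_cball] in auto)
  qed (use lim Fb in auto)
  then show "(\<integral>z. frechet_derivative G (at z) v \<partial>lborel) = 0"
    unfolding Fint using LIMSEQ_unique tendsto_const unfolding D_def by metis
qed

context riemannian_chart
begin

lemma integral_partial_zero:
  assumes h: "chart_Ck c 1 h" and K: "compact K" "K \<subseteq> U" "\<And>p. p \<in> dom c \<Longrightarrow> coord c p \<notin> K \<Longrightarrow> h p = 0"
  shows "integrable lborel (\<lambda>z. indicator U z * partial c i h (coord_inv c z))"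
    and "(\<integral>z. indicator U z * partial c i h (coord_inv c z) \<partial>lborel) = 0"
proof -
  define G where "G = (\<lambda>z. if z \<in> U then h (coord_inv c z) else 0)"
  have "Ck_on 1 U (\<lambda>z. h (coord_inv c z))" using h by (simp add: chart_Ck_def comp_def)
  then have G: "Ck_on 1 UNIV G" unfolding G_def
    by (rule Ck_on_extend_zero[OF open_range K(1,2)]) (use K(3) coord_inv_dom coord_coord_inv in fastforce)
  have GK: "G z = 0" if "z \<notin> K" for z
    using that K(3)[OF coord_inv_dom] coord_coord_inv[of z] by (cases "z \<in> U") (simp_all add: G_def)
  have "frechet_derivative G (at z) (axis i 1) = indicator U z * partial c i h (coord_inv c z)" for z
  proof (cases "z \<in> U")
    case True
    have "frechet_derivative G (at z) = frechet_derivative (h \<circ> coord_inv c) (at z)"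
      by (rule frechet_derivative_transform_within_open[OF _ open_range True]) (use G in \<open>auto simp: G_def\<close>)
    then show ?thesis using True by (simp add: partial_def)
  next
    case False
    \<comment> \<open>A point off \<open>U\<close> is also off the compact set \<open>K\<close>, so
      \<open>G\<close> vanishes near it and the boundary of \<open>U\<close> contributes
      nothing.\<close>
    have "((\<lambda>_. 0) has_derivative (\<lambda>_. 0)) (at z)" by simp
    then have "(G has_derivative (\<lambda>_. 0)) (at z)"
      by (rule has_derivative_transform_within_open[where s="- K"])
         (use False K(2) GK compact_imp_closed[OF K(1)] in auto)
    then show ?thesis using False frechet_derivative_at[of G "\<lambda>_. 0" z] by (simp add: fun_eq_iff)
  qed
  then show "integrable lborel (\<lambda>z. indicator U z * partial c i h (coord_inv c z))"
    "(\<integral>z. indicator U z * partial c i h (coord_inv c z) \<partial>lborel) = 0"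
    using integral_directional_derivative_zero[OF G K(1) GK, of "axis i 1"] by auto
qed

text \<open>The weight \<open>w\<close>, the product of \<open>exp (- f q)\<close> and the volume
  density, has logarithmic derivative equal to the trace of the Christoffel symbols minus the
  derivative of \<open>f\<close>. Hence the integrand is the coordinate divergence of
  \<open>\<psi>\<close> times \<open>w\<close> times the gradient of \<open>h\<close>, and each of
  its summands integrates to 0.\<close>

lemma green_chart:
  assumes \<psi>: "chart_Ck c 1 \<psi>" and f: "chart_Ck c 1 f" and h: "chart_Ck c 2 h"
    and K: "compact K" "K \<subseteq> U" "\<And>p. p \<in> dom c \<Longrightarrow> coord c p \<notin> K \<Longrightarrow> \<psi> p = 0"
  defines "F \<equiv> \<lambda>p. (grad_inner g c \<psi> h p + \<psi> p * (lap g c h p - grad_inner g c f h p)) * (exp (- f p) * sqrt (det (g c p)))"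
  shows "integrable lborel (\<lambda>z. indicator U z * F (coord_inv c z))"
    and "(\<integral>z. indicator U z * F (coord_inv c z) \<partial>lborel) = 0"
proof -
  have cX: "chart_Ck c 1 (\<lambda>q. grad g h c q $ i)" for i
    using chart_Ck_grad[of 1 h i] h by (simp add: numeral_2_eq_2)
  have ce: "chart_Ck c 1 (\<lambda>q. exp (- f q))" by (intro chart_Ck_exp chart_Ck_minus f)
  define w where "w = (\<lambda>q. exp (- f q) * sqrt (det (g c q)))"
  have cw: "chart_Ck c 1 w" unfolding w_def by (intro chart_Ck_mult ce chart_Ck_sqrt_det)
  have dw: "partial c i w p = w p * ((\<Sum>k\<in>UNIV. christoffel g c k k i p) - partial c i f p)" if p: "p \<in> dom c" for i p
  proof -
    have "partial c i (\<lambda>q. - f q) p = - partial c i f p"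
      using partial_cmult[OF f p, of i "-1"] by simp
    then have "partial c i (\<lambda>q. exp (- f q)) p = - (exp (- f p) * partial c i f p)"
      using partial_exp[OF chart_Ck_minus[OF f] p, of i] by simp
    then show ?thesis unfolding w_def partial_mult[OF ce chart_Ck_sqrt_det p] partial_sqrt_det[OF p]
      by (simp add: algebra_simps)
  qed
  define H where "H = (\<lambda>i q. \<psi> q * (grad g h c q $ i * w q))"
  have cH: "chart_Ck c 1 (H i)" for i unfolding H_def by (intro chart_Ck_mult \<psi> cX cw)
  have HK: "H i p = 0" if "p \<in> dom c" "coord c p \<notin> K" for i p using K(3)[OF that] by (simp add: H_def)
  have FH: "F p = (\<Sum>i\<in>UNIV. partial c i (H i) p)" if p: "p \<in> dom c" for p
  proof -
    have "partial c i (H i) p = (partial c i \<psi> p * grad g h c p $ i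
        + \<psi> p * (partial c i (\<lambda>q. grad g h c q $ i) p + (\<Sum>k\<in>UNIV. christoffel g c k k i p * grad g h c p $ i)
           - partial c i f p * grad g h c p $ i)) * w p" for i
      unfolding H_def partial_mult[OF \<psi> chart_Ck_mult[OF cX cw] p] partial_mult[OF cX cw p] dw[OF p] sum_distrib_right[symmetric]
      by (simp add: algebra_simps)
    then have "(\<Sum>i\<in>UNIV. partial c i (H i) p) = (grad_inner g c \<psi> h p + \<psi> p * ((\<Sum>i\<in>UNIV. partial c i (\<lambda>q. grad g h c q $ i) p)
         + (\<Sum>i\<in>UNIV. \<Sum>k\<in>UNIV. christoffel g c k k i p * grad g h c p $ i) - grad_inner g c f h p)) * w p"
      unfolding grad_inner_def
      by (simp only: sum_distrib_right[symmetric] sum.distrib sum_distrib_left[symmetric] sum_subtractf)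
    also have "(\<Sum>i\<in>UNIV. \<Sum>k\<in>UNIV. christoffel g c k k i p * grad g h c p $ i) = (\<Sum>i\<in>UNIV. \<Sum>j\<in>UNIV. christoffel g c i i j p * grad g h c p $ j)"
      by (rule sum.swap)
    finally show ?thesis by (simp add: F_def w_def lap_def sum.distrib)
  qed
  have eq: "indicator U z * F (coord_inv c z) = (\<Sum>i\<in>UNIV. indicator U z * partial c i (H i) (coord_inv c z))" for z
    by (cases "z \<in> U") (auto simp: FH)
  show "integrable lborel (\<lambda>z. indicator U z * F (coord_inv c z))"
    unfolding eq by (intro Bochner_Integration.integrable_sum integral_partial_zero(1)[OF cH K(1,2) HK])
  show "(\<integral>z. indicator U z * F (coord_inv c z) \<partial>lborel) = 0"
    unfolding eq
    by (subst Bochner_Integration.integral_sum)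
       (auto intro!: sum.neutral integral_partial_zero[OF cH K(1,2) HK])
qed

end

section \<open>The weighted measure of a compact manifold\<close>

definition manifold_bump :: "('a, 'n::finite) chart \<Rightarrow> real^'n \<Rightarrow> real \<Rightarrow> 'a \<Rightarrow> real" where
  "manifold_bump c a r p = (if p \<in> dom c then bump a r (coord c p) else 0)"

lemma manifold_bump_nonneg: "manifold_bump c a r p \<ge> 0"
  by (simp add: manifold_bump_def bump_nonneg)

locale weighted_manifold =
  fixes M :: "'a::t2_space set" and A :: "('a, 'n::finite) chart set" and g :: "('a, 'n) tensor2"
    and \<nu> :: "'a measure" and f :: "'a \<Rightarrow> real"
  assumes manifold: "compact_riemannian_manifold M A g"
    and volume: "riemannian_volume M A g \<nu>"
    and f_C2: "Ck_function A 2 f"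
begin

section \<open>Topology of the atlas\<close>

lemma compact_M: "compact M" using manifold by (simp add: compact_riemannian_manifold_def)

lemma chart: "c \<in> A \<Longrightarrow> riemannian_chart c g"
  using manifold unfolding compact_riemannian_manifold_def riemannian_chart_def smooth_atlas_def riemannian_metric_def by blast

lemma M_eq: "M = (\<Union>c\<in>A. dom c)"
  using manifold unfolding compact_riemannian_manifold_def smooth_atlas_def by blast

lemma dom_subset: "c \<in> A \<Longrightarrow> dom c \<subseteq> M" using M_eq by auto

lemma dom_openin: "c \<in> A \<Longrightarrow> openin (top_of_set M) (dom c)"
  using manifold unfolding compact_riemannian_manifold_def smooth_atlas_def by blast

lemma chart_homeo: "c \<in> A \<Longrightarrow> homeomorphism (dom c) (coord c ` dom c) (coord c) (coord_inv c)"
  using riemannian_chart.homeo chart by blast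

lemma open_coord_image:
  assumes "c \<in> A" "openin (top_of_set M) W" "W \<subseteq> dom c"
  shows "open (coord c ` W)"
proof -
  have "openin (top_of_set (dom c)) W"
    using assms openin_subset_trans dom_subset by blast
  then have "openin (top_of_set (coord c ` dom c)) (coord c ` W)"
    by (rule homeomorphism_imp_open_map[OF chart_homeo[OF assms(1)]])
  then show ?thesis using riemannian_chart.open_range[OF chart[OF assms(1)]] openin_open_eq by blast
qed

lemma transition_smooth:
  assumes "c \<in> A" "d \<in> A"
  shows "Ck_on k (coord c ` (dom c \<inter> dom d)) (coord d \<circ> coord_inv c)"
  using manifold assms unfolding compact_riemannian_manifold_def smooth_atlas_def smooth_on_def by blast

text \<open>Continuity is local, and the chart domains are relatively open in \<open>M\<close>. The
  factor \<open>I\<close> is carried along for functions on space-time; a function on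
  \<open>M\<close> alone is treated with a dummy parameter.\<close>

lemma continuous_on_from_charts:
  fixes F :: "'a \<times> 'b::t2_space \<Rightarrow> 'c::topological_space"
  assumes "\<And>c. c \<in> A \<Longrightarrow> continuous_on (coord c ` dom c \<times> I) (\<lambda>x. F (coord_inv c (fst x), snd x))"
  shows "continuous_on (M \<times> I) F"
  unfolding continuous_on_eq_continuous_within
proof
  fix x assume x: "x \<in> M \<times> I"
  then obtain c where c: "c \<in> A" "fst x \<in> dom c" using M_eq by auto
  interpret C: riemannian_chart c g using chart c by blast
  obtain T where T: "open T" "dom c = M \<inter> T" using dom_openin[OF c(1)] by (auto simp: openin_open)
  have "continuous_on (dom c) (coord c)" using C.homeo by (simp add: homeomorphism_def)
  then have "continuous_on (dom c \<times> I) (\<lambda>y. coord c (fst y))"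
    by (rule continuous_on_compose2[OF _ continuous_on_fst[OF continuous_on_id]]) auto
  then have "continuous_on (dom c \<times> I) (\<lambda>y. (coord c (fst y), snd y))"
    by (rule continuous_on_Pair[OF _ continuous_on_snd[OF continuous_on_id]])
  then have "continuous_on (dom c \<times> I) (\<lambda>y. F (coord_inv c (fst (coord c (fst y), snd y)), snd (coord c (fst y), snd y)))"
    by (rule continuous_on_compose2[OF assms[OF c(1)]]) auto
  then have "continuous_on (dom c \<times> I) F"
    by (rule continuous_on_eq) auto
  then have "continuous (at x within dom c \<times> I) F"
    using x c(2) bspec[of "dom c \<times> I" _ x] unfolding continuous_on_eq_continuous_within by (auto simp del: ball_simps simp: mem_Times_iff)
  moreover have "at x within M \<times> I = at x within dom c \<times> I"
  proof (rule at_within_nhd[of _ "T \<times> UNIV"])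
    show "x \<in> T \<times> UNIV" using c(2) T(2) by (auto simp: mem_Times_iff)
    show "open (T \<times> (UNIV::'b set))" using T(1) by (simp add: open_Times)
    have "(M \<times> I) \<inter> (T \<times> UNIV) = (dom c \<times> I) \<inter> (T \<times> UNIV)" unfolding T(2) by blast
    then show "(M \<times> I) \<inter> (T \<times> UNIV) - {x} = (dom c \<times> I) \<inter> (T \<times> UNIV) - {x}" by simp
  qed
  ultimately show "continuous (at x within M \<times> I) F" by simp
qed

lemma continuous_on_Ck: 
  assumes "Ck_function A k h" shows "continuous_on M h"
proof -
  have "continuous_on (M \<times> (UNIV::real set)) (\<lambda>x. h (fst x))"
  proof (rule continuous_on_from_charts)
    fix c assume "c \<in> A"
    then have "continuous_on (coord c ` dom c) (h \<circ> coord_inv c)"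
      using assms Ck_on_imp_continuous unfolding Ck_function_def by blast
    then have "continuous_on (coord c ` dom c \<times> UNIV) (\<lambda>x. (h \<circ> coord_inv c) (fst x))"
      by (rule continuous_on_compose2) (auto intro!: continuous_intros)
    then show "continuous_on (coord c ` dom c \<times> UNIV) (\<lambda>x. h (fst (coord_inv c (fst x), snd x)))" by simp
  qed
  then have "continuous_on M (\<lambda>p. (\<lambda>x. h (fst x)) (p, 0::real))"
    by (rule continuous_on_compose2) (auto intro!: continuous_intros)
  then show ?thesis by simp
qed

lemma Ck_function_iff: "Ck_function A k h \<longleftrightarrow> (\<forall>c\<in>A. chart_Ck c k h)"
  by (simp add: Ck_function_def chart_Ck_def)

lemma f_C1: "Ck_function A 1 f"
  using f_C2 unfolding Ck_function_def by (meson Ck_on_le one_le_numeral)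

section \<open>Measurability and the volume in a chart\<close>

lemma sets_nu: "sets \<nu> = sets (restrict_space borel M)"
  using volume by (simp add: riemannian_volume_def)

lemma space_nu: "space \<nu> = M"
  using sets_eq_imp_space_eq[OF sets_nu] by (simp add: space_restrict_space)

lemma measurable_nu: "continuous_on M h \<Longrightarrow> h \<in> borel_measurable \<nu>"
  for h :: "'a \<Rightarrow> real"
  using borel_measurable_continuous_on_restrict[of M h] measurable_cong_sets[OF sets_nu refl, of borel] by auto

lemma openin_sets_nu: "openin (top_of_set M) W \<Longrightarrow> W \<in> sets \<nu>"
  unfolding sets_nu sets_restrict_space openin_open by auto

lemma openin_coord_preimage:
  assumes "c \<in> A" "open V"
  shows "openin (top_of_set M) {p \<in> dom c. coord c p \<in> V}"
proof -
  have "openin (top_of_set (dom c)) (dom c \<inter> coord c -` V)"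
    using continuous_openin_preimage_gen[of "dom c" "coord c" V] chart_homeo[OF assms(1)] assms(2)
    by (simp add: homeomorphism_def)
  moreover have "dom c \<inter> coord c -` V = {p \<in> dom c. coord c p \<in> V}" by auto
  ultimately show ?thesis using openin_trans dom_openin[OF assms(1)] by metis
qed

definition vol_density :: "('a, 'n) chart \<Rightarrow> real^'n \<Rightarrow> real" where
  "vol_density c z = sqrt (det (g c (coord_inv c z)))"

lemma continuous_vol_density: "c \<in> A \<Longrightarrow> continuous_on (coord c ` dom c) (vol_density c)"
  using riemannian_chart.chart_Ck_sqrt_det[OF chart, of c 0]
  by (simp add: chart_Ck_def comp_def vol_density_def[abs_def])

lemma vol_density_pos: "c \<in> A \<Longrightarrow> z \<in> coord c ` dom c \<Longrightarrow> vol_density c z > 0"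
  using riemannian_chart.det_metric_pos[OF chart] riemannian_chart.coord_inv_dom[OF chart]
  by (simp add: vol_density_def)

lemma emeasure_chart:
  assumes "c \<in> A" "V \<in> sets borel"
  shows "emeasure \<nu> {p \<in> dom c. coord c p \<in> V} = (\<integral>\<^sup>+z\<in>coord c ` dom c \<inter> V. ennreal (vol_density c z) \<partial>lborel)"
  using volume assms by (simp add: riemannian_volume_def vol_density_def)

lemma vol_density_measurable:
  assumes "c \<in> A"
  shows "(\<lambda>z. indicator (coord c ` dom c) z * vol_density c z) \<in> borel_measurable borel"
  using borel_measurable_continuous_on_indicator[OF _ continuous_vol_density[OF assms]]
     riemannian_chart.open_range[OF chart[OF assms]] by simp

lemma coord_measurable:
  assumes "c \<in> A"
  shows "coord c \<in> restrict_space \<nu> (dom c) \<rightarrow>\<^sub>M borel"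
proof -
  have "coord c \<in> restrict_space borel (dom c) \<rightarrow>\<^sub>M borel"
    using chart_homeo[OF assms] borel_measurable_continuous_on_restrict by (auto simp: homeomorphism_def)
  moreover have "sets (restrict_space \<nu> (dom c)) = sets (restrict_space borel (dom c))"
  proof -
    have "sets (restrict_space \<nu> (dom c)) = sets (restrict_space (restrict_space borel M) (dom c))"
      by (rule restrict_space_sets_cong) (use sets_nu in auto)
    also have "\<dots> = sets (restrict_space borel (M \<inter> dom c))"
      by (rule sets_restrict_restrict_space)
    also have "M \<inter> dom c = dom c" using dom_subset[OF assms] by auto
    finally show ?thesis .
  qed
  ultimately show ?thesis using measurable_cong_sets by blast
qed

text \<open>The defining property of the volume gives the values on Borel sets; read as an equality
  of measures, it extends to integrals through \<open>integral_distr\<close> and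
  \<open>integral_density\<close>.\<close>

lemma distr_coord:
  assumes "c \<in> A"
  shows "distr (restrict_space \<nu> (dom c)) borel (coord c)
       = density lborel (\<lambda>z. ennreal (indicator (coord c ` dom c) z * vol_density c z))"
proof (rule measure_eqI)
  fix V assume "V \<in> sets (distr (restrict_space \<nu> (dom c)) borel (coord c))"
  then have V: "V \<in> sets borel" by simp
  have d: "dom c \<in> sets \<nu>" using openin_sets_nu dom_openin assms by blast
  have "space (restrict_space \<nu> (dom c)) = dom c"
    using dom_subset[OF assms] space_nu by (auto simp: space_restrict_space)
  then have "emeasure (distr (restrict_space \<nu> (dom c)) borel (coord c)) V = emeasure (restrict_space \<nu> (dom c)) (coord c -` V \<inter> dom c)"
    using emeasure_distr[OF coord_measurable[OF assms] V] by simp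
  also have "\<dots> = emeasure \<nu> (coord c -` V \<inter> dom c)"
    by (rule emeasure_restrict_space) (use d dom_subset[OF assms] space_nu in \<open>auto simp: Int_absorb2\<close>)
  also have "coord c -` V \<inter> dom c = {p \<in> dom c. coord c p \<in> V}" by auto
  also have "emeasure \<nu> \<dots> = (\<integral>\<^sup>+z\<in>coord c ` dom c \<inter> V. ennreal (vol_density c z) \<partial>lborel)"
    by (rule emeasure_chart[OF assms V])
  also have "\<dots> = (\<integral>\<^sup>+z. ennreal (indicator (coord c ` dom c) z * vol_density c z) * indicator V z \<partial>lborel)"
    by (rule nn_integral_cong) (auto simp: indicator_def)
  also have "\<dots> = emeasure (density lborel (\<lambda>z. ennreal (indicator (coord c ` dom c) z * vol_density c z))) V"
    using V vol_density_measurable[OF assms] by (simp add: emeasure_density)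
  finally show "emeasure (distr (restrict_space \<nu> (dom c)) borel (coord c)) V
     = emeasure (density lborel (\<lambda>z. ennreal (indicator (coord c ` dom c) z * vol_density c z))) V" .
qed simp

lemma integral_chart:
  fixes h :: "'a \<Rightarrow> real"
  assumes c: "c \<in> A" and h: "continuous_on (coord c ` dom c) (h \<circ> coord_inv c)"
  shows "integrable \<nu> (\<lambda>p. indicator (dom c) p * h p) \<longleftrightarrow>
           integrable lborel (\<lambda>z. indicator (coord c ` dom c) z * (h (coord_inv c z) * vol_density c z))"
    and "(\<integral>p. indicator (dom c) p * h p \<partial>\<nu>)
          = (\<integral>z. indicator (coord c ` dom c) z * (h (coord_inv c z) * vol_density c z) \<partial>lborel)"
proof -
  interpret C: riemannian_chart c g using chart c by blast
  let ?U = "coord c ` dom c"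
  define H where "H = (\<lambda>z. indicator ?U z * h (coord_inv c z))"
  have mH: "H \<in> borel_measurable borel"
    unfolding H_def using borel_measurable_continuous_on_indicator[OF _ h] C.open_range by (simp add: comp_def)
  have d: "dom c \<in> sets \<nu>" using openin_sets_nu dom_openin c by blast
  have dM: "dom c \<inter> space \<nu> \<in> sets \<nu>" using d dom_subset[OF c] space_nu by (simp add: Int_absorb2)
  have sp: "space (restrict_space \<nu> (dom c)) = dom c"
    using dom_subset[OF c] space_nu by (auto simp: space_restrict_space)
  have Hh: "H (coord c p) = h p" if "p \<in> space (restrict_space \<nu> (dom c))" for p
    using that by (simp add: sp H_def)
  have nn: "AE z in lborel. 0 \<le> indicator ?U z * vol_density c z"
    using vol_density_pos[OF c] by (auto simp: indicator_def intro!: AE_I2 less_imp_le)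
  have mult: "indicator ?U z * vol_density c z * H z = indicator ?U z * (h (coord_inv c z) * vol_density c z)" for z
    by (simp add: H_def indicator_def)
  have "integrable \<nu> (\<lambda>p. indicator (dom c) p * h p) \<longleftrightarrow> integrable (restrict_space \<nu> (dom c)) h"
    using integrable_restrict_space[OF dM, of h] by simp
  also have "\<dots> \<longleftrightarrow> integrable (restrict_space \<nu> (dom c)) (\<lambda>p. H (coord c p))"
    by (rule Bochner_Integration.integrable_cong) (auto simp: Hh)
  also have "\<dots> \<longleftrightarrow> integrable (density lborel (\<lambda>z. ennreal (indicator ?U z * vol_density c z))) H"
    using integrable_distr_eq[OF coord_measurable[OF c] mH] distr_coord[OF c] by simp
  also have "\<dots> \<longleftrightarrow> integrable lborel (\<lambda>z. indicator ?U z * (h (coord_inv c z) * vol_density c z))"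
    using integrable_density[of H lborel "\<lambda>z. indicator ?U z * vol_density c z"] mH vol_density_measurable[OF c] nn
    by (simp add: mult)
  finally show "integrable \<nu> (\<lambda>p. indicator (dom c) p * h p) \<longleftrightarrow>
           integrable lborel (\<lambda>z. indicator (coord c ` dom c) z * (h (coord_inv c z) * vol_density c z))" .
  have "(\<integral>p. indicator (dom c) p * h p \<partial>\<nu>) = (\<integral>p. h p \<partial>restrict_space \<nu> (dom c))"
    using integral_restrict_space[OF dM, of h] by simp
  also have "\<dots> = (\<integral>p. H (coord c p) \<partial>restrict_space \<nu> (dom c))"
    by (rule Bochner_Integration.integral_cong) (auto simp: Hh)
  also have "\<dots> = (\<integral>z. H z \<partial>density lborel (\<lambda>z. ennreal (indicator ?U z * vol_density c z)))"
    using integral_distr[OF coord_measurable[OF c] mH] distr_coord[OF c] by simp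
  also have "\<dots> = (\<integral>z. indicator ?U z * (h (coord_inv c z) * vol_density c z) \<partial>lborel)"
    using integral_density[of H lborel "\<lambda>z. indicator ?U z * vol_density c z"] mH vol_density_measurable[OF c] nn
    by (simp add: mult)
  finally show "(\<integral>p. indicator (dom c) p * h p \<partial>\<nu>)
          = (\<integral>z. indicator (coord c ` dom c) z * (h (coord_inv c z) * vol_density c z) \<partial>lborel)" .
qed

text \<open>The open balls cover \<open>M\<close>, while the closed balls still lie in the
  coordinate ranges. This leaves room for bumps with compact support and for a bound of the volume
  density on each ball.\<close>

lemma finite_ball_cover:
  obtains D where "finite D"
    "\<And>c a r. (c, a, r) \<in> D \<Longrightarrow> c \<in> A \<and> r > 0 \<and> cball a r \<subseteq> coord c ` dom c"
    "M \<subseteq> (\<Union>(c, a, r)\<in>D. {p \<in> dom c. coord c p \<in> ball a r})"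
proof -
  define S where "S = {(c, a, r). c \<in> A \<and> r > 0 \<and> cball a r \<subseteq> coord c ` dom c}"
  define B where "B = (\<lambda>(c :: ('a, 'n) chart, a, r). {p \<in> dom c. coord c p \<in> ball a r})"
  have o: "\<forall>W\<in>B ` S. openin (top_of_set M) W"
    using openin_coord_preimage[OF _ open_ball] by (auto simp: B_def S_def simp del: mem_ball)
  have "M \<subseteq> \<Union> (B ` S)"
  proof
    fix p assume "p \<in> M"
    then obtain c where c: "c \<in> A" "p \<in> dom c" using M_eq by auto
    then obtain r where "r > 0" "cball (coord c p) r \<subseteq> coord c ` dom c"
      using riemannian_chart.open_range[OF chart] open_contains_cball by blast
    then have "(c, coord c p, r) \<in> S" "p \<in> B (c, coord c p, r)" using c by (auto simp: S_def B_def)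
    then show "p \<in> \<Union> (B ` S)" by blast
  qed
  then obtain W where W: "W \<subseteq> B ` S" "finite W" "M \<subseteq> \<Union> W"
    using compact_M[unfolded compact_eq_openin_cover] o by meson
  then obtain D where D: "D \<subseteq> S" "finite D" "W = B ` D" by (meson finite_subset_image)
  show thesis
  proof (rule that[of D])
    show "M \<subseteq> (\<Union>(c, a, r)\<in>D. {p \<in> dom c. coord c p \<in> ball a r})"
      using W(3) unfolding D(3) B_def by (simp add: case_prod_beta)
  qed (use D in \<open>auto simp: S_def\<close>)
qed

text \<open>On each closed ball of a finite cover the continuous density is bounded, so compactness
  of \<open>M\<close> supplies finiteness; every continuous function thereby becomes
  integrable.\<close>

lemma finite_measure_nu: "finite_measure \<nu>"
proof (rule finite_measureI)
  obtain D where D: "finite D"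
    "\<And>c a r. (c, a, r) \<in> D \<Longrightarrow> c \<in> A \<and> r > 0 \<and> cball a r \<subseteq> coord c ` dom c"
    "M \<subseteq> (\<Union>(c, a, r)\<in>D. {p \<in> dom c. coord c p \<in> ball a r})" using finite_ball_cover by blast
  define B where "B = (\<lambda>(c :: ('a, 'n) chart, a, r). {p \<in> dom c. coord c p \<in> ball a r})"
  have fin: "emeasure \<nu> (B x) < \<infinity>" if x: "x \<in> D" for x
  proof -
    obtain c a r where car: "x = (c, a, r)" by (cases x)
    then have c: "c \<in> A" "r > 0" "cball a r \<subseteq> coord c ` dom c" using D(2) x by auto
    have "compact (vol_density c ` cball a r)"
      by (intro compact_continuous_image continuous_on_subset[OF continuous_vol_density[OF c(1)] c(3)] compact_cball)
    then obtain b where b: "\<And>z. z \<in> cball a r \<Longrightarrow> \<bar>vol_density c z\<bar> \<le> b"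
      using compact_imp_bounded by (force simp: bounded_iff)
    have "emeasure \<nu> (B x) = (\<integral>\<^sup>+z\<in>coord c ` dom c \<inter> ball a r. ennreal (vol_density c z) \<partial>lborel)"
      unfolding car B_def using emeasure_chart[OF c(1), of "ball a r"] by simp
    also have "\<dots> \<le> (\<integral>\<^sup>+z. ennreal b * indicator (cball a r) z \<partial>lborel)"
    proof (rule nn_integral_mono)
      fix z
      show "ennreal (vol_density c z) * indicator (coord c ` dom c \<inter> ball a r) z \<le> ennreal b * indicator (cball a r) z"
        using b[of z] by (auto simp: indicator_def intro!: ennreal_leI)
    qed
    also have "\<dots> = ennreal b * emeasure lborel (cball a r)" by (simp add: nn_integral_cmult_indicator)
    also have "\<dots> < \<infinity>" using emeasure_lborel_cball_finite[of a r] by (simp add: ennreal_mult_less_top)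
    finally show ?thesis .
  qed
  have m: "B x \<in> sets \<nu>" if "x \<in> D" for x
  proof -
    obtain c a r where car: "x = (c, a, r)" by (cases x)
    then have "c \<in> A" using D(2) that by auto
    then show ?thesis unfolding car B_def using openin_sets_nu openin_coord_preimage[of c "ball a r"] by simp
  qed
  have "emeasure \<nu> (space \<nu>) \<le> emeasure \<nu> (\<Union>x\<in>D. B x)"
    unfolding space_nu by (rule emeasure_mono) (use D(1,3) m in \<open>auto simp: B_def case_prod_beta\<close>)
  also have "\<dots> \<le> (\<Sum>x\<in>D. emeasure \<nu> (B x))"
    by (rule emeasure_subadditive_finite) (use D(1) m in auto)
  also have "\<dots> < \<infinity>" using fin D(1) by (simp add: ennreal_sum_less_top)
  finally show "emeasure \<nu> (space \<nu>) \<noteq> \<infinity>" by simp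
qed

section \<open>Integrals against the weighted measure\<close>

abbreviation "\<mu> \<equiv> weighted_measure \<nu> f"

lemma f_cont: "continuous_on M f" using continuous_on_Ck f_C2 by blast

lemma exp_f_cont: "continuous_on M (\<lambda>p. exp (- f p))"
  by (intro continuous_intros f_cont)

lemma integral_mu:
  fixes h :: "'a \<Rightarrow> real"
  assumes "h \<in> borel_measurable \<nu>"
  shows "integrable \<mu> h \<longleftrightarrow> integrable \<nu> (\<lambda>p. exp (- f p) * h p)"
    and "(\<integral>p. h p \<partial>\<mu>) = (\<integral>p. exp (- f p) * h p \<partial>\<nu>)"
proof -
  have m: "(\<lambda>p. exp (- f p)) \<in> borel_measurable \<nu>" using measurable_nu exp_f_cont by blast
  show "integrable \<mu> h \<longleftrightarrow> integrable \<nu> (\<lambda>p. exp (- f p) * h p)"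
    unfolding weighted_measure_def using integrable_density[OF assms m] by simp
  show "(\<integral>p. h p \<partial>\<mu>) = (\<integral>p. exp (- f p) * h p \<partial>\<nu>)"
    unfolding weighted_measure_def using integral_density[OF assms m] by simp
qed

lemma integrable_nu_continuous:
  fixes h :: "'a \<Rightarrow> real"
  assumes "continuous_on M h"
  shows "integrable \<nu> h"
proof -
  interpret finite_measure \<nu> by (rule finite_measure_nu)
  obtain b where "\<And>p. p \<in> M \<Longrightarrow> \<bar>h p\<bar> \<le> b"
    using compact_imp_bounded[OF compact_continuous_image[OF assms compact_M]] by (force simp: bounded_iff)
  then show ?thesis
    using integrable_const_bound[of h b] measurable_nu[OF assms] space_nu by (auto intro!: AE_I2)
qed

lemma integrable_continuous:
  fixes h :: "'a \<Rightarrow> real"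
  assumes "continuous_on M h"
  shows "integrable \<mu> h"
  using integral_mu(1)[OF measurable_nu[OF assms]]
    integrable_nu_continuous[OF continuous_on_mult[OF exp_f_cont assms]] by simp

lemma measurable_mu: "continuous_on M h \<Longrightarrow> h \<in> borel_measurable \<mu>"
  for h :: "'a \<Rightarrow> real"
  using measurable_nu by (simp add: weighted_measure_def)

lemma space_mu: "space \<mu> = M" by (simp add: weighted_measure_def space_nu)

lemma integral_mu_cong: "(\<And>p. p \<in> M \<Longrightarrow> h p = h' p) \<Longrightarrow> (\<integral>p. h p \<partial>\<mu>) = (\<integral>p. h' p \<partial>\<mu>)"
  for h h' :: "'a \<Rightarrow> real"
  by (rule Bochner_Integration.integral_cong) (auto simp: space_mu)

end

section \<open>Change of charts\<close>

context weighted_manifold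
begin

lemma open_overlap:
  assumes "c \<in> A" "d \<in> A"
  shows "open (coord c ` (dom c \<inter> dom d))"
  by (rule open_coord_image[OF assms(1) openin_Int[OF dom_openin[OF assms(1)] dom_openin[OF assms(2)]]]) blast

lemma partial_chain:
  assumes c: "c \<in> A" and d: "d \<in> A" and p: "p \<in> dom c" "p \<in> dom d" and h: "Ck_function A 1 h"
  shows "partial c i h p = (\<Sum>k\<in>UNIV. jacobian_at c d p $ k $ i * partial d k h p)"
proof -
  interpret C: riemannian_chart c g using chart c by blast
  interpret D: riemannian_chart d g using chart d by blast
  define z where "z = coord c p"
  define \<tau> where "\<tau> = coord d \<circ> coord_inv c"
  define S where "S = coord c ` (dom c \<inter> dom d)"
  have S: "open S" "z \<in> S" using open_overlap[OF c d] p by (auto simp: S_def z_def)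
  have \<tau>: "(\<tau> has_derivative frechet_derivative \<tau> (at z)) (at z)"
    using Ck_on_SucD[OF transition_smooth[OF c d, of "Suc 0"] S(2)[unfolded S_def]] unfolding \<tau>_def .
  have \<tau>z: "\<tau> z = coord d p" using p by (simp add: \<tau>_def z_def)
  define Dh where "Dh = frechet_derivative (h \<circ> coord_inv d) (at (coord d p))"
  have Dh: "(h \<circ> coord_inv d has_derivative Dh) (at (\<tau> z))"
    unfolding Dh_def \<tau>z using D.chart_C1_has_derivative[of h "coord d p"] h d p by (auto simp: Ck_function_iff)
  have "((\<lambda>x. (h \<circ> coord_inv d) (\<tau> x)) has_derivative (\<lambda>v. Dh (frechet_derivative \<tau> (at z) v))) (at z)"
    by (rule has_derivative_compose[OF \<tau> Dh])
  then have "(h \<circ> coord_inv c has_derivative (\<lambda>v. Dh (frechet_derivative \<tau> (at z) v))) (at z)"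
    by (rule has_derivative_transform_within_open[OF _ S]) (auto simp: S_def \<tau>_def)
  then have e: "partial c i h p = Dh (frechet_derivative \<tau> (at z) (axis i 1))"
    using C.partial_eq unfolding z_def by blast
  interpret l: linear Dh using Dh has_derivative_linear by blast
  have J: "frechet_derivative \<tau> (at z) (axis i 1) $ k = jacobian_at c d p $ k $ i" for k
    by (simp add: jacobian_at_def matrix_def \<tau>_def z_def)
  have "frechet_derivative \<tau> (at z) (axis i 1) = (\<Sum>k\<in>UNIV. (jacobian_at c d p $ k $ i) *\<^sub>R axis k 1)"
    using basis_expansion[of "frechet_derivative \<tau> (at z) (axis i 1)"] by (simp add: J scalar_mult_eq_scaleR)
  then show ?thesis unfolding e by (simp only: l.sum l.scaleR) (simp add: partial_def Dh_def)
qed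

text \<open>Differentials transform by the transposed Jacobian and gradients by the Jacobian itself,
  so their pairing is invariant.\<close>

lemma grad_inner_independent:
  assumes c: "c \<in> A" and d: "d \<in> A" and p: "p \<in> dom c" "p \<in> dom d"
    and a: "Ck_function A 1 a" and b: "Ck_function A 1 b"
  shows "grad_inner g c a b p = grad_inner g d a b p"
proof -
  interpret C: riemannian_chart c g using chart c by blast
  interpret D: riemannian_chart d g using chart d by blast
  define J where "J = jacobian_at c d p"
  define dc where "dc = (\<lambda>h. \<chi> i. partial c i h p)"
  define dd where "dd = (\<lambda>h. \<chi> i. partial d i h p)"
  have ch: "dc h = transpose J *v dd h" if "Ck_function A 1 h" for h
    using partial_chain[OF c d p that] by (simp add: vec_eq_iff dc_def dd_def J_def matrix_vector_mult_def transpose_def)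
  have gJ: "g c p = transpose J ** g d p ** J"
    using manifold c d p unfolding compact_riemannian_manifold_def riemannian_metric_def J_def by blast
  \<comment> \<open>Nondegeneracy of the Jacobian is read off from the transformation law of the
    metric, whose determinant in chart \<open>c\<close> is positive.\<close>
  have "det J \<noteq> 0" using C.det_metric_pos[OF p(1)] unfolding gJ by (auto simp: det_mul)
  then have inv: "invertible (transpose J)" by (simp add: invertible_det_nz)
  have gc: "g c p *v grad g b c p = dc b"
    using posdef_matrix_inv(1)[OF C.metric_sym C.metric_pos] p(1) by (simp add: grad_def dc_def matrix_vector_mul_assoc)
  have gd: "matrix_inv (g d p) *v dd b = grad g b d p" by (simp add: grad_def dd_def)
  have gdi: "matrix_inv (g d p) ** g d p = mat 1"
    using posdef_matrix_inv(2)[OF D.metric_sym D.metric_pos] p(2) by simp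
  have "transpose J *v (g d p *v (J *v grad g b c p)) = transpose J *v dd b"
    using gc unfolding gJ ch[OF b] by (simp add: matrix_vector_mul_assoc matrix_mul_assoc)
  then have "g d p *v (J *v grad g b c p) = dd b"
    using invertible_matrix_inv(2)[OF inv] by (metis matrix_vector_mul_assoc matrix_vector_mul_lid)
  then have "matrix_inv (g d p) *v (g d p *v (J *v grad g b c p)) = grad g b d p" using gd by simp
  then have X: "J *v grad g b c p = grad g b d p"
    by (simp add: matrix_vector_mul_assoc matrix_mul_assoc gdi)
  have "grad_inner g c a b p = dc a \<bullet> grad g b c p" by (simp add: grad_inner_def dc_def inner_vec_def)
  also have "\<dots> = dd a \<bullet> (J *v grad g b c p)"
    unfolding ch[OF a] by (simp add: dot_lmul_matrix[symmetric] transpose_matrix_vector)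
  also have "\<dots> = grad_inner g d a b p" unfolding X by (simp add: grad_inner_def dd_def inner_vec_def)
  finally show ?thesis .
qed

lemma compact_chart_ball:
  assumes "c \<in> A" "K \<subseteq> coord c ` dom c" "compact K"
  shows "compact (coord_inv c ` K)" "coord_inv c ` K \<subseteq> dom c"
proof -
  interpret C: riemannian_chart c g using chart assms(1) by blast
  show "compact (coord_inv c ` K)"
    by (rule compact_continuous_image[OF continuous_on_subset[OF _ assms(2)] assms(3)])
       (use C.homeo in \<open>simp add: homeomorphism_def\<close>)
  show "coord_inv c ` K \<subseteq> dom c" using assms(2) C.coord_inv_dom by blast
qed

lemma openin_diff_compact:
  assumes "d \<in> A" "compact K" shows "openin (top_of_set M) (dom d - K)"
proof -
  have "dom d - K = dom d \<inter> (M \<inter> - K)" using dom_subset[OF assms(1)] by auto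
  moreover have "openin (top_of_set M) (M \<inter> - K)"
    using compact_imp_closed[OF assms(2)] by (simp add: openin_open_Int open_Compl)
  ultimately show ?thesis using dom_openin[OF assms(1)] by (metis openin_Int)
qed

text \<open>In another chart the bump is the coordinate bump composed with a transition map on the
  overlap, and 0 off the compact set \<open>K\<close>. In a Hausdorff space \<open>K\<close> is
  closed, so both regions are open, and together they fill the chart.\<close>

lemma Ck_function_manifold_bump:
  assumes c: "c \<in> A" and r: "r > 0" "cball a r \<subseteq> coord c ` dom c"
  shows "Ck_function A 1 (manifold_bump c a r)"
  unfolding Ck_function_def
proof
  fix d assume d: "d \<in> A"
  interpret C: riemannian_chart c g using chart c by blast
  interpret D: riemannian_chart d g using chart d by blast
  define K where "K = coord_inv c ` cball a r"
  have K: "compact K" "K \<subseteq> dom c" unfolding K_def using compact_chart_ball[OF c r(2)] by auto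
  define S where "S = coord d ` (dom d \<inter> dom c)"
  define W where "W = coord d ` (dom d - K)"
  have S: "open S" unfolding S_def by (rule open_overlap[OF d c])
  have W: "open W" unfolding W_def by (rule open_coord_image[OF d openin_diff_compact[OF d K(1)]]) auto
  have "Ck_on 1 S (\<lambda>z. bump a r ((coord c \<circ> coord_inv d) z))"
    by (rule Ck_on_compose[OF S subset_UNIV transition_smooth[OF d c, folded S_def] Ck_on_bump])
  then have 1: "Ck_on 1 S (manifold_bump c a r \<circ> coord_inv d)"
    by (subst Ck_on_cong[OF S]) (auto simp: S_def manifold_bump_def)
  have z: "manifold_bump c a r q = 0" if "q \<notin> K" for q
  proof (cases "q \<in> dom c")
    case True
    then have "coord c q \<notin> cball a r" using that C.coord_inv_coord[OF True] unfolding K_def by (metis image_eqI)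
    then show ?thesis using True bump_zero[OF r(1), of "coord c q" a] ball_subset_cball[of a r] by (auto simp: manifold_bump_def)
  qed (simp add: manifold_bump_def)
  have "Ck_on 1 W (\<lambda>z. 0::real)" by (rule Ck_on_const[OF W])
  then have 2: "Ck_on 1 W (manifold_bump c a r \<circ> coord_inv d)"
    by (subst Ck_on_cong[OF W, of _ "\<lambda>z. 0"]) (auto simp: W_def z)
  have "coord d ` dom d = S \<union> W" using K(2) unfolding S_def W_def by blast
  then show "Ck_on 1 (coord d ` dom d) (manifold_bump c a r \<circ> coord_inv d)"
    using Ck_on_Un[OF S W 1 2] by simp
qed

lemma manifold_bump_pos:
  "r > 0 \<Longrightarrow> p \<in> dom c \<Longrightarrow> coord c p \<in> ball a r \<Longrightarrow> manifold_bump c a r p > 0"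
  using bump_pos[of r "coord c p" a] by (simp add: manifold_bump_def)

lemma manifold_bump_zero:
  "r > 0 \<Longrightarrow> \<not> (p \<in> dom c \<and> coord c p \<in> ball a r) \<Longrightarrow> manifold_bump c a r p = 0"
  using bump_zero[of r "coord c p" a] by (auto simp: manifold_bump_def)

text \<open>The weighted divergence of \<open>\<psi>\<close> times the gradient of \<open>h\<close>,
  computed in the chart \<open>c\<close>.\<close>

definition green_term :: "('a, 'n) chart \<Rightarrow> ('a \<Rightarrow> real) \<Rightarrow> ('a \<Rightarrow> real) \<Rightarrow> 'a \<Rightarrow> real" where
  "green_term c \<psi> h p = grad_inner g c \<psi> h p + \<psi> p * (lap g c h p - grad_inner g c f h p)"

lemma green_local:
  assumes c: "c \<in> A" and \<psi>: "chart_Ck c 1 \<psi>" and h: "chart_Ck c 2 h"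
    and K: "compact K" "K \<subseteq> coord c ` dom c" "\<And>p. p \<in> dom c \<Longrightarrow> coord c p \<notin> K \<Longrightarrow> \<psi> p = 0"
  shows "integrable \<mu> (\<lambda>p. indicator (dom c) p * green_term c \<psi> h p)"
    and "(\<integral>p. indicator (dom c) p * green_term c \<psi> h p \<partial>\<mu>) = 0"
proof -
  interpret C: riemannian_chart c g using chart c by blast
  have fc: "chart_Ck c 1 f" using f_C1 c by (simp add: Ck_function_iff)
  define k where "k = (\<lambda>p. exp (- f p) * green_term c \<psi> h p)"
  have "chart_Ck c 0 k"
  proof -
    have "chart_Ck c 0 (grad_inner g c \<psi> h)" "chart_Ck c 0 (grad_inner g c f h)" "chart_Ck c 0 (lap g c h)"
      using C.chart_Ck_grad_inner[of 0 \<psi> h] C.chart_Ck_grad_inner[of 0 f h] C.chart_Ck_lap[of 0 h] \<psi> fc h C.chart_Ck_le[of 2 h 1]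
      by (simp_all add: numeral_2_eq_2)
    moreover have "chart_Ck c 0 \<psi>" "chart_Ck c 0 f" using \<psi> fc C.chart_Ck_le[of 1] by simp_all
    ultimately show ?thesis unfolding k_def green_term_def
      by (intro C.chart_Ck_mult C.chart_Ck_exp C.chart_Ck_minus C.chart_Ck_add C.chart_Ck_diff)
  qed
  then have kc: "continuous_on (coord c ` dom c) (k \<circ> coord_inv c)" by (simp add: chart_Ck_def)
  have e: "k (coord_inv c z) * vol_density c z = (grad_inner g c \<psi> h (coord_inv c z) + \<psi> (coord_inv c z) * (lap g c h (coord_inv c z) - grad_inner g c f h (coord_inv c z)))
       * (exp (- f (coord_inv c z)) * sqrt (det (g c (coord_inv c z))))" for z
    by (simp add: k_def green_term_def vol_density_def)
  have i: "integrable \<nu> (\<lambda>p. indicator (dom c) p * k p)" "(\<integral>p. indicator (dom c) p * k p \<partial>\<nu>) = 0"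
    using C.green_chart[OF \<psi> fc h K] unfolding integral_chart[OF c kc] e by auto
  \<comment> \<open>Measurability of the uncut integrand on \<open>M\<close> is unknown at this
    point; the function cut off to the chart inherits it from the integrable \<open>k\<close> by
    undoing the weight.\<close>
  have "(\<lambda>p. exp (f p) * (indicator (dom c) p * k p)) \<in> borel_measurable \<nu>"
    using borel_measurable_times[OF measurable_nu[of "\<lambda>p. exp (f p)"] borel_measurable_integrable[OF i(1)]] f_cont
    by (auto intro!: continuous_intros)
  moreover have ee: "exp (f p) * (indicator (dom c) p * k p) = indicator (dom c) p * green_term c \<psi> h p" for p
    by (simp add: k_def exp_minus)
  ultimately have m: "(\<lambda>p. indicator (dom c) p * green_term c \<psi> h p) \<in> borel_measurable \<nu>" by simp
  have e2: "exp (- f p) * (indicator (dom c) p * green_term c \<psi> h p) = indicator (dom c) p * k p" for p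
    by (simp add: k_def)
  show "integrable \<mu> (\<lambda>p. indicator (dom c) p * green_term c \<psi> h p)"
    "(\<integral>p. indicator (dom c) p * green_term c \<psi> h p \<partial>\<mu>) = 0"
    using i unfolding integral_mu[OF m] e2 by auto
qed

text \<open>The measure has full support: the density is positive and a ball has positive Lebesgue
  measure. So a property that holds almost everywhere holds at some point of each coordinate
  ball.\<close>

lemma AE_mu_open_chart:
  assumes c: "c \<in> A" and r: "r > 0" "ball a r \<subseteq> coord c ` dom c" and ae: "AE p in \<mu>. P p"
  shows "\<exists>p\<in>dom c. coord c p \<in> ball a r \<and> P p"
proof (rule ccontr)
  assume n: "\<not> ?thesis"
  define B where "B = {p \<in> dom c. coord c p \<in> ball a r}"
  have m: "(\<lambda>p. ennreal (exp (- f p))) \<in> borel_measurable \<nu>"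
    using measurable_nu[OF exp_f_cont] by simp
  have "AE p in \<nu>. P p" using ae m unfolding weighted_measure_def by (simp add: AE_density)
  then have ae: "AE p in \<nu>. p \<notin> B" by (rule AE_mp) (use n in \<open>auto simp: B_def\<close>)
  have B: "B \<in> sets \<nu>" unfolding B_def using openin_sets_nu openin_coord_preimage[OF c open_ball] by blast
  have "emeasure \<nu> B = 0"
    using AE_iff_measurable[of B \<nu> "\<lambda>p. p \<notin> B"] B ae sets.sets_into_space[OF B] by blast
  then have "(\<integral>\<^sup>+z\<in>coord c ` dom c \<inter> ball a r. ennreal (vol_density c z) \<partial>lborel) = 0"
    unfolding B_def using emeasure_chart[OF c, of "ball a r"] by simp
  moreover have "(\<lambda>z. ennreal (vol_density c z) * indicator (coord c ` dom c \<inter> ball a r) z) \<in> borel_measurable lborel"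
  proof -
    have e: "ennreal (vol_density c z) * indicator (coord c ` dom c \<inter> ball a r) z
       = ennreal (indicator (coord c ` dom c) z * vol_density c z) * indicator (ball a r) z" for z
      by (auto simp: indicator_def)
    show ?thesis unfolding e using vol_density_measurable[OF c]
      by (intro borel_measurable_times_ennreal borel_measurable_indicator measurable_compose[OF _ measurable_ennreal]) simp_all
  qed
  ultimately have "AE z in lborel. ennreal (vol_density c z) * indicator (coord c ` dom c \<inter> ball a r) z = 0"
    using nn_integral_0_iff_AE by blast
  then have "AE z in lborel. z \<notin> ball a r"
  proof (rule AE_mp, intro AE_I2 impI notI)
    fix z assume "ennreal (vol_density c z) * indicator (coord c ` dom c \<inter> ball a r) z = 0" "z \<in> ball a r"
    then show False using r(2) vol_density_pos[OF c, of z] by (auto simp: indicator_def)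
  qed
  then have "emeasure lborel (ball a r) = 0"
    using AE_iff_measurable[of "ball a r" lborel "\<lambda>z. z \<notin> ball a r"] by (simp del: mem_ball)
  then show False using content_ball_pos[OF r(1), of a] by (simp add: measure_def)
qed

end

section \<open>Green's formula on the manifold\<close>

context weighted_manifold
begin

lemma partial_zero_outside:
  assumes d: "d \<in> A" and K: "compact K" and z: "\<And>q. q \<in> dom d - K \<Longrightarrow> h q = 0" and p: "p \<in> dom d - K"
  shows "partial d i h p = 0"
proof -
  interpret D: riemannian_chart d g using chart d by blast
  have W: "open (coord d ` (dom d - K))"
    by (rule open_coord_image[OF d openin_diff_compact[OF d K]]) auto
  have "((\<lambda>_. 0) has_derivative (\<lambda>_. 0)) (at (coord d p))" by simp
  then have "(h \<circ> coord_inv d has_derivative (\<lambda>_. 0)) (at (coord d p))"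
    by (rule has_derivative_transform_within_open[OF _ W]) (use p z in auto)
  from D.partial_eq[OF this] show ?thesis .
qed

lemma green_term_zero_outside:
  assumes d: "d \<in> A" and K: "compact K" and z: "\<And>q. q \<in> dom d - K \<Longrightarrow> \<psi> q = 0" and p: "p \<in> dom d - K"
  shows "green_term d \<psi> h p = 0"
  using partial_zero_outside[OF assms] z[OF p] by (simp add: green_term_def grad_inner_def)

definition wlap_in :: "('a, 'n) chart \<Rightarrow> ('a \<Rightarrow> real) \<Rightarrow> 'a \<Rightarrow> real" where
  "wlap_in c h p = lap g c h p - grad_inner g c f h p"

lemma chart_Ck_wlap_in:
  assumes c: "c \<in> A" and h: "Ck_function A (Suc (Suc k)) h" and f: "Ck_function A (Suc k) f"
  shows "chart_Ck c k (wlap_in c h)"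
proof -
  interpret C: riemannian_chart c g using chart c by blast
  have "chart_Ck c (Suc (Suc k)) h" "chart_Ck c (Suc k) f" "chart_Ck c (Suc k) h"
    using h f c C.chart_Ck_le[of "Suc (Suc k)" h "Suc k"] by (auto simp: Ck_function_iff)
  then show ?thesis
    unfolding wlap_in_def[abs_def] by (intro C.chart_Ck_diff C.chart_Ck_lap C.chart_Ck_grad_inner)
qed

text \<open>Green's formula in either chart, tested against a bump function, has the same first-order
  term; so the two local expressions of the operator agree weakly, hence pointwise.\<close>

lemma wlap_in_le:
  assumes c: "c \<in> A" and d: "d \<in> A" and p: "p \<in> dom c" "p \<in> dom d" and h: "Ck_function A 2 h"
  shows "wlap_in c h p \<le> wlap_in d h p"
proof (rule ccontr)
  assume "\<not> ?thesis"
  then have gt: "wlap_in c h p - wlap_in d h p > 0" by simp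
  interpret C: riemannian_chart c g using chart c by blast
  interpret D: riemannian_chart d g using chart d by blast
  define \<Delta> where "\<Delta> = (\<lambda>q. wlap_in c h q - wlap_in d h q)"
  define S where "S = coord c ` (dom c \<inter> dom d)"
  have S: "open S" unfolding S_def by (rule open_overlap[OF c d])
  have h1: "Ck_function A 1 h" and h2: "Ck_function A (Suc (Suc 0)) h"
    using h unfolding Ck_function_def by (meson Ck_on_le one_le_numeral, simp add: numeral_2_eq_2)
  have f1: "Ck_function A (Suc 0) f" using f_C1 by simp
  have hc: "chart_Ck c 2 h" "chart_Ck d 2 h" using h c d by (auto simp: Ck_function_iff)
  have "continuous_on (coord d ` dom d) (wlap_in d h \<circ> coord_inv d)"
    using chart_Ck_wlap_in[OF d h2 f1] by (simp add: chart_Ck_def)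
  moreover have "continuous_on S (coord d \<circ> coord_inv c)"
    using transition_smooth[OF c d, of 0] by (simp add: S_def)
  ultimately have "continuous_on S (\<lambda>z. (wlap_in d h \<circ> coord_inv d) ((coord d \<circ> coord_inv c) z))"
    by (rule continuous_on_compose2) (auto simp: S_def)
  then have "continuous_on S (\<lambda>z. wlap_in d h (coord_inv c z))"
    by (rule continuous_on_eq) (auto simp: S_def)
  moreover have "continuous_on (coord c ` dom c) (wlap_in c h \<circ> coord_inv c)"
    using chart_Ck_wlap_in[OF c h2 f1] by (simp add: chart_Ck_def)
  then have "continuous_on S (\<lambda>z. wlap_in c h (coord_inv c z))"
    unfolding comp_def by (rule continuous_on_subset) (auto simp: S_def)
  ultimately have cont: "continuous_on S (\<lambda>z. \<Delta> (coord_inv c z))"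
    unfolding \<Delta>_def by (intro continuous_on_diff)
  \<comment> \<open>The set where the supposed strict inequality persists. The bump is placed on a
    closed ball inside it, and therefore inside the overlap.\<close>
  define V where "V = (\<lambda>z. \<Delta> (coord_inv c z)) -` {0<..} \<inter> S"
  have V: "open V" unfolding V_def
    by (rule continuous_on_open_vimage[OF S, THEN iffD1, OF cont, rule_format]) (rule open_greaterThan)
  have "coord c p \<in> V" using gt p by (simp add: V_def S_def \<Delta>_def)
  then obtain r where r: "r > 0" "cball (coord c p) r \<subseteq> V" using V open_contains_cball by blast
  define K where "K = cball (coord c p) r"
  have KS: "K \<subseteq> S" using r by (auto simp: K_def V_def)
  then have KU: "K \<subseteq> coord c ` dom c" by (auto simp: S_def)
  define \<beta> where "\<beta> = manifold_bump c (coord c p) r"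
  have \<beta>: "Ck_function A 1 \<beta>" unfolding \<beta>_def
    by (rule Ck_function_manifold_bump[OF c r(1)]) (use KU in \<open>simp add: K_def\<close>)
  have \<beta>c: "chart_Ck c 1 \<beta>" "chart_Ck d 1 \<beta>" using \<beta> c d by (auto simp: Ck_function_iff)
  define L where "L = coord_inv c ` K"
  have L: "compact L" "L \<subseteq> dom c \<inter> dom d"
    using compact_chart_ball[OF c KU] KS by (auto simp: L_def K_def S_def)
  have \<beta>0: "\<beta> q = 0" if "q \<notin> L" for q
    unfolding \<beta>_def
  proof (rule manifold_bump_zero[OF r(1)], rule notI)
    assume "q \<in> dom c \<and> coord c q \<in> ball (coord c p) r"
    then have "q = coord_inv c (coord c q)" "coord c q \<in> K" by (auto simp: K_def)
    then show False using that unfolding L_def by blast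
  qed
  have \<Delta>pos: "\<Delta> q > 0" if "q \<in> L" for q using that r(2) by (auto simp: L_def K_def V_def)
  have gc: "integrable \<mu> (\<lambda>p. indicator (dom c) p * green_term c \<beta> h p)"
       "(\<integral>p. indicator (dom c) p * green_term c \<beta> h p \<partial>\<mu>) = 0"
  proof -
    have z: "\<beta> q = 0" if "q \<in> dom c" "coord c q \<notin> K" for q
    proof (rule \<beta>0, rule notI)
      assume "q \<in> L"
      then obtain x where "x \<in> K" "q = coord_inv c x" by (auto simp: L_def)
      then show False using that(2) C.coord_coord_inv[of x] KU by auto
    qed
    show "integrable \<mu> (\<lambda>p. indicator (dom c) p * green_term c \<beta> h p)"
       "(\<integral>p. indicator (dom c) p * green_term c \<beta> h p \<partial>\<mu>) = 0"
      using green_local[OF c \<beta>c(1) hc(1) _ KU z] by (auto simp: K_def)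
  qed
  have gd: "integrable \<mu> (\<lambda>p. indicator (dom d) p * green_term d \<beta> h p)"
       "(\<integral>p. indicator (dom d) p * green_term d \<beta> h p \<partial>\<mu>) = 0"
  proof -
    have k: "compact (coord d ` L)"
    proof (rule compact_continuous_image[OF _ L(1)])
      have "continuous_on (dom d) (coord d)" using D.homeo by (simp add: homeomorphism_def)
      then show "continuous_on L (coord d)" by (rule continuous_on_subset) (use L(2) in blast)
    qed
    have s: "coord d ` L \<subseteq> coord d ` dom d" using L by auto
    have z: "\<beta> q = 0" if "q \<in> dom d" "coord d q \<notin> coord d ` L" for q
      using \<beta>0[of q] that by auto
    show "integrable \<mu> (\<lambda>p. indicator (dom d) p * green_term d \<beta> h p)"
       "(\<integral>p. indicator (dom d) p * green_term d \<beta> h p \<partial>\<mu>) = 0"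
      using green_local[OF d \<beta>c(2) hc(2) k s z] by auto
  qed
  \<comment> \<open>In the difference of the two Green integrands the first-order terms cancel. What
    remains is \<open>\<beta>\<close> times \<open>\<Delta>\<close>, which is nonnegative with
    integral 0, but positive near \<open>p\<close>.\<close>
  define F where "F = (\<lambda>p. indicator (dom c) p * green_term c \<beta> h p - indicator (dom d) p * green_term d \<beta> h p)"
  have intF: "integrable \<mu> F" "(\<integral>p. F p \<partial>\<mu>) = 0"
    unfolding F_def using gc gd by auto
  have FL: "F q = \<beta> q * \<Delta> q" if "q \<in> L" for q
  proof -
    have q: "q \<in> dom c" "q \<in> dom d" using that L(2) by auto
    show ?thesis using q grad_inner_independent[OF c d q \<beta> h1]
      by (simp add: F_def green_term_def \<Delta>_def wlap_in_def right_diff_distrib)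
  qed
  have F0: "F q = 0" if "q \<notin> L" for q
    using that green_term_zero_outside[OF c L(1), of \<beta> q h] green_term_zero_outside[OF d L(1), of \<beta> q h] \<beta>0
    by (auto simp: F_def indicator_def)
  have Fnn: "F q \<ge> 0" for q
    using FL[of q] F0[of q] \<Delta>pos[of q] manifold_bump_nonneg[of c "coord c p" r q] by (cases "q \<in> L") (auto simp: \<beta>_def)
  have "AE q in \<mu>. F q = 0"
    using integral_nonneg_eq_0_iff_AE[OF intF(1)] Fnn intF(2) by auto
  from AE_mu_open_chart[OF c r(1) _ this, of "coord c p"]
  obtain q where q: "q \<in> dom c" "coord c q \<in> ball (coord c p) r" "F q = 0"
    using KU ball_subset_cball unfolding K_def by blast
  have "q \<in> L" using q by (auto simp: L_def K_def intro!: image_eqI[of _ _ "coord c q"])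
  then show False using q(3) FL[of q] \<Delta>pos[of q] manifold_bump_pos[OF r(1) q(1,2)] by (simp add: \<beta>_def)
qed

lemma wlap_in_independent:
  assumes "c \<in> A" "d \<in> A" "p \<in> dom c" "p \<in> dom d" "Ck_function A 2 h"
  shows "wlap_in c h p = wlap_in d h p"
  using wlap_in_le[OF assms(1-5)] wlap_in_le[OF assms(2,1,4,3,5)] by simp

section \<open>Gradient products and the weighted Laplacian as functions on the manifold\<close>

lemma chart_at: 
  assumes "p \<in> M" shows "chart_at A p \<in> A" "p \<in> dom (chart_at A p)"
proof -
  have "\<exists>c. c \<in> A \<and> p \<in> dom c" using assms M_eq by blast
  from someI_ex[OF this] show "chart_at A p \<in> A" "p \<in> dom (chart_at A p)"
    unfolding chart_at_def by auto
qed

definition ginner :: "('a \<Rightarrow> real) \<Rightarrow> ('a \<Rightarrow> real) \<Rightarrow> 'a \<Rightarrow> real" where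
  "ginner a b p = grad_inner g (chart_at A p) a b p"

definition wlap :: "('a \<Rightarrow> real) \<Rightarrow> 'a \<Rightarrow> real" where
  "wlap h p = wlap_in (chart_at A p) h p"

lemma Ck_function_le: "Ck_function A k h \<Longrightarrow> j \<le> k \<Longrightarrow> Ck_function A j h"
  unfolding Ck_function_def using Ck_on_le by blast

lemma ginner_eq:
  assumes "c \<in> A" "p \<in> dom c" "Ck_function A 1 a" "Ck_function A 1 b"
  shows "ginner a b p = grad_inner g c a b p"
  unfolding ginner_def using grad_inner_independent chart_at assms dom_subset by blast

lemma wlap_eq:
  assumes "c \<in> A" "p \<in> dom c" "Ck_function A 2 h"
  shows "wlap h p = wlap_in c h p"
  unfolding wlap_def using wlap_in_independent chart_at assms dom_subset by blast

lemma Ck_function_ginner: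
  assumes a: "Ck_function A (Suc k) a" and b: "Ck_function A (Suc k) b"
  shows "Ck_function A k (ginner a b)"
  unfolding Ck_function_iff
proof
  fix c assume c: "c \<in> A"
  interpret C: riemannian_chart c g using chart c by blast
  have "chart_Ck c k (grad_inner g c a b)"
    using a b c by (intro C.chart_Ck_grad_inner) (auto simp: Ck_function_iff)
  moreover have "Ck_function A 1 a" "Ck_function A 1 b" using Ck_function_le a b by auto
  then have "ginner a b p = grad_inner g c a b p" if "p \<in> dom c" for p using ginner_eq c that by blast
  ultimately show "chart_Ck c k (ginner a b)" by (subst C.chart_Ck_cong) auto
qed

text \<open>As \<open>chart_at A p\<close> jumps with \<open>p\<close>, regularity cannot be read
  off from the definition. Chart independence identifies \<open>wlap h\<close> on each chart with
  the expression in that fixed chart.\<close>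

lemma Ck_function_wlap:
  assumes h: "Ck_function A (Suc (Suc k)) h" and f: "Ck_function A (Suc k) f"
  shows "Ck_function A k (wlap h)"
  unfolding Ck_function_iff
proof
  fix c assume c: "c \<in> A"
  interpret C: riemannian_chart c g using chart c by blast
  have "Ck_function A 2 h" using Ck_function_le[OF h] by simp
  then have "wlap h p = wlap_in c h p" if "p \<in> dom c" for p using wlap_eq c that by blast
  then show "chart_Ck c k (wlap h)" using chart_Ck_wlap_in[OF c h f] by (subst C.chart_Ck_cong) auto
qed

lemma Ck_function_mult: "Ck_function A k a \<Longrightarrow> Ck_function A k b \<Longrightarrow> Ck_function A k (\<lambda>p. a p * b p)"
  unfolding Ck_function_iff using riemannian_chart.chart_Ck_mult[OF chart] by blast

lemma Ck_function_add: "Ck_function A k a \<Longrightarrow> Ck_function A k b \<Longrightarrow> Ck_function A k (\<lambda>p. a p + b p)"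
  unfolding Ck_function_iff using riemannian_chart.chart_Ck_add[OF chart] by blast

lemma Ck_function_divide:
  "Ck_function A k a \<Longrightarrow> Ck_function A k b \<Longrightarrow> (\<And>p. p \<in> M \<Longrightarrow> b p \<noteq> 0) \<Longrightarrow> Ck_function A k (\<lambda>p. a p / b p)"
  unfolding Ck_function_iff using riemannian_chart.chart_Ck_divide[OF chart] dom_subset by blast

lemma Ck_function_sum: "(\<And>x. x \<in> D \<Longrightarrow> Ck_function A k (h x)) \<Longrightarrow> Ck_function A k (\<lambda>p. \<Sum>x\<in>D. h x p)"
  unfolding Ck_function_iff by (intro ballI riemannian_chart.chart_Ck_sum[OF chart]) auto

lemma Ck_function_const: "Ck_function A k (\<lambda>p. a)"
  unfolding Ck_function_iff using riemannian_chart.chart_Ck_const[OF chart] by blast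

lemma green:
  assumes \<psi>: "Ck_function A 1 \<psi>" and h: "Ck_function A 2 h"
  shows "(\<integral>p. ginner \<psi> h p \<partial>\<mu>) = - (\<integral>p. \<psi> p * wlap h p \<partial>\<mu>)"
proof -
  obtain D where D: "finite D"
    "\<And>c a r. (c, a, r) \<in> D \<Longrightarrow> c \<in> A \<and> r > 0 \<and> cball a r \<subseteq> coord c ` dom c"
    "M \<subseteq> (\<Union>(c, a, r)\<in>D. {p \<in> dom c. coord c p \<in> ball a r})" using finite_ball_cover by blast
  define \<beta> where "\<beta> = (\<lambda>(c :: ('a, 'n) chart, a, r). manifold_bump c a r)"
  have \<beta>1: "Ck_function A 1 (\<beta> x)" if "x \<in> D" for x
    using that D(2) Ck_function_manifold_bump by (cases x) (auto simp: \<beta>_def)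
  define S where "S = (\<lambda>p. \<Sum>x\<in>D. \<beta> x p)"
  have S1: "Ck_function A 1 S" unfolding S_def by (rule Ck_function_sum[OF \<beta>1])
  have Spos: "S p > 0" if pM: "p \<in> M" for p
  proof -
    obtain c a r where x: "(c, a, r) \<in> D" "p \<in> dom c" "coord c p \<in> ball a r"
      using pM D(3) by (auto simp del: mem_ball)
    show ?thesis unfolding S_def
    proof (rule sum_pos2[OF D(1) x(1)])
      show "0 < \<beta> (c, a, r) p" using manifold_bump_pos[OF _ x(2,3)] D(2)[OF x(1)] by (simp add: \<beta>_def)
      show "0 \<le> \<beta> y p" for y using manifold_bump_nonneg by (cases y) (simp add: \<beta>_def)
    qed
  qed
  \<comment> \<open>The bumps are not normalised, so their sum \<open>S\<close>, positive on
    \<open>M\<close>, is divided out.\<close>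
  define \<psi>' where "\<psi>' = (\<lambda>x p. \<beta> x p * (\<psi> p / S p))"
  have \<psi>'1: "Ck_function A 1 (\<psi>' x)" if "x \<in> D" for x
    unfolding \<psi>'_def using Spos by (intro Ck_function_mult Ck_function_divide \<beta>1 \<psi> S1 that) (simp add: less_imp_neq[symmetric])
  have h1: "Ck_function A 1 h" and h2: "Ck_function A (Suc (Suc 0)) h"
    using h Ck_function_le by (auto simp: numeral_2_eq_2)
  have f1: "Ck_function A (Suc 0) f" using f_C1 by simp
  have cg: "continuous_on M (ginner a h)" if "Ck_function A 1 a" for a
    using continuous_on_Ck Ck_function_ginner[of 0 a h] that h1 by simp
  have cw: "continuous_on M (wlap h)" using continuous_on_Ck Ck_function_wlap[OF h2 f1] by blast
  define T where "T = (\<lambda>a p. ginner a h p + a p * wlap h p)"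
  have cT: "continuous_on M (T a)" if "Ck_function A 1 a" for a
    unfolding T_def by (intro continuous_intros cg cw that continuous_on_Ck[OF that])
  have T0: "(\<integral>p. T (\<psi>' x) p \<partial>\<mu>) = 0" if x: "x \<in> D" for x
  proof -
    obtain c a r where car: "x = (c, a, r)" by (cases x)
    have c: "c \<in> A" "r > 0" "cball a r \<subseteq> coord c ` dom c" using D(2) x car by auto
    interpret C: riemannian_chart c g using chart c(1) by blast
    define L where "L = coord_inv c ` cball a r"
    have L: "compact L" "L \<subseteq> dom c" unfolding L_def using compact_chart_ball[OF c(1,3)] by auto
    have z: "\<psi>' x q = 0" if "q \<notin> L" for q
    proof -
      have "manifold_bump c a r q = 0"
      proof (rule manifold_bump_zero[OF c(2)], rule notI)
        assume "q \<in> dom c \<and> coord c q \<in> ball a r"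
        then have "q = coord_inv c (coord c q)" "coord c q \<in> cball a r" by auto
        then show False using that unfolding L_def by blast
      qed
      then show ?thesis by (simp add: \<psi>'_def \<beta>_def car)
    qed
    have gt: "T (\<psi>' x) p = green_term d (\<psi>' x) h p" if "d \<in> A" "p \<in> dom d" for d p
      unfolding T_def green_term_def using ginner_eq[OF that \<psi>'1[OF x] h1] wlap_eq[OF that h] by (simp add: wlap_in_def)
    have "T (\<psi>' x) p = indicator (dom c) p * green_term c (\<psi>' x) h p" if p: "p \<in> M" for p
    proof (cases "p \<in> dom c")
      case True
      then show ?thesis using gt c(1) by simp
    next
      case False
      obtain d where d: "d \<in> A" "p \<in> dom d" using p M_eq by blast
      \<comment> \<open>Off \<open>dom c\<close> the integrand has to be computed in another chart,
        where \<open>\<psi>' x\<close> vanishes on a neighbourhood of the point.\<close>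
      have "green_term d (\<psi>' x) h p = 0"
        by (rule green_term_zero_outside[OF d(1) L(1)]) (use z False L d in auto)
      then show ?thesis using gt[OF d] False by simp
    qed
    then have "(\<integral>p. T (\<psi>' x) p \<partial>\<mu>) = (\<integral>p. indicator (dom c) p * green_term c (\<psi>' x) h p \<partial>\<mu>)"
      by (rule integral_mu_cong)
    also have "\<dots> = 0"
    proof (rule green_local(2)[OF c(1) _ _ compact_cball c(3)])
      show "chart_Ck c 1 (\<psi>' x)" "chart_Ck c 2 h" using \<psi>'1[OF x] h c(1) by (auto simp: Ck_function_iff)
      show "\<psi>' x p = 0" if "p \<in> dom c" "coord c p \<notin> cball a r" for p
      proof (rule z, rule notI)
        assume "p \<in> L"
        then obtain y where "y \<in> cball a r" "p = coord_inv c y" by (auto simp: L_def)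
        then show False using that(2) C.coord_coord_inv[of y] c(3) by auto
      qed
    qed
    finally show ?thesis .
  qed
  \<comment> \<open>\<open>T\<close> is linear in its first argument, but the decomposition of
    \<open>\<psi>\<close> holds only on \<open>M\<close>. It is therefore differentiated inside a
    chart, where agreement on the domain suffices.\<close>
  have Tsum: "T \<psi> p = (\<Sum>x\<in>D. T (\<psi>' x) p)" if p: "p \<in> M" for p
  proof -
    have e: "\<psi> q = (\<Sum>x\<in>D. \<psi>' x q)" if "q \<in> M" for q
    proof -
      have "(\<Sum>x\<in>D. \<psi>' x q) = S q * (\<psi> q / S q)" unfolding \<psi>'_def S_def sum_distrib_right ..
      then show ?thesis using Spos[OF that] by simp
    qed
    define c where "c = chart_at A p"
    have c: "c \<in> A" "p \<in> dom c" using chart_at p by (auto simp: c_def)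
    interpret C: riemannian_chart c g using chart c(1) by blast
    have "partial c i \<psi> p = (\<Sum>x\<in>D. partial c i (\<psi>' x) p)" for i
    proof -
      have "partial c i \<psi> p = partial c i (\<lambda>q. \<Sum>x\<in>D. \<psi>' x q) p"
        by (rule C.partial_cong) (use \<psi> c e dom_subset[OF c(1)] in \<open>auto simp: Ck_function_iff simp del: One_nat_def\<close>)
      also have "\<dots> = (\<Sum>x\<in>D. partial c i (\<psi>' x) p)"
        by (rule C.partial_sum) (use \<psi>'1 c in \<open>auto simp: Ck_function_iff simp del: One_nat_def\<close>)
      finally show ?thesis .
    qed
    then have "ginner \<psi> h p = (\<Sum>x\<in>D. ginner (\<psi>' x) h p)"
      unfolding ginner_def c_def[symmetric] grad_inner_def by (simp add: sum_distrib_right) (rule sum.swap)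
    then show ?thesis unfolding T_def by (simp add: sum.distrib e[OF p] sum_distrib_right)
  qed
  have "(\<integral>p. T \<psi> p \<partial>\<mu>) = (\<integral>p. (\<Sum>x\<in>D. T (\<psi>' x) p) \<partial>\<mu>)"
    by (rule integral_mu_cong[OF Tsum])
  also have "\<dots> = (\<Sum>x\<in>D. \<integral>p. T (\<psi>' x) p \<partial>\<mu>)"
    by (rule Bochner_Integration.integral_sum) (use cT \<psi>'1 integrable_continuous in blast)
  also have "\<dots> = 0" using T0 by simp
  finally have "(\<integral>p. ginner \<psi> h p + \<psi> p * wlap h p \<partial>\<mu>) = 0" by (simp add: T_def)
  moreover have "integrable \<mu> (ginner \<psi> h)" "integrable \<mu> (\<lambda>p. \<psi> p * wlap h p)"
    using cg[OF \<psi>] continuous_on_mult[OF continuous_on_Ck[OF \<psi>] cw] integrable_continuous by auto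
  ultimately show ?thesis by simp
qed

end

section \<open>Time-dependent functions\<close>

definition time_deriv :: "(real \<Rightarrow> 'a \<Rightarrow> real) \<Rightarrow> real \<Rightarrow> 'a \<Rightarrow> real" where
  "time_deriv h t p = deriv (\<lambda>s. h s p) t"

definition spacetime_chart :: "(real \<Rightarrow> 'a \<Rightarrow> real) \<Rightarrow> ('a, 'n::finite) chart \<Rightarrow> (real^'n) \<times> real \<Rightarrow> real" where
  "spacetime_chart h c x = h (snd x) (coord_inv c (fst x))"

context weighted_manifold
begin

context
  fixes I :: "real set" and h :: "real \<Rightarrow> 'a \<Rightarrow> real"
  assumes I: "open I" and h: "smooth_spacetime A I h"
begin

section \<open>Slices and time derivatives of smooth functions on space-time\<close>

lemma spacetime_chart_Ck: "c \<in> A \<Longrightarrow> Ck_on k (coord c ` dom c \<times> I) (spacetime_chart h c)"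
  using h by (simp add: smooth_spacetime_def smooth_on_def spacetime_chart_def[abs_def] case_prod_beta')

lemma open_chart_times: "c \<in> A \<Longrightarrow> open (coord c ` dom c \<times> I)"
  using I riemannian_chart.open_range[OF chart] by (simp add: open_Times)

lemma spacetime_chart_has_derivative:
  assumes "c \<in> A" "p \<in> dom c" "t \<in> I"
  shows "(spacetime_chart h c has_derivative frechet_derivative (spacetime_chart h c) (at (coord c p, t))) (at (coord c p, t))"
  using Ck_on_SucD[OF spacetime_chart_Ck[OF assms(1), of "Suc 0"], of "(coord c p, t)"] assms by auto

lemma Ck_function_slice:
  assumes "t \<in> I" shows "Ck_function A k (h t)"
  unfolding Ck_function_def
proof
  fix c assume c: "c \<in> A"
  interpret C: riemannian_chart c g using chart c by blast
  have "Ck_on k (coord c ` dom c) (\<lambda>z. (z, 0::real) + (0, t))"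
    by (intro Ck_on_add Ck_on_const Ck_on_linear C.open_range bounded_linear_Pair bounded_linear_ident bounded_linear_zero)
  then have "Ck_on k (coord c ` dom c) (\<lambda>z. spacetime_chart h c ((z, 0) + (0, t)))"
    by (intro Ck_on_compose[OF C.open_range _ _ spacetime_chart_Ck[OF c], where \<tau>="\<lambda>z. (z, 0) + (0, t)"]) (use assms in auto)
  then show "Ck_on k (coord c ` dom c) (h t \<circ> coord_inv c)" by (simp add: spacetime_chart_def comp_def)
qed

lemma partial_slice:
  assumes c: "c \<in> A" and p: "p \<in> dom c" and t: "t \<in> I"
  shows "partial c i (h t) p = frechet_derivative (spacetime_chart h c) (at (coord c p, t)) (axis i 1, 0)"
proof -
  interpret C: riemannian_chart c g using chart c by blast
  have "((\<lambda>z. (z, t)) has_derivative (\<lambda>v. (v, 0))) (at (coord c p))"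
    by (auto intro!: derivative_eq_intros)
  from has_derivative_compose[OF this spacetime_chart_has_derivative[OF assms]]
  have "(h t \<circ> coord_inv c has_derivative (\<lambda>v. frechet_derivative (spacetime_chart h c) (at (coord c p, t)) (v, 0))) (at (coord c p))"
    by (simp add: spacetime_chart_def comp_def)
  from C.partial_eq[OF this] show ?thesis .
qed

lemma time_derivative_chart:
  assumes c: "c \<in> A" and p: "p \<in> dom c" and t: "t \<in> I"
  shows "((\<lambda>s. h s p) has_real_derivative frechet_derivative (spacetime_chart h c) (at (coord c p, t)) (0, 1)) (at t)"
proof -
  interpret C: riemannian_chart c g using chart c by blast
  interpret l: linear "frechet_derivative (spacetime_chart h c) (at (coord c p, t))"
    using spacetime_chart_has_derivative[OF assms] has_derivative_linear by blast
  have s: "frechet_derivative (spacetime_chart h c) (at (coord c p, t)) (0, u) = frechet_derivative (spacetime_chart h c) (at (coord c p, t)) (0, 1) * u" for u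
    using l.scaleR[of u "(0, 1)"] by simp
  have "((\<lambda>s. (coord c p, s)) has_derivative (\<lambda>u. (0, u))) (at t)"
    by (auto intro!: derivative_eq_intros)
  from has_derivative_compose[OF this spacetime_chart_has_derivative[OF assms]]
  have "((\<lambda>s. spacetime_chart h c (coord c p, s)) has_derivative (*) (frechet_derivative (spacetime_chart h c) (at (coord c p, t)) (0, 1))) (at t)"
    by (rule has_derivative_eq_rhs) (rule ext, rule s)
  moreover have "(\<lambda>s. spacetime_chart h c (coord c p, s)) = (\<lambda>s. h s p)" using p by (simp add: spacetime_chart_def)
  ultimately show ?thesis by (simp add: has_field_derivative_def)
qed

lemma time_deriv_chart:
  assumes "c \<in> A" "p \<in> dom c" "t \<in> I"
  shows "time_deriv h t p = frechet_derivative (spacetime_chart h c) (at (coord c p, t)) (0, 1)"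
  unfolding time_deriv_def using DERIV_imp_deriv time_derivative_chart[OF assms] by blast

lemma has_time_deriv:
  assumes "p \<in> M" "t \<in> I"
  shows "((\<lambda>s. h s p) has_real_derivative time_deriv h t p) (at t)"
proof -
  obtain c where "c \<in> A" "p \<in> dom c" using assms(1) M_eq by blast
  then show ?thesis using time_derivative_chart time_deriv_chart assms(2) by metis
qed

text \<open>In a chart the time derivative is the derivative in the fixed direction
  \<open>(0, 1)\<close>, so its regularity is part of the definition of
  \<open>Ck_on\<close>.\<close>

lemma smooth_time_deriv: "smooth_spacetime A I (time_deriv h)"
  unfolding smooth_spacetime_def smooth_on_def
proof (intro ballI allI)
  fix c k assume c: "c \<in> A"
  interpret C: riemannian_chart c g using chart c by blast
  have 1: "Ck_on k (coord c ` dom c \<times> I) (\<lambda>x. frechet_derivative (spacetime_chart h c) (at x) (0, 1))"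
    using spacetime_chart_Ck[OF c, of "Suc k"] by simp
  have e: "(\<lambda>(z, t). time_deriv h t (coord_inv c z)) x = frechet_derivative (spacetime_chart h c) (at x) (0, 1)" if "x \<in> coord c ` dom c \<times> I" for x
  proof -
    obtain z t where x: "x = (z, t)" by (cases x)
    then have z: "z \<in> coord c ` dom c" "t \<in> I" using that by auto
    show ?thesis unfolding x using time_deriv_chart[OF c C.coord_inv_dom[OF z(1)] z(2)] C.coord_coord_inv[OF z(1)] by simp
  qed
  show "Ck_on k (coord c ` dom c \<times> I) (\<lambda>(z, t). time_deriv h t (coord_inv c z))"
    by (rule iffD2[OF Ck_on_cong[OF open_chart_times[OF c] e] 1])
qed

lemma continuous_on_spacetime: "continuous_on (M \<times> I) (\<lambda>x. h (snd x) (fst x))"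
proof (rule continuous_on_from_charts)
  fix c assume "c \<in> A"
  from Ck_on_imp_continuous[OF spacetime_chart_Ck[OF this]]
  show "continuous_on (coord c ` dom c \<times> I) (\<lambda>x. h (snd (coord_inv c (fst x), snd x)) (fst (coord_inv c (fst x), snd x)))"
    by (simp add: spacetime_chart_def)
qed

lemma continuous_on_partial_spacetime:
  assumes c: "c \<in> A"
  shows "continuous_on (coord c ` dom c \<times> I) (\<lambda>x. partial c i (h (snd x)) (coord_inv c (fst x)))"
proof -
  interpret C: riemannian_chart c g using chart c by blast
  have 1: "continuous_on (coord c ` dom c \<times> I) (\<lambda>x. frechet_derivative (spacetime_chart h c) (at x) (axis i 1, 0))"
    using spacetime_chart_Ck[OF c, of "Suc 0"] by simp
  show ?thesis
  proof (rule continuous_on_eq[OF 1])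
    fix x assume x: "x \<in> coord c ` dom c \<times> I"
    then have z: "fst x \<in> coord c ` dom c" "snd x \<in> I" by auto
    show "frechet_derivative (spacetime_chart h c) (at x) (axis i 1, 0) = partial c i (h (snd x)) (coord_inv c (fst x))"
      using partial_slice[OF c C.coord_inv_dom[OF z(1)] z(2), of i] C.coord_coord_inv[OF z(1)] by simp
  qed
qed

end

text \<open>Symmetry of the second derivative on space-time, for the directions
  \<open>(axis i 1, 0)\<close> and \<open>(0, 1)\<close>.\<close>

lemma partial_has_time_deriv:
  assumes I: "open I" and h: "smooth_spacetime A I h" and c: "c \<in> A" and p: "p \<in> dom c" and t: "t \<in> I"
  shows "((\<lambda>s. partial c i (h s) p) has_real_derivative partial c i (time_deriv h t) p) (at t)"
proof -
  interpret C: riemannian_chart c g using chart c by blast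
  define F where "F = spacetime_chart h c"
  define S where "S = coord c ` dom c \<times> I"
  define x where "x = (coord c p, t)"
  have S: "open S" "x \<in> S" using open_chart_times[OF I h c] p t by (auto simp: S_def x_def)
  have F: "Ck_on k S F" for k unfolding S_def F_def by (rule spacetime_chart_Ck[OF I h c])
  define P where "P = (\<lambda>y. frechet_derivative F (at y) (axis i 1, 0::real))"
  define Q where "Q = (\<lambda>y. frechet_derivative F (at y) (0::real^'n, 1::real))"
  have "Ck_on (Suc 0) S P" using F[of "Suc (Suc 0)"] unfolding P_def Ck_on.simps(2)[of "Suc 0"] by blast
  then have P: "(P has_derivative frechet_derivative P (at x)) (at x)" using Ck_on_SucD S(2) by blast
  interpret l: linear "frechet_derivative P (at x)" using P has_derivative_linear by blast
  have "((\<lambda>s. (coord c p, s)) has_derivative (\<lambda>u. (0, u))) (at t)"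
    by (auto intro!: derivative_eq_intros)
  from has_derivative_compose[OF this P[unfolded x_def]]
  have "((\<lambda>s. P (coord c p, s)) has_derivative (\<lambda>u. frechet_derivative P (at x) (0, u))) (at t)"
    by (simp add: x_def)
  then have 1: "((\<lambda>s. P (coord c p, s)) has_real_derivative frechet_derivative P (at x) (0, 1)) (at t)"
    unfolding has_field_derivative_def
  proof (rule has_derivative_eq_rhs)
    show "(\<lambda>u. frechet_derivative P (at x) (0, u)) = (*) (frechet_derivative P (at x) (0, 1))"
    proof (rule ext)
      fix u show "frechet_derivative P (at x) (0, u) = frechet_derivative P (at x) (0, 1) * u"
        using l.scaleR[of u "(0, 1)"] by simp
    qed
  qed
  have 2: "((\<lambda>s. partial c i (h s) p) has_real_derivative frechet_derivative P (at x) (0, 1)) (at t)"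
    by (rule has_field_derivative_transform_within_open[OF 1 I t])
       (use partial_slice[OF I h c p] in \<open>simp add: P_def F_def\<close>)
  have "frechet_derivative P (at x) (0, 1) = frechet_derivative Q (at x) (axis i 1, 0)"
    unfolding P_def Q_def by (rule frechet_derivative_symmetric[OF S(1) F S(2)])
  also have "\<dots> = frechet_derivative (spacetime_chart (time_deriv h) c) (at x) (axis i 1, 0)"
  proof -
    have "Ck_on (Suc 0) S Q" using F[of "Suc (Suc 0)"] unfolding Q_def Ck_on.simps(2)[of "Suc 0"] by blast
    then have "Q differentiable (at x)" using S(2) by simp
    moreover have "Q y = spacetime_chart (time_deriv h) c y" if "y \<in> S" for y
    proof -
      have z: "fst y \<in> coord c ` dom c" "snd y \<in> I" using that by (auto simp: S_def)
      show ?thesis using time_deriv_chart[OF I h c C.coord_inv_dom[OF z(1)] z(2)] C.coord_coord_inv[OF z(1)]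
        by (simp add: spacetime_chart_def Q_def F_def)
    qed
    ultimately have "frechet_derivative Q (at x) = frechet_derivative (spacetime_chart (time_deriv h) c) (at x)"
      using frechet_derivative_transform_within_open S by metis
    then show ?thesis by simp
  qed
  also have "\<dots> = partial c i (time_deriv h t) p"
    unfolding x_def by (rule partial_slice[OF I smooth_time_deriv[OF I h] c p t, symmetric])
  finally show ?thesis using 2 by simp
qed

text \<open>The inverse metric does not depend on time, so the product rule acts on the two
  differentials only.\<close>

lemma ginner_has_time_deriv:
  assumes I: "open I" and a: "smooth_spacetime A I a" and b: "smooth_spacetime A I b" and p: "p \<in> M" and t: "t \<in> I"
  shows "((\<lambda>s. ginner (a s) (b s) p) has_real_derivative
           (ginner (time_deriv a t) (b t) p + ginner (a t) (time_deriv b t) p)) (at t)"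
proof -
  define c where "c = chart_at A p"
  have c: "c \<in> A" "p \<in> dom c" using chart_at[OF p] by (auto simp: c_def)
  interpret C: riemannian_chart c g using chart c by blast
  have "((\<lambda>s. \<Sum>i\<in>UNIV. partial c i (a s) p * (\<Sum>j\<in>UNIV. matrix_inv (g c p) $ i $ j * partial c j (b s) p)) has_real_derivative
     (\<Sum>i\<in>UNIV. partial c i (a t) p * (\<Sum>j\<in>UNIV. matrix_inv (g c p) $ i $ j * partial c j (time_deriv b t) p)
        + partial c i (time_deriv a t) p * (\<Sum>j\<in>UNIV. matrix_inv (g c p) $ i $ j * partial c j (b t) p))) (at t)"
    by (intro DERIV_sum DERIV_mult' DERIV_cmult partial_has_time_deriv[OF I a c t] partial_has_time_deriv[OF I b c t])
  then show ?thesis unfolding ginner_def grad_inner_def C.grad_nth c_def[symmetric]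
    by (simp add: C.grad_nth sum.distrib add.commute)
qed

text \<open>Joint continuity of the differentiated integrand is what differentiation under the
  integral asks for.\<close>

lemma continuous_on_ginner_spacetime:
  assumes I: "open I" and a: "smooth_spacetime A I a" and b: "smooth_spacetime A I b"
  shows "continuous_on (M \<times> I) (\<lambda>x. ginner (a (snd x)) (b (snd x)) (fst x))"
proof (rule continuous_on_from_charts)
  fix c assume c: "c \<in> A"
  interpret C: riemannian_chart c g using chart c by blast
  have gc: "continuous_on (coord c ` dom c \<times> I) (\<lambda>x. matrix_inv (g c (coord_inv c (fst x))) $ i $ j)" for i j
  proof -
    have "continuous_on (coord c ` dom c) (\<lambda>z. matrix_inv (g c (coord_inv c z)) $ i $ j)"
      using C.chart_Ck_inverse_metric[of 0 i j] by (simp add: chart_Ck_def comp_def)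
    then show ?thesis by (rule continuous_on_compose2) (auto intro!: continuous_intros)
  qed
  have "continuous_on (coord c ` dom c \<times> I) (\<lambda>x. \<Sum>i\<in>UNIV. partial c i (a (snd x)) (coord_inv c (fst x)) *
      (\<Sum>j\<in>UNIV. matrix_inv (g c (coord_inv c (fst x))) $ i $ j * partial c j (b (snd x)) (coord_inv c (fst x))))"
    by (intro continuous_on_sum continuous_on_mult gc continuous_on_partial_spacetime[OF I a c] continuous_on_partial_spacetime[OF I b c])
  then show "continuous_on (coord c ` dom c \<times> I) (\<lambda>x. ginner (a (snd (coord_inv c (fst x), snd x))) (b (snd (coord_inv c (fst x), snd x))) (fst (coord_inv c (fst x), snd x)))"
  proof (rule continuous_on_eq)
    fix x assume "x \<in> coord c ` dom c \<times> I"
    then have z: "fst x \<in> coord c ` dom c" "snd x \<in> I" by auto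
    show "(\<Sum>i\<in>UNIV. partial c i (a (snd x)) (coord_inv c (fst x)) *
      (\<Sum>j\<in>UNIV. matrix_inv (g c (coord_inv c (fst x))) $ i $ j * partial c j (b (snd x)) (coord_inv c (fst x))))
      = ginner (a (snd (coord_inv c (fst x), snd x))) (b (snd (coord_inv c (fst x), snd x))) (fst (coord_inv c (fst x), snd x))"
      using ginner_eq[OF c C.coord_inv_dom[OF z(1)] Ck_function_slice[OF I a z(2)] Ck_function_slice[OF I b z(2)]]
      by (simp add: grad_inner_def C.grad_nth)
  qed
qed

text \<open>Dominated convergence along sequences. \<open>F'\<close> is bounded on the compact set
  \<open>M \<times> cball t e\<close>, the mean value inequality carries this bound over to the
  difference quotients, and constants are integrable because the measure is finite.\<close>

lemma integral_has_time_deriv: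
  fixes F F' :: "real \<Rightarrow> 'a \<Rightarrow> real"
  assumes I: "open I" and t: "t \<in> I"
    and der: "\<And>s p. s \<in> I \<Longrightarrow> p \<in> M \<Longrightarrow> ((\<lambda>s. F s p) has_real_derivative F' s p) (at s)"
    and cont: "\<And>s. s \<in> I \<Longrightarrow> continuous_on M (F s)"
    and cont': "continuous_on (M \<times> I) (\<lambda>x. F' (snd x) (fst x))"
  shows "((\<lambda>s. \<integral>p. F s p \<partial>\<mu>) has_real_derivative (\<integral>p. F' t p \<partial>\<mu>)) (at t)"
proof -
  obtain e where e: "e > 0" "cball t e \<subseteq> I" using I t open_contains_cball by blast
  have "compact ((\<lambda>x. F' (snd x) (fst x)) ` (M \<times> cball t e))"
    by (intro compact_continuous_image continuous_on_subset[OF cont'] compact_Times compact_M compact_cball)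
       (use e in auto)
  from compact_imp_bounded[OF this] obtain B where "\<forall>y\<in>(\<lambda>x. F' (snd x) (fst x)) ` (M \<times> cball t e). norm y \<le> B"
    unfolding bounded_iff by blast
  then have B: "\<bar>F' s p\<bar> \<le> B" if "p \<in> M" "s \<in> cball t e" for s p using that by force
  have contF': "continuous_on M (F' t)"
  proof -
    have "continuous_on M (\<lambda>p. (\<lambda>x. F' (snd x) (fst x)) (p, t))"
      by (rule continuous_on_compose2[OF cont']) (use t in \<open>auto intro!: continuous_intros\<close>)
    then show ?thesis by simp
  qed
  define G where "G = (\<lambda>s. \<integral>p. F s p \<partial>\<mu>)"
  have "((\<lambda>h. (G (t + h) - G t) / h) \<longlongrightarrow> (\<integral>p. F' t p \<partial>\<mu>)) (at 0)"
    unfolding tendsto_at_iff_sequentially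
  proof (intro allI impI)
    fix X :: "nat \<Rightarrow> real"
    assume X: "\<forall>i. X i \<in> UNIV - {0}" "X \<longlonglongrightarrow> 0"
    \<comment> \<open>Quotients whose step leaves the interval are replaced by 0, so that the bound
      holds for every index; this changes finitely many terms only.\<close>
    define s where "s = (\<lambda>n p. if \<bar>X n\<bar> \<le> e then (F (t + X n) p - F t p) / X n else 0)"
    have inI: "t + X n \<in> I" if "\<bar>X n\<bar> \<le> e" for n
      using that e(2) by (auto simp: dist_real_def)
    have ev: "eventually (\<lambda>n. \<bar>X n\<bar> \<le> e) sequentially"
      using tendstoD[OF X(2) e(1)] by (rule eventually_mono) simp
    have cs: "continuous_on M (s n)" for n
      using inI[of n] X(1) by (cases "\<bar>X n\<bar> \<le> e") (auto simp: s_def intro!: continuous_intros cont t)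
    have bd: "\<bar>s n p\<bar> \<le> B" if p: "p \<in> M" for n p
    proof (cases "\<bar>X n\<bar> \<le> e")
      case True
      have "norm (F (t + X n) p - F t p) \<le> B * norm (t + X n - t)"
      proof (rule field_differentiable_bound[of "cball t e" "\<lambda>s. F s p" "\<lambda>s. F' s p"])
        show "((\<lambda>s. F s p) has_field_derivative F' u p) (at u within cball t e)" if "u \<in> cball t e" for u
          by (rule has_field_derivative_at_within, rule der[OF _ p]) (use e(2) that in blast)
      qed (use B[OF p] True e(1) in \<open>auto simp: dist_real_def\<close>)
      then show ?thesis using X(1)[rule_format, of n] True by (simp add: s_def divide_le_eq)
    next
      case False
      have "0 \<le> B" using B[OF p, of t] e(1) by simp
      then show ?thesis using False by (simp add: s_def)
    qed
    have lim: "(\<lambda>n. s n p) \<longlonglongrightarrow> F' t p" if p: "p \<in> M" for p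
    proof -
      have "((\<lambda>h. (F (t + h) p - F t p) / h) \<longlongrightarrow> F' t p) (at 0)"
        using der[OF t p] by (simp add: DERIV_def)
      then have "((\<lambda>h. (F (t + h) p - F t p) / h) \<circ> X) \<longlonglongrightarrow> F' t p"
        using X unfolding tendsto_at_iff_sequentially by blast
      then show ?thesis
        by (rule Lim_transform_eventually) (use ev in \<open>rule eventually_mono, simp add: s_def\<close>)
    qed
    have "(\<lambda>n. \<integral>p. s n p \<partial>\<mu>) \<longlonglongrightarrow> (\<integral>p. F' t p \<partial>\<mu>)"
      by (rule integral_dominated_convergence[where w="\<lambda>_. B"])
         (use measurable_mu[OF contF'] measurable_mu[OF cs] integrable_continuous[OF continuous_on_const] lim bd in \<open>auto intro!: AE_I2 simp: space_mu\<close>)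
    then show "((\<lambda>h. (G (t + h) - G t) / h) \<circ> X) \<longlonglongrightarrow> (\<integral>p. F' t p \<partial>\<mu>)"
    proof (rule Lim_transform_eventually)
      show "\<forall>\<^sub>F n in sequentially. (\<integral>p. s n p \<partial>\<mu>) = ((\<lambda>h. (G (t + h) - G t) / h) \<circ> X) n"
        using ev
      proof (rule eventually_mono)
        fix n assume n: "\<bar>X n\<bar> \<le> e"
        have "(\<integral>p. s n p \<partial>\<mu>) = (\<integral>p. (F (t + X n) p - F t p) / X n \<partial>\<mu>)" using n by (simp add: s_def)
        also have "\<dots> = (G (t + X n) - G t) / X n"
          unfolding G_def using integrable_continuous[OF cont[OF inI[OF n]]] integrable_continuous[OF cont[OF t]] by simp
        finally show "(\<integral>p. s n p \<partial>\<mu>) = ((\<lambda>h. (G (t + h) - G t) / h) \<circ> X) n" by simp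
      qed
    qed
  qed
  then show ?thesis unfolding DERIV_def G_def by simp
qed

end

section \<open>Entropy along the flow\<close>

context riemannian_chart
begin

lemma grad_cong:
  assumes "chart_Ck c 1 h" "\<And>q. q \<in> dom c \<Longrightarrow> h q = h' q" "p \<in> dom c"
  shows "grad g h c p = grad g h' c p"
  using partial_cong[OF assms] by (simp add: grad_def)

lemma lap_cong:
  assumes h: "chart_Ck c 2 h" and e: "\<And>q. q \<in> dom c \<Longrightarrow> h q = h' q" and p: "p \<in> dom c"
  shows "lap g c h p = lap g c h' p"
proof -
  have h1: "chart_Ck c 1 h" using h chart_Ck_le by fastforce
  have "chart_Ck c 1 (\<lambda>q. grad g h c q $ i)" for i
    using chart_Ck_grad[of 1 h i] h by (simp add: numeral_2_eq_2)
  then have "partial c i (\<lambda>q. grad g h c q $ i) p = partial c i (\<lambda>q. grad g h' c q $ i) p" for i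
    by (rule partial_cong) (use grad_cong[OF h1 e] p in auto)
  then show ?thesis by (simp add: lap_def grad_cong[OF h1 e p])
qed

lemma metric_grad: "p \<in> dom c \<Longrightarrow> g c p *v grad g h c p = (\<chi> i. partial c i h p)"
  by (simp add: vec_eq_iff matrix_vector_mult_def partial_grad_inverse)

lemma grad_metric_grad:
  "p \<in> dom c \<Longrightarrow> grad g a c p \<bullet> (g c p *v grad g b c p) = grad_inner g c a b p"
  unfolding metric_grad grad_inner_commute[of p a b]
  by (simp add: metric_grad inner_vec_def grad_inner_def mult.commute)

end

context weighted_manifold
begin

section \<open>Product and chain rules for gradient products\<close>

lemma rinner_grad: "p \<in> M \<Longrightarrow> rinner A g (grad g a) (grad g b) p = ginner a b p"
  unfolding rinner_def tensor_eval_def ginner_def Let_def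
  using riemannian_chart.grad_metric_grad[OF chart] chart_at by blast

lemma ginner_commute: "p \<in> M \<Longrightarrow> ginner a b p = ginner b a p"
  unfolding ginner_def using riemannian_chart.grad_inner_commute[OF chart] chart_at by blast

lemma ginner_cong:
  assumes "Ck_function A 1 a" "\<And>q. q \<in> M \<Longrightarrow> a q = a' q" "p \<in> M"
  shows "ginner a b p = ginner a' b p"
proof -
  define c where "c = chart_at A p"
  have c: "c \<in> A" "p \<in> dom c" using chart_at[OF assms(3)] by (auto simp: c_def)
  have a: "chart_Ck c 1 a" using assms(1) c by (simp add: Ck_function_iff)
  have "partial c i a p = partial c i a' p" for i
    by (rule riemannian_chart.partial_cong[OF chart[OF c(1)] a _ c(2)]) (use assms(2) dom_subset[OF c(1)] in blast)
  then show ?thesis by (simp add: ginner_def grad_inner_def c_def[symmetric])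
qed

text \<open>\<open>x\<close> and \<open>y\<close> are numbers attached to the point
  \<open>p\<close>, which covers sums, products and compositions at once.\<close>

lemma ginner_partial:
  assumes "p \<in> M" "\<And>i. partial (chart_at A p) i a p = x * partial (chart_at A p) i a1 p + y * partial (chart_at A p) i a2 p"
  shows "ginner a b p = x * ginner a1 b p + y * ginner a2 b p"
  unfolding ginner_def grad_inner_def assms(2)
  by (simp add: distrib_right sum.distrib sum_distrib_left mult.assoc)

lemma chart_Ck_chart_at: "Ck_function A k h \<Longrightarrow> p \<in> M \<Longrightarrow> chart_Ck (chart_at A p) k h"
  using chart_at by (auto simp: Ck_function_iff)

lemma ginner_mult:
  assumes a: "Ck_function A 1 a" and b: "Ck_function A 1 b" and p: "p \<in> M"
  shows "ginner (\<lambda>q. a q * b q) h p = b p * ginner a h p + a p * ginner b h p"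
proof -
  interpret C: riemannian_chart "chart_at A p" g using chart chart_at(1)[OF p] by blast
  show ?thesis
    using C.partial_mult[OF chart_Ck_chart_at[OF a p] chart_Ck_chart_at[OF b p] chart_at(2)[OF p]]
    by (intro ginner_partial[OF p]) simp
qed

lemma ginner_add:
  assumes a: "Ck_function A 1 a" and b: "Ck_function A 1 b" and p: "p \<in> M"
  shows "ginner (\<lambda>q. a q + b q) h p = ginner a h p + ginner b h p"
proof -
  interpret C: riemannian_chart "chart_at A p" g using chart chart_at(1)[OF p] by blast
  show ?thesis
    using ginner_partial[OF p, of "\<lambda>q. a q + b q" 1 a 1 b h]
      C.partial_add[OF chart_Ck_chart_at[OF a p] chart_Ck_chart_at[OF b p] chart_at(2)[OF p]] by simp
qed

lemma ginner_cmult: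
  assumes a: "Ck_function A 1 a" and p: "p \<in> M"
  shows "ginner (\<lambda>q. x * a q) h p = x * ginner a h p"
proof -
  interpret C: riemannian_chart "chart_at A p" g using chart chart_at(1)[OF p] by blast
  show ?thesis
    using ginner_partial[OF p, of "\<lambda>q. x * a q" x a 0 a h]
      C.partial_cmult[OF chart_Ck_chart_at[OF a p] chart_at(2)[OF p]] by simp
qed

lemma ginner_const: "ginner (\<lambda>q. x) h p = 0"
  unfolding ginner_def grad_inner_def partial_def by (simp add: comp_def frechet_derivative_const)

lemma ginner_ln:
  assumes a: "Ck_function A 1 a" and p: "p \<in> M" and pos: "a p > 0"
  shows "ginner (\<lambda>q. ln (a q)) h p = ginner a h p / a p"
proof -
  interpret C: riemannian_chart "chart_at A p" g using chart chart_at(1)[OF p] by blast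
  show ?thesis
    using ginner_partial[OF p, of "\<lambda>q. ln (a q)" "1 / a p" a 0 a h]
      C.partial_ln[OF chart_Ck_chart_at[OF a p] chart_at(2)[OF p] pos] by simp
qed

lemma Ck_function_ln: "Ck_function A k a \<Longrightarrow> (\<And>p. p \<in> M \<Longrightarrow> a p > 0) \<Longrightarrow> Ck_function A k (\<lambda>p. ln (a p))"
  unfolding Ck_function_iff using riemannian_chart.chart_Ck_ln[OF chart] dom_subset by blast

lemma Ck_function_cmult: "Ck_function A k a \<Longrightarrow> Ck_function A k (\<lambda>p. x * a p)"
  using Ck_function_mult[OF Ck_function_const] by blast

text \<open>The product rule for the divergence; it brings the continuity equation into a form with
  scalar operators only.\<close>

lemma nabla_mu_adj_grad:
  assumes r: "Ck_function A 1 r" and h: "Ck_function A 2 h" and p: "p \<in> M"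
  shows "nabla_mu_adj A g f (\<lambda>x q. r q *\<^sub>R grad g h x q) p = - (r p * wlap h p + ginner r h p)"
proof -
  define c where "c = chart_at A p"
  have c: "c \<in> A" "p \<in> dom c" using chart_at[OF p] by (auto simp: c_def)
  interpret C: riemannian_chart c g using chart c by blast
  have rc: "chart_Ck c 1 r" and hc: "chart_Ck c 2 h" using r h c by (auto simp: Ck_function_iff)
  have X: "chart_Ck c 1 (\<lambda>q. grad g h c q $ i)" for i
    using C.chart_Ck_grad[of 1 h i] hc by (simp add: numeral_2_eq_2)
  have "rinner A g (grad g f) (\<lambda>x q. r q *\<^sub>R grad g h x q) p = r p * ginner f h p"
    unfolding rinner_def tensor_eval_def Let_def c_def[symmetric] ginner_def C.grad_metric_grad[OF c(2), symmetric]
    by (simp add: matrix_vector_mult_scaleR)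
  moreover have "divergence A g (\<lambda>x q. r q *\<^sub>R grad g h x q) p = r p * lap g c h p + grad_inner g c r h p"
    unfolding divergence_def Let_def c_def[symmetric] lap_def grad_inner_def
    by (simp add: C.partial_mult[OF rc X c(2)] sum.distrib sum_distrib_left algebra_simps)
  ultimately show ?thesis
    by (simp add: nabla_mu_adj_def wlap_def wlap_in_def ginner_def c_def algebra_simps)
qed

lemma tensor_norm2_nonneg:
  assumes "p \<in> M" shows "tensor_norm2 A g S p \<ge> 0"
proof -
  interpret C: riemannian_chart "chart_at A p" g using chart chart_at(1)[OF assms] by blast
  show ?thesis unfolding tensor_norm2_def Let_def
    by (rule posdef_double_contraction_nonneg[OF C.metric_sym C.metric_pos]) (use chart_at(2)[OF assms] in auto)
qed

text \<open>The cross term is the trace of the Hessian, the unweighted Laplacian, which exceeds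
  \<open>wlap h\<close> by the drift.\<close>

lemma tensor_norm2_Hess_shift:
  assumes h: "Ck_function A 2 h" and p: "p \<in> M"
  shows "tensor_norm2 A g (\<lambda>x q. Hess g h x q - a *\<^sub>R g x q) p
    = tensor_norm2 A g (Hess g h) p - 2 * a * (wlap h p + ginner f h p) + a\<^sup>2 * real CARD('n)"
proof -
  define c where "c = chart_at A p"
  have c: "c \<in> A" "p \<in> dom c" using chart_at[OF p] by (auto simp: c_def)
  interpret C: riemannian_chart c g using chart c by blast
  have hc: "chart_Ck c 2 h" using h c by (auto simp: Ck_function_iff)
  show ?thesis
    unfolding tensor_norm2_def Let_def c_def[symmetric]
    using C.tensor_square_shift[OF c(2) C.Hess_sym[OF hc c(2)], of a]
    unfolding C.lap_eq_trace_Hess[OF hc c(2), symmetric]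
    by (simp add: wlap_def wlap_in_def ginner_def c_def)
qed

text \<open>All tensors are read in the chart \<open>chart_at A p\<close>. The functions that are
  differentiated must first be rewritten in this one chart on its whole domain, which chart
  independence permits.\<close>

lemma weighted_bochner_global:
  assumes h: "Ck_function A 3 h" and p: "p \<in> M"
  shows "wlap (\<lambda>q. ginner h h q / 2) p - ginner h (wlap h) p
    = tensor_norm2 A g (Hess g h) p + tensor_eval A (Ric g) (grad g h) (grad g h) p
      + tensor_eval A (Hess g f) (grad g h) (grad g h) p"
proof -
  define c where "c = chart_at A p"
  have c: "c \<in> A" "p \<in> dom c" using chart_at[OF p] by (auto simp: c_def)
  interpret C: riemannian_chart c g using chart c by blast
  have hc: "chart_Ck c 3 h" and fc: "chart_Ck c 2 f" using h f_C2 c by (auto simp: Ck_function_iff)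
  have h1: "Ck_function A 1 h" and h2: "Ck_function A 2 h" using Ck_function_le[OF h] by auto
  have Q2: "Ck_function A 2 (\<lambda>q. ginner h h q / 2)"
    using Ck_function_divide[OF Ck_function_ginner Ck_function_const, of 2 h h 2] h by simp
  then have Qc: "chart_Ck c 2 (\<lambda>q. ginner h h q / 2)" "chart_Ck c 1 (\<lambda>q. ginner h h q / 2)"
    using c C.chart_Ck_le[of 2 _ 1] by (auto simp: Ck_function_iff)
  have w1: "Ck_function A 1 (wlap h)"
    using Ck_function_wlap[of 1 h] h f_C2 by (simp add: numeral_3_eq_3 numeral_2_eq_2)
  have eQ: "ginner h h q / 2 = grad_inner g c h h q / 2" if "q \<in> dom c" for q
    using ginner_eq[OF c(1) that h1 h1] by simp
  have ew: "wlap h q = lap g c h q - grad_inner g c f h q" if "q \<in> dom c" for q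
    using wlap_eq[OF c(1) that h2] by (simp add: wlap_in_def)
  have "wlap (\<lambda>q. ginner h h q / 2) p = lap g c (\<lambda>q. grad_inner g c h h q / 2) p - grad_inner g c f (\<lambda>q. grad_inner g c h h q / 2) p"
    unfolding wlap_eq[OF c Q2] wlap_in_def grad_inner_def[of _ _ f]
    using C.lap_cong[OF Qc(1) eQ c(2)] C.grad_cong[OF Qc(2) eQ c(2)] by simp
  moreover have "ginner h (wlap h) p = grad_inner g c h (\<lambda>q. lap g c h q - grad_inner g c f h q) p"
    unfolding ginner_eq[OF c h1 w1] grad_inner_def[of _ _ h]
    using C.grad_cong[OF _ ew c(2)] w1 c by (simp add: Ck_function_iff del: One_nat_def)
  ultimately show ?thesis
    unfolding tensor_norm2_def tensor_eval_def Let_def c_def[symmetric]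
    using C.weighted_bochner[OF hc fc c(2)] by simp
qed

text \<open>For $m = n$ the quotient is \<open>0\<close> because of \<open>x / 0 = 0\<close>, which matches the convention for $\mathrm{Ric}_{n,n}$.\<close>

lemma tensor_eval_Ric_mn:
  assumes f: "m = real CARD('n) \<Longrightarrow> \<exists>k. \<forall>p\<in>M. f p = k" and p: "p \<in> M"
  shows "tensor_eval A (Ric_mn m g f) (grad g h) (grad g h) p
    = tensor_eval A (Ric g) (grad g h) (grad g h) p + tensor_eval A (Hess g f) (grad g h) (grad g h) p
      - (ginner h f p)\<^sup>2 / (m - real CARD('n))"
    and "m = real CARD('n) \<Longrightarrow> ginner h f p = 0"
proof -
  define c where "c = chart_at A p"
  have c: "c \<in> A" "p \<in> dom c" using chart_at[OF p] by (auto simp: c_def)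
  interpret C: riemannian_chart c g using chart c by blast
  define X where "X = grad g h c p"
  have G: "ginner h f p = (\<Sum>i\<in>UNIV. partial c i f p * X $ i)"
    unfolding ginner_commute[OF p, of h] by (simp add: ginner_def grad_inner_def c_def X_def)
  have df: "partial c i f q = 0" if m: "m = real CARD('n)" and q: "q \<in> dom c" for i q
  proof -
    obtain k where k: "\<forall>p\<in>M. f p = k" using f[OF m] by blast
    have "chart_Ck c 1 f" using f_C1 c by (auto simp: Ck_function_iff)
    then have "partial c i f q = partial c i (\<lambda>_. k) q"
      by (rule C.partial_cong) (use k dom_subset[OF c(1)] q in auto)
    then show ?thesis by simp
  qed
  show G0: "ginner h f p = 0" if "m = real CARD('n)" using df[OF that c(2)] G by simp
  show "tensor_eval A (Ric_mn m g f) (grad g h) (grad g h) p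
    = tensor_eval A (Ric g) (grad g h) (grad g h) p + tensor_eval A (Hess g f) (grad g h) (grad g h) p
      - (ginner h f p)\<^sup>2 / (m - real CARD('n))"
  proof (cases "m = real CARD('n)")
    case True
    have "partial c i (partial c j f) p = 0" for i j
    proof -
      have "chart_Ck c 1 (partial c j f)"
        using C.chart_Ck_partial[of 1 f j] f_C2 c by (auto simp: Ck_function_iff numeral_2_eq_2)
      then have "partial c i (partial c j f) p = partial c i (\<lambda>_. 0) p"
        by (rule C.partial_cong) (use df[OF True] c in auto)
      then show ?thesis by simp
    qed
    then have "Hess g f c p = 0" using df[OF True c(2)] by (simp add: Hess_def vec_eq_iff)
    then show ?thesis using G0[OF True] True
      by (simp add: tensor_eval_def Ric_mn_def Let_def c_def[symmetric])
  next
    case False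
    have "X \<bullet> ((\<chi> i j. partial c i f p * partial c j f p / (m - real CARD('n))) *v X) = (ginner h f p)\<^sup>2 / (m - real CARD('n))"
      unfolding G power2_eq_square sum_product inner_vec_def matrix_vector_mult_def
      by (simp add: sum_distrib_left sum_divide_distrib mult_ac)
    then show ?thesis using False
      by (simp add: tensor_eval_def Ric_mn_def Let_def c_def[symmetric] X_def[symmetric]
          matrix_vector_mult_add_rdistrib matrix_vector_mult_diff_rdistrib inner_add_right inner_diff_right)
  qed
qed

end

text \<open>\<open>\<epsilon>\<close> is the square of the constant of the theorem, as
  \<open>c\<close> denotes charts here. The flow equations are stated through \<open>wlap\<close>
  and \<open>ginner\<close>.\<close>

locale entropy_flow = weighted_manifold M A g \<nu> f
  for M :: "'a::t2_space set" and A :: "('a, 'n::finite) chart set" and g \<nu> f +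
  fixes I :: "real set" and \<rho> \<phi> :: "real \<Rightarrow> 'a \<Rightarrow> real" and \<epsilon> :: real
  assumes I: "open I"
    and rho_smooth: "smooth_spacetime A I \<rho>"
    and phi_smooth: "smooth_spacetime A I \<phi>"
    and rho_pos: "\<And>t p. t \<in> I \<Longrightarrow> p \<in> M \<Longrightarrow> \<rho> t p > 0"
    and eps: "\<epsilon> > 0"
    and continuity: "\<And>t p. t \<in> I \<Longrightarrow> p \<in> M \<Longrightarrow>
          time_deriv \<rho> t p = - (\<rho> t p * wlap (\<phi> t) p + ginner (\<rho> t) (\<phi> t) p)"
    and potential: "\<And>t p. t \<in> I \<Longrightarrow> p \<in> M \<Longrightarrow>
          \<epsilon> * (time_deriv \<phi> t p + 1/2 * ginner (\<phi> t) (\<phi> t) p) = - \<phi> t p - ln (\<rho> t p) - 1"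
begin

context
  fixes t assumes t: "t \<in> I"
begin

section \<open>Regularity of the flow and the first derivative of the entropy\<close>

lemma rho_Ck: "Ck_function A k (\<rho> t)" and phi_Ck: "Ck_function A k (\<phi> t)"
  and rho_t_Ck: "Ck_function A k (time_deriv \<rho> t)" and phi_t_Ck: "Ck_function A k (time_deriv \<phi> t)"
  using Ck_function_slice[OF I _ t] rho_smooth phi_smooth smooth_time_deriv[OF I] by blast+

lemma wlap_phi_C1: "Ck_function A 1 (wlap (\<phi> t))"
  using Ck_function_wlap[OF phi_Ck, of 1] f_C2 by (simp add: numeral_2_eq_2)

lemma ln_rho_Ck: "Ck_function A k (\<lambda>p. ln (\<rho> t p))"
  using Ck_function_ln[OF rho_Ck] rho_pos[OF t] by blast

lemmas flow_continuous =
  continuous_on_Ck[OF rho_Ck] continuous_on_Ck[OF phi_Ck] continuous_on_Ck[OF rho_t_Ck] continuous_on_Ck[OF phi_t_Ck]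
  continuous_on_Ck[OF wlap_phi_C1]

text \<open>The weak form of the continuity equation: Green's formula with \<open>\<psi>\<close>
  times the density as test function, where the product rule cancels the term with the gradient of
  the density. It is used with the logarithm of the density plus 1, and with L phi.\<close>

lemma integral_rho_t:
  assumes \<psi>: "Ck_function A 1 \<psi>"
  shows "(\<integral>p. \<psi> p * time_deriv \<rho> t p \<partial>\<mu>) = (\<integral>p. \<rho> t p * ginner \<psi> (\<phi> t) p \<partial>\<mu>)"
proof -
  have c1: "continuous_on M (\<lambda>p. \<psi> p * \<rho> t p * wlap (\<phi> t) p)"
    by (intro continuous_intros continuous_on_Ck[OF \<psi>] flow_continuous)
  have c2: "continuous_on M (\<lambda>p. \<psi> p * ginner (\<rho> t) (\<phi> t) p)"
    by (intro continuous_intros continuous_on_Ck[OF \<psi>] continuous_on_Ck[OF Ck_function_ginner[OF rho_Ck phi_Ck]])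
  have c3: "continuous_on M (\<lambda>p. \<rho> t p * ginner \<psi> (\<phi> t) p)"
    using \<psi> by (intro continuous_intros flow_continuous continuous_on_Ck[OF Ck_function_ginner[where k=0, OF _ phi_Ck]]) simp
  have "(\<integral>p. \<psi> p * time_deriv \<rho> t p \<partial>\<mu>) = (\<integral>p. - (\<psi> p * \<rho> t p * wlap (\<phi> t) p) - \<psi> p * ginner (\<rho> t) (\<phi> t) p \<partial>\<mu>)"
    by (rule integral_mu_cong) (simp add: continuity[OF t] algebra_simps)
  also have "\<dots> = - (\<integral>p. \<psi> p * \<rho> t p * wlap (\<phi> t) p \<partial>\<mu>) - (\<integral>p. \<psi> p * ginner (\<rho> t) (\<phi> t) p \<partial>\<mu>)"
    using integrable_continuous[OF c1] integrable_continuous[OF c2] by simp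
  also have "- (\<integral>p. \<psi> p * \<rho> t p * wlap (\<phi> t) p \<partial>\<mu>) = (\<integral>p. ginner (\<lambda>p. \<psi> p * \<rho> t p) (\<phi> t) p \<partial>\<mu>)"
    by (rule green[symmetric]) (intro Ck_function_mult \<psi> rho_Ck, rule phi_Ck)
  also have "\<dots> = (\<integral>p. \<rho> t p * ginner \<psi> (\<phi> t) p + \<psi> p * ginner (\<rho> t) (\<phi> t) p \<partial>\<mu>)"
    by (rule integral_mu_cong) (simp add: ginner_mult[OF \<psi> rho_Ck])
  also have "\<dots> = (\<integral>p. \<rho> t p * ginner \<psi> (\<phi> t) p \<partial>\<mu>) + (\<integral>p. \<psi> p * ginner (\<rho> t) (\<phi> t) p \<partial>\<mu>)"
    using integrable_continuous[OF c2] integrable_continuous[OF c3] by simp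
  finally show ?thesis by simp
qed

text \<open>The derivative of x ln x is ln x + 1. As a test function it has the gradient of the
  density divided by the density, which cancels the factor in front.\<close>

lemma entropy_deriv:
  "((\<lambda>s. Ent \<mu> (\<rho> s)) has_real_derivative (\<integral>p. ginner (\<rho> t) (\<phi> t) p \<partial>\<mu>)) (at t)"
proof -
  have cr: "continuous_on (M \<times> I) (\<lambda>x. \<rho> (snd x) (fst x))" "continuous_on (M \<times> I) (\<lambda>x. time_deriv \<rho> (snd x) (fst x))"
    using continuous_on_spacetime[OF I rho_smooth] continuous_on_spacetime[OF I smooth_time_deriv[OF I rho_smooth]] by auto
  have "((\<lambda>s. \<integral>p. \<rho> s p * ln (\<rho> s p) \<partial>\<mu>) has_real_derivative
       (\<integral>p. (ln (\<rho> t p) + 1) * time_deriv \<rho> t p \<partial>\<mu>)) (at t)"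
  proof (rule integral_has_time_deriv[OF I t])
    fix s p assume s: "s \<in> I" "p \<in> M"
    show "((\<lambda>s. \<rho> s p * ln (\<rho> s p)) has_real_derivative (ln (\<rho> s p) + 1) * time_deriv \<rho> s p) (at s)"
      using has_time_deriv[OF I rho_smooth s(2,1)] rho_pos[OF s]
      by (auto intro!: derivative_eq_intros simp: field_simps)
  next
    fix s assume s: "s \<in> I"
    have nz: "\<forall>p\<in>M. \<rho> s p \<noteq> 0" using rho_pos[OF s] by fastforce
    show "continuous_on M (\<lambda>p. \<rho> s p * ln (\<rho> s p))"
      by (intro continuous_intros continuous_on_Ck[OF Ck_function_slice[OF I rho_smooth s]] nz)
  next
    have nz: "\<forall>x\<in>M \<times> I. \<rho> (snd x) (fst x) \<noteq> 0" using rho_pos by fastforce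
    show "continuous_on (M \<times> I) (\<lambda>x. (ln (\<rho> (snd x) (fst x)) + 1) * time_deriv \<rho> (snd x) (fst x))"
      by (intro continuous_intros cr nz)
  qed
  also have "(\<integral>p. (ln (\<rho> t p) + 1) * time_deriv \<rho> t p \<partial>\<mu>) = (\<integral>p. \<rho> t p * ginner (\<lambda>p. ln (\<rho> t p) + 1) (\<phi> t) p \<partial>\<mu>)"
    by (rule integral_rho_t) (intro Ck_function_add ln_rho_Ck Ck_function_const)
  also have "\<dots> = (\<integral>p. ginner (\<rho> t) (\<phi> t) p \<partial>\<mu>)"
  proof (rule integral_mu_cong)
    fix p assume p: "p \<in> M"
    show "\<rho> t p * ginner (\<lambda>p. ln (\<rho> t p) + 1) (\<phi> t) p = ginner (\<rho> t) (\<phi> t) p"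
      using rho_pos[OF t p] by (simp add: ginner_add[OF ln_rho_Ck Ck_function_const p] ginner_const ginner_ln[OF rho_Ck p])
  qed
  finally show ?thesis by (simp add: Ent_def)
qed

lemma entropy_deriv_green:
  "(\<integral>p. ginner (\<rho> t) (\<phi> t) p \<partial>\<mu>) = - (\<integral>p. \<rho> t p * wlap (\<phi> t) p \<partial>\<mu>)"
  by (rule green[OF rho_Ck phi_Ck])

lemma half_grad_square_C2: "Ck_function A 2 (\<lambda>q. ginner (\<phi> t) (\<phi> t) q / 2)"
  using Ck_function_divide[OF Ck_function_ginner[OF phi_Ck phi_Ck] Ck_function_const, of 2 2] by simp

lemma continuous_on_wlap_half_grad_square: "continuous_on M (wlap (\<lambda>q. ginner (\<phi> t) (\<phi> t) q / 2))"
proof -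
  have "Ck_function A (Suc (Suc 0)) (\<lambda>q. ginner (\<phi> t) (\<phi> t) q / 2)" "Ck_function A (Suc 0) f"
    using half_grad_square_C2 f_C1 by (simp_all add: numeral_2_eq_2)
  from continuous_on_Ck[OF Ck_function_wlap[OF this]] show ?thesis .
qed

lemma continuous_on_ginner: "Ck_function A 1 a \<Longrightarrow> Ck_function A 1 b \<Longrightarrow> continuous_on M (ginner a b)"
  using continuous_on_Ck[OF Ck_function_ginner[of 0]] by simp

lemma continuous_on_bochner_term:
  "continuous_on M (\<lambda>p. wlap (\<lambda>q. ginner (\<phi> t) (\<phi> t) q / 2) p - ginner (\<phi> t) (wlap (\<phi> t)) p)"
  by (intro continuous_intros continuous_on_wlap_half_grad_square continuous_on_ginner phi_Ck wlap_phi_C1)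

text \<open>The potential equation is solved for the time derivative of phi and differentiated in
  space; its logarithm produces the integrand of the Fisher information.\<close>

lemma ginner_rho_phi_t:
  assumes p: "p \<in> M"
  shows "ginner (\<rho> t) (time_deriv \<phi> t) p = - ginner (\<rho> t) (\<lambda>q. ginner (\<phi> t) (\<phi> t) q / 2) p
      - 1 / \<epsilon> * (ginner (\<rho> t) (\<phi> t) p + ginner (\<rho> t) (\<rho> t) p / \<rho> t p)"
proof -
  define Q where "Q = (\<lambda>q. ginner (\<phi> t) (\<phi> t) q / 2)"
  have Q1: "Ck_function A 1 Q" unfolding Q_def using half_grad_square_C2 Ck_function_le by fastforce
  define l where "l = (\<lambda>q. ln (\<rho> t q) + 1)"
  have l: "Ck_function A 1 l" unfolding l_def by (intro Ck_function_add ln_rho_Ck Ck_function_const)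
  have pl: "Ck_function A 1 (\<lambda>q. \<phi> t q + l q)" by (intro Ck_function_add phi_Ck l)
  have "time_deriv \<phi> t q = (- 1) * Q q + (- 1 / \<epsilon>) * (\<phi> t q + l q)" if "q \<in> M" for q
    using potential[OF t that] eps by (simp add: Q_def l_def field_simps)
  then have "ginner (time_deriv \<phi> t) (\<rho> t) p = ginner (\<lambda>q. (- 1) * Q q + (- 1 / \<epsilon>) * (\<phi> t q + l q)) (\<rho> t) p"
    by (rule ginner_cong[OF phi_t_Ck _ p])
  also have "\<dots> = (- 1) * ginner Q (\<rho> t) p + (- 1 / \<epsilon>) * (ginner (\<phi> t) (\<rho> t) p + ginner l (\<rho> t) p)"
    using ginner_add[OF Ck_function_cmult[OF Q1] Ck_function_cmult[OF pl] p, of "-1" "-1/\<epsilon>"]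
      ginner_cmult[OF Q1 p, of "-1"] ginner_cmult[OF pl p, of "-1/\<epsilon>"] ginner_add[OF phi_Ck l p] by simp
  also have "ginner l (\<rho> t) p = ginner (\<rho> t) (\<rho> t) p / \<rho> t p"
    unfolding l_def ginner_add[OF ln_rho_Ck Ck_function_const p] ginner_const
    using ginner_ln[OF rho_Ck p rho_pos[OF t p]] by simp
  finally show ?thesis
    unfolding Q_def[symmetric] ginner_commute[OF p, of "time_deriv \<phi> t"] ginner_commute[OF p, of Q] ginner_commute[OF p, of "\<phi> t"]
    by simp
qed

lemma continuous_on_fisher_integrand: "continuous_on M (\<lambda>p. ginner (\<rho> t) (\<rho> t) p / \<rho> t p)"
proof -
  have "\<forall>p\<in>M. \<rho> t p \<noteq> 0" using rho_pos[OF t] by fastforce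
  then show ?thesis by (intro continuous_intros continuous_on_ginner rho_Ck continuous_on_Ck[OF rho_Ck])
qed

lemma entropy_deriv2:
  "((\<lambda>s. \<integral>p. ginner (\<rho> s) (\<phi> s) p \<partial>\<mu>) has_real_derivative
     (\<integral>p. \<rho> t p * (wlap (\<lambda>q. ginner (\<phi> t) (\<phi> t) q / 2) p - ginner (\<phi> t) (wlap (\<phi> t)) p) \<partial>\<mu>)
       - 1 / \<epsilon> * ((\<integral>p. ginner (\<rho> t) (\<phi> t) p \<partial>\<mu>) + (\<integral>p. ginner (\<rho> t) (\<rho> t) p / \<rho> t p \<partial>\<mu>))) (at t)"
proof -
  define Q where "Q = (\<lambda>q. ginner (\<phi> t) (\<phi> t) q / 2)"
  have Q2: "Ck_function A 2 Q" unfolding Q_def by (rule half_grad_square_C2)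
  have Q1: "Ck_function A 1 Q" using Q2 Ck_function_le by fastforce
  have "((\<lambda>s. \<integral>p. ginner (\<rho> s) (\<phi> s) p \<partial>\<mu>) has_real_derivative
     (\<integral>p. ginner (time_deriv \<rho> t) (\<phi> t) p + ginner (\<rho> t) (time_deriv \<phi> t) p \<partial>\<mu>)) (at t)"
  proof (rule integral_has_time_deriv[OF I t])
    show "((\<lambda>s. ginner (\<rho> s) (\<phi> s) p) has_real_derivative
       ginner (time_deriv \<rho> s) (\<phi> s) p + ginner (\<rho> s) (time_deriv \<phi> s) p) (at s)" if "s \<in> I" "p \<in> M" for s p
      by (rule ginner_has_time_deriv[OF I rho_smooth phi_smooth that(2,1)])
    show "continuous_on M (ginner (\<rho> s) (\<phi> s))" if "s \<in> I" for s
      by (intro continuous_on_ginner Ck_function_slice[OF I _ that] rho_smooth phi_smooth)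
    show "continuous_on (M \<times> I) (\<lambda>x. ginner (time_deriv \<rho> (snd x)) (\<phi> (snd x)) (fst x)
        + ginner (\<rho> (snd x)) (time_deriv \<phi> (snd x)) (fst x))"
      by (intro continuous_on_add continuous_on_ginner_spacetime[OF I] smooth_time_deriv[OF I] rho_smooth phi_smooth)
  qed
  also have "(\<integral>p. ginner (time_deriv \<rho> t) (\<phi> t) p + ginner (\<rho> t) (time_deriv \<phi> t) p \<partial>\<mu>)
     = (\<integral>p. ginner (time_deriv \<rho> t) (\<phi> t) p \<partial>\<mu>) + (\<integral>p. ginner (\<rho> t) (time_deriv \<phi> t) p \<partial>\<mu>)"
    by (intro Bochner_Integration.integral_add integrable_continuous continuous_on_ginner rho_t_Ck phi_t_Ck rho_Ck phi_Ck)
  \<comment> \<open>Green's formula moves the gradient onto \<open>\<phi> t\<close>; the weak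
    continuity equation is then applied with \<open>wlap (\<phi> t)\<close> as test
    function.\<close>
  also have "(\<integral>p. ginner (time_deriv \<rho> t) (\<phi> t) p \<partial>\<mu>) = - (\<integral>p. \<rho> t p * ginner (\<phi> t) (wlap (\<phi> t)) p \<partial>\<mu>)"
  proof -
    have "(\<integral>p. ginner (time_deriv \<rho> t) (\<phi> t) p \<partial>\<mu>) = - (\<integral>p. wlap (\<phi> t) p * time_deriv \<rho> t p \<partial>\<mu>)"
      unfolding green[OF rho_t_Ck phi_Ck] by (simp add: mult.commute)
    also have "\<dots> = - (\<integral>p. \<rho> t p * ginner (\<phi> t) (wlap (\<phi> t)) p \<partial>\<mu>)"
      unfolding integral_rho_t[OF wlap_phi_C1]
      by (rule arg_cong[of _ _ uminus], rule integral_mu_cong) (simp add: ginner_commute[of _ "wlap (\<phi> t)" "\<phi> t"])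
    finally show ?thesis .
  qed
  \<comment> \<open>Here Green's formula is used in the other direction, leaving the density
    undifferentiated next to the operator applied to \<open>Q\<close>.\<close>
  also have "(\<integral>p. ginner (\<rho> t) (time_deriv \<phi> t) p \<partial>\<mu>) = (\<integral>p. \<rho> t p * wlap Q p \<partial>\<mu>)
     - 1 / \<epsilon> * ((\<integral>p. ginner (\<rho> t) (\<phi> t) p \<partial>\<mu>) + (\<integral>p. ginner (\<rho> t) (\<rho> t) p / \<rho> t p \<partial>\<mu>))"
  proof -
    have "(\<integral>p. ginner (\<rho> t) (time_deriv \<phi> t) p \<partial>\<mu>) =
       (\<integral>p. - ginner (\<rho> t) Q p - 1 / \<epsilon> * (ginner (\<rho> t) (\<phi> t) p + ginner (\<rho> t) (\<rho> t) p / \<rho> t p) \<partial>\<mu>)"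
      unfolding Q_def by (rule integral_mu_cong[OF ginner_rho_phi_t])
    also have "\<dots> = - (\<integral>p. ginner (\<rho> t) Q p \<partial>\<mu>) - 1 / \<epsilon> * ((\<integral>p. ginner (\<rho> t) (\<phi> t) p \<partial>\<mu>) + (\<integral>p. ginner (\<rho> t) (\<rho> t) p / \<rho> t p \<partial>\<mu>))"
      using integrable_continuous[OF continuous_on_ginner[OF rho_Ck Q1]] integrable_continuous[OF continuous_on_ginner[OF rho_Ck phi_Ck]]
        integrable_continuous[OF continuous_on_fisher_integrand] by simp
    finally show ?thesis unfolding green[OF rho_Ck Q2] by simp
  qed
  also have "- (\<integral>p. \<rho> t p * ginner (\<phi> t) (wlap (\<phi> t)) p \<partial>\<mu>) + ((\<integral>p. \<rho> t p * wlap Q p \<partial>\<mu>)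
     - 1 / \<epsilon> * ((\<integral>p. ginner (\<rho> t) (\<phi> t) p \<partial>\<mu>) + (\<integral>p. ginner (\<rho> t) (\<rho> t) p / \<rho> t p \<partial>\<mu>)))
     = (\<integral>p. \<rho> t p * (wlap Q p - ginner (\<phi> t) (wlap (\<phi> t)) p) \<partial>\<mu>)
     - 1 / \<epsilon> * ((\<integral>p. ginner (\<rho> t) (\<phi> t) p \<partial>\<mu>) + (\<integral>p. ginner (\<rho> t) (\<rho> t) p / \<rho> t p \<partial>\<mu>))"
  proof -
    have "continuous_on M (\<lambda>p. \<rho> t p * wlap Q p)" "continuous_on M (\<lambda>p. \<rho> t p * ginner (\<phi> t) (wlap (\<phi> t)) p)"
      using continuous_on_wlap_half_grad_square continuous_on_Ck[OF rho_Ck] continuous_on_ginner[OF phi_Ck wlap_phi_C1]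
      by (auto simp: Q_def intro: continuous_on_mult)
    then show ?thesis using integrable_continuous by (simp add: right_diff_distrib)
  qed
  finally show ?thesis by (simp add: Q_def)
qed

lemma entropy_rhs:
  assumes f: "m = real CARD('n) \<Longrightarrow> \<exists>k. \<forall>p\<in>M. f p = k" and prob: "(\<integral>p. \<rho> t p \<partial>\<mu>) = 1"
  shows "(\<integral>p. (tensor_norm2 A g (\<lambda>x q. Hess g (\<phi> t) x q - a *\<^sub>R g x q) p
              + tensor_eval A (Ric_mn m g f) (grad g (\<phi> t)) (grad g (\<phi> t)) p) * \<rho> t p \<partial>\<mu>)
          + (m - real CARD('n)) * (\<integral>p. \<bar>a + ginner (\<phi> t) f p / (m - real CARD('n))\<bar>\<^sup>2 * \<rho> t p \<partial>\<mu>)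
       = (\<integral>p. \<rho> t p * (wlap (\<lambda>q. ginner (\<phi> t) (\<phi> t) q / 2) p - ginner (\<phi> t) (wlap (\<phi> t)) p) \<partial>\<mu>)
          + 2 * a * (\<integral>p. ginner (\<rho> t) (\<phi> t) p \<partial>\<mu>) + m * a\<^sup>2"
proof -
  let ?n = "real CARD('n)"
  define G where "G = ginner (\<phi> t) f"
  define W where "W = wlap (\<phi> t)"
  define B where "B = (\<lambda>p. wlap (\<lambda>q. ginner (\<phi> t) (\<phi> t) q / 2) p - ginner (\<phi> t) (wlap (\<phi> t)) p)"
  have cG: "continuous_on M G" unfolding G_def by (intro continuous_on_ginner phi_Ck f_C1)
  have cW: "continuous_on M W" unfolding W_def by (rule continuous_on_Ck[OF wlap_phi_C1])
  have cB: "continuous_on M B" unfolding B_def by (rule continuous_on_bochner_term)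
  have cr: "continuous_on M (\<rho> t)" by (rule continuous_on_Ck[OF rho_Ck])
  \<comment> \<open>After the Bochner formula the integrand consists of continuous scalar functions,
    which makes its integrability visible.\<close>
  define J1 where "J1 = (\<lambda>p. (B p - 2 * a * (W p + G p) + a\<^sup>2 * ?n - (G p)\<^sup>2 / (m - ?n)) * \<rho> t p)"
  define J2 where "J2 = (\<lambda>p. (a + G p / (m - ?n))\<^sup>2 * \<rho> t p)"
  have cJ1: "continuous_on M J1" unfolding J1_def divide_inverse by (intro continuous_intros cG cW cB cr)
  have cJ2: "continuous_on M J2" unfolding J2_def divide_inverse by (intro continuous_intros cG cr)
  have 1: "(\<integral>p. (tensor_norm2 A g (\<lambda>x q. Hess g (\<phi> t) x q - a *\<^sub>R g x q) p
              + tensor_eval A (Ric_mn m g f) (grad g (\<phi> t)) (grad g (\<phi> t)) p) * \<rho> t p \<partial>\<mu>) = (\<integral>p. J1 p \<partial>\<mu>)"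
  proof (rule integral_mu_cong)
    fix p assume p: "p \<in> M"
    have te: "tensor_eval A (Ric_mn m g f) (grad g (\<phi> t)) (grad g (\<phi> t)) p
      = tensor_eval A (Ric g) (grad g (\<phi> t)) (grad g (\<phi> t)) p + tensor_eval A (Hess g f) (grad g (\<phi> t)) (grad g (\<phi> t)) p
      - (ginner (\<phi> t) f p)\<^sup>2 / (m - real CARD('n))"
      by (rule tensor_eval_Ric_mn(1)[OF _ p]) (rule f)
    show "(tensor_norm2 A g (\<lambda>x q. Hess g (\<phi> t) x q - a *\<^sub>R g x q) p
              + tensor_eval A (Ric_mn m g f) (grad g (\<phi> t)) (grad g (\<phi> t)) p) * \<rho> t p = J1 p"
      unfolding J1_def tensor_norm2_Hess_shift[OF phi_Ck p] te B_def weighted_bochner_global[OF phi_Ck p]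
        ginner_commute[OF p, of f] W_def G_def
      by simp
  qed
  have "(\<integral>p. J1 p \<partial>\<mu>) + (m - ?n) * (\<integral>p. J2 p \<partial>\<mu>) = (\<integral>p. J1 p + (m - ?n) * J2 p \<partial>\<mu>)"
    using integrable_continuous[OF cJ1] integrable_continuous[OF cJ2] by simp
  also have "\<dots> = (\<integral>p. \<rho> t p * B p - 2 * a * (\<rho> t p * W p) + m * a\<^sup>2 * \<rho> t p \<partial>\<mu>)"
  proof (rule integral_mu_cong)
    fix p assume p: "p \<in> M"
    \<comment> \<open>The terms linear and quadratic in \<open>G p\<close> occur with both signs,
      and the coefficients n and m - n add up to m. For m = n the weight is constant, so
      \<open>G p\<close> is 0 and all quotients by 0 vanish with it.\<close>
    have "- (2 * a * G p) + a\<^sup>2 * ?n - (G p)\<^sup>2 / (m - ?n) + (m - ?n) * (a + G p / (m - ?n))\<^sup>2 = m * a\<^sup>2"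
    proof (cases "m = ?n")
      case True
      then show ?thesis using tensor_eval_Ric_mn(2)[OF f p] by (simp add: G_def)
    next
      case False
      have "k * (a + x / k)\<^sup>2 = k * a\<^sup>2 + 2 * a * x + x\<^sup>2 / k" if "k \<noteq> 0" for k x :: real
        using that by (simp add: power2_eq_square field_simps)
      from this[of "m - ?n" "G p"] False show ?thesis by (simp add: algebra_simps)
    qed
    then have "(- (2 * a * G p) + a\<^sup>2 * ?n - (G p)\<^sup>2 / (m - ?n) + (m - ?n) * (a + G p / (m - ?n))\<^sup>2) * \<rho> t p = m * a\<^sup>2 * \<rho> t p" by simp
    then show "J1 p + (m - ?n) * J2 p = \<rho> t p * B p - 2 * a * (\<rho> t p * W p) + m * a\<^sup>2 * \<rho> t p"
      unfolding J1_def J2_def by (simp add: algebra_simps)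
  qed
  also have "\<dots> = (\<integral>p. \<rho> t p * B p \<partial>\<mu>) - 2 * a * (\<integral>p. \<rho> t p * W p \<partial>\<mu>) + m * a\<^sup>2 * (\<integral>p. \<rho> t p \<partial>\<mu>)"
    using integrable_continuous[OF continuous_on_mult[OF cr cB]] integrable_continuous[OF continuous_on_mult[OF cr cW]]
      integrable_continuous[OF cr] by simp
  finally show ?thesis
    unfolding 1 entropy_deriv_green prob by (simp add: J2_def G_def W_def B_def)
qed

end

end

theorem theorem1p8:
  fixes M :: "'a::t2_space set"
    and A :: "('a, 'n::finite) chart set"
    and g :: "('a, 'n) tensor2"
    and \<nu> \<mu> :: "'a measure"
    and f :: "'a \<Rightarrow> real"
    and m c T :: real
    and u \<alpha> :: "real \<Rightarrow> real"
    and \<rho> \<phi> :: "real \<Rightarrow> 'a \<Rightarrow> real"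
  assumes manifold: "compact_riemannian_manifold M A g"
    and volume: "riemannian_volume M A g \<nu>"
    and f_C2: "Ck_function A 2 f"
    and mu: "\<mu> = weighted_measure \<nu> f"
    and m_ge: "m \<ge> real CARD('n)"
    and m_eq: "m = real CARD('n) \<Longrightarrow> \<exists>k. \<forall>p\<in>M. f p = k"
    and c_pos: "c > 0"
    and u_smooth: "smooth_on {0<..<T} u"
    and u_pos: "\<And>t. t \<in> {0<..<T} \<Longrightarrow> u t > 0"
    and u_ode: "\<And>t. t \<in> {0<..<T} \<Longrightarrow> c\<^sup>2 * deriv (deriv u) t + deriv u t = 1 / (2 * u t)"
    and alpha: "\<And>t. t \<in> {0<..<T} \<Longrightarrow> \<alpha> t = deriv u t / u t"
    and rho_smooth: "smooth_spacetime A {0<..<T} \<rho>"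
    and phi_smooth: "smooth_spacetime A {0<..<T} \<phi>"
    and rho_pos: "\<And>t p. t \<in> {0<..<T} \<Longrightarrow> p \<in> M \<Longrightarrow> \<rho> t p > 0"
    and rho_prob: "\<And>t. t \<in> {0<..<T} \<Longrightarrow> (\<integral>p. \<rho> t p \<partial>\<mu>) = 1"
    and continuity_eq: "\<And>t p. t \<in> {0<..<T} \<Longrightarrow> p \<in> M \<Longrightarrow>
          deriv (\<lambda>s. \<rho> s p) t
            - nabla_mu_adj A g f (\<lambda>x q. \<rho> t q *\<^sub>R grad g (\<phi> t) x q) p = 0"
    and potential_eq: "\<And>t p. t \<in> {0<..<T} \<Longrightarrow> p \<in> M \<Longrightarrow>
          c\<^sup>2 * (deriv (\<lambda>s. \<phi> s p) t
                 + 1/2 * rinner A g (grad g (\<phi> t)) (grad g (\<phi> t)) p)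
            = - \<phi> t p - ln (\<rho> t p) - 1"
  shows "(\<forall>t\<in>{0<..<T}.
            (\<lambda>s. Ent \<mu> (\<rho> s)) differentiable (at t) \<and>
            deriv (\<lambda>s. Ent \<mu> (\<rho> s)) differentiable (at t) \<and>
            deriv (deriv (\<lambda>s. Ent \<mu> (\<rho> s))) t
              + (2 * \<alpha> t + 1 / c\<^sup>2) * deriv (\<lambda>s. Ent \<mu> (\<rho> s)) t
              + 1 / c\<^sup>2 * (\<integral>p. rinner A g (grad g (\<rho> t)) (grad g (\<rho> t)) p / \<rho> t p \<partial>\<mu>)
              + m * (\<alpha> t)\<^sup>2
            = (\<integral>p. (tensor_norm2 A g (\<lambda>x q. Hess g (\<phi> t) x q - \<alpha> t *\<^sub>R g x q) p
                     + tensor_eval A (Ric_mn m g f) (grad g (\<phi> t)) (grad g (\<phi> t)) p)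
                    * \<rho> t p \<partial>\<mu>)
              + (m - real CARD('n)) *
                (\<integral>p. \<bar>\<alpha> t + rinner A g (grad g (\<phi> t)) (grad g f) p / (m - real CARD('n))\<bar>\<^sup>2
                    * \<rho> t p \<partial>\<mu>))
       \<and> (tensor_nonneg A (Ric_mn m g f) \<longrightarrow>
          (\<forall>t\<in>{0<..<T}.
            deriv (deriv (\<lambda>s. Ent \<mu> (\<rho> s))) t
              + (2 * \<alpha> t + 1 / c\<^sup>2) * deriv (\<lambda>s. Ent \<mu> (\<rho> s)) t
              + 1 / c\<^sup>2 * (\<integral>p. rinner A g (grad g (\<rho> t)) (grad g (\<rho> t)) p / \<rho> t p \<partial>\<mu>)
              + m * (\<alpha> t)\<^sup>2 \<ge> 0))"
proof -
  interpret W: weighted_manifold M A g \<nu> f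
    using manifold volume f_C2 by (simp add: weighted_manifold_def)
  define I where "I = {0<..<T}"
  have e: "c\<^sup>2 > 0" using c_pos by simp
  interpret F: entropy_flow M A g \<nu> f I \<rho> \<phi> "c\<^sup>2"
  proof unfold_locales
    show "open I" "c\<^sup>2 > 0" using e by (simp_all add: I_def)
    show smooth: "smooth_spacetime A I \<rho>" "smooth_spacetime A I \<phi>" using rho_smooth phi_smooth by (simp_all add: I_def)
    show "\<rho> t p > 0" if "t \<in> I" "p \<in> M" for t p using rho_pos that by (simp add: I_def)
    have slice: "Ck_function A k (\<rho> t)" "Ck_function A k (\<phi> t)" if "t \<in> I" for k t
      using W.Ck_function_slice[OF \<open>open I\<close> _ that] smooth by blast+
    show "time_deriv \<rho> t p = - (\<rho> t p * W.wlap (\<phi> t) p + W.ginner (\<rho> t) (\<phi> t) p)" if "t \<in> I" "p \<in> M" for t p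
      using continuity_eq[of t p] that W.nabla_mu_adj_grad[OF slice that(2)] by (simp add: I_def time_deriv_def)
    show "c\<^sup>2 * (time_deriv \<phi> t p + 1/2 * W.ginner (\<phi> t) (\<phi> t) p) = - \<phi> t p - ln (\<rho> t p) - 1" if "t \<in> I" "p \<in> M" for t p
      using potential_eq[of t p] that by (simp add: I_def time_deriv_def W.rinner_grad)
  qed
  define E where "E = (\<lambda>s. Ent \<mu> (\<rho> s))"
  define D where "D = (\<lambda>s. \<integral>p. W.ginner (\<rho> s) (\<phi> s) p \<partial>\<mu>)"
  define L where "L = (\<lambda>t. deriv (deriv E) t + (2 * \<alpha> t + 1 / c\<^sup>2) * deriv E t
        + 1 / c\<^sup>2 * (\<integral>p. rinner A g (grad g (\<rho> t)) (grad g (\<rho> t)) p / \<rho> t p \<partial>\<mu>) + m * (\<alpha> t)\<^sup>2)"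
  define N where "N = (\<lambda>t p. (tensor_norm2 A g (\<lambda>x q. Hess g (\<phi> t) x q - \<alpha> t *\<^sub>R g x q) p
                     + tensor_eval A (Ric_mn m g f) (grad g (\<phi> t)) (grad g (\<phi> t)) p) * \<rho> t p)"
  define R where "R = (\<lambda>t p. \<bar>\<alpha> t + rinner A g (grad g (\<phi> t)) (grad g f) p / (m - real CARD('n))\<bar>\<^sup>2 * \<rho> t p)"
  have main: "E differentiable (at t) \<and> deriv E differentiable (at t) \<and>
      L t = (\<integral>p. N t p \<partial>\<mu>) + (m - real CARD('n)) * (\<integral>p. R t p \<partial>\<mu>)" if t: "t \<in> {0<..<T}" for t
  proof -
    have tI: "t \<in> I" using t by (simp add: I_def)
    have dE: "(E has_real_derivative D s) (at s)" if "s \<in> I" for s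
      using F.entropy_deriv[OF that] by (simp add: E_def D_def mu)
    then have dE': "deriv E s = D s" if "s \<in> I" for s using DERIV_imp_deriv that by blast
    define D2 where "D2 = (\<integral>p. \<rho> t p * (W.wlap (\<lambda>q. W.ginner (\<phi> t) (\<phi> t) q / 2) p - W.ginner (\<phi> t) (W.wlap (\<phi> t)) p) \<partial>\<mu>)"
    define Fi where "Fi = (\<integral>p. W.ginner (\<rho> t) (\<rho> t) p / \<rho> t p \<partial>\<mu>)"
    have "(D has_real_derivative D2 - 1 / c\<^sup>2 * (D t + Fi)) (at t)"
      using F.entropy_deriv2[OF tI] by (simp add: D_def D2_def Fi_def mu)
    \<comment> \<open>\<open>deriv E\<close> is known to equal \<open>D\<close> only on the open
      interval, which is enough for the derivative at \<open>t\<close>.\<close>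
    then have ddE: "(deriv E has_real_derivative D2 - 1 / c\<^sup>2 * (D t + Fi)) (at t)"
      by (rule has_field_derivative_transform_within_open[OF _ F.I tI]) (simp add: dE')
    have Fi: "(\<integral>p. rinner A g (grad g (\<rho> t)) (grad g (\<rho> t)) p / \<rho> t p \<partial>\<mu>) = Fi"
      unfolding Fi_def mu by (rule W.integral_mu_cong) (simp add: W.rinner_grad)
    have R: "(\<integral>p. R t p \<partial>\<mu>) = (\<integral>p. \<bar>\<alpha> t + W.ginner (\<phi> t) f p / (m - real CARD('n))\<bar>\<^sup>2 * \<rho> t p \<partial>\<mu>)"
      unfolding R_def mu by (rule W.integral_mu_cong) (simp add: W.rinner_grad)
    have prob: "(\<integral>p. \<rho> t p \<partial>weighted_measure \<nu> f) = 1" using rho_prob[OF t] by (simp add: mu)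
    have "(\<integral>p. N t p \<partial>\<mu>) + (m - real CARD('n)) * (\<integral>p. R t p \<partial>\<mu>) = D2 + 2 * \<alpha> t * D t + m * (\<alpha> t)\<^sup>2"
      unfolding R unfolding N_def D2_def D_def mu by (rule F.entropy_rhs[OF tI m_eq prob])
    \<comment> \<open>The terms with the factor \<open>1 / c\<^sup>2\<close> on the left cancel
      those in the second derivative of the entropy.\<close>
    moreover have "L t = D2 + 2 * \<alpha> t * D t + m * (\<alpha> t)\<^sup>2"
      unfolding L_def Fi dE'[OF tI] DERIV_imp_deriv[OF ddE] by (simp add: algebra_simps add_divide_distrib)
    ultimately show ?thesis
      using dE[OF tI] ddE by (auto simp: real_differentiable_def)
  qed
  have "L t \<ge> 0" if nn: "tensor_nonneg A (Ric_mn m g f)" and t: "t \<in> {0<..<T}" for t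
  proof -
    have "N t p \<ge> 0" if p: "p \<in> M" for p
    proof -
      have "tensor_eval A (Ric_mn m g f) (grad g (\<phi> t)) (grad g (\<phi> t)) p \<ge> 0"
        using nn W.chart_at[OF p] by (simp add: tensor_nonneg_def tensor_eval_def Let_def)
      then show ?thesis using W.tensor_norm2_nonneg[OF p] rho_pos[OF t p] by (simp add: N_def)
    qed
    then have "(\<integral>p. N t p \<partial>\<mu>) \<ge> 0"
      using W.space_mu mu by (intro integral_nonneg_AE AE_I2) auto
    moreover have "(\<integral>p. R t p \<partial>\<mu>) \<ge> 0"
      using W.space_mu mu rho_pos[OF t] by (intro integral_nonneg_AE AE_I2) (auto simp: R_def less_imp_le)
    \<comment> \<open>The factor m - n in front of the second integral is nonnegative.\<close>
    ultimately show ?thesis using main[OF t] m_ge by simp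
  qed
  with main show ?thesis unfolding L_def N_def R_def E_def by blast
qed

end
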